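(* Let $A$ be a ring that is either a Noetherian local ring or a standard graded ring, let $I\subset A$ be an ideal, and let $x_1,\ldots,x_r$ be an $A$-regular sequence contained in $I$ (in the graded case, $I$ and all the $x_i$ are homogeneous). Then the following conditions are equivalent: (i) $\sqrt{I}=\sqrt{(x_1,\ldots,x_r)}$; (ii) $x_1,\ldots,x_r$ form a coregular sequence for the local cohomology module $H^r_I(A)$, and $H^i_I(A)=0$ for all $i>r$.
   Context: A standard graded ring means a Noetherian graded ring generated by its degree-one elements over a field $A_0$; in the graded case all modules are graded and all ideals and elements are homogeneous. Coregular sequence: let $I$ be an ideal of $A$ and $M$ a non-zero $A$-module with $\operatorname{Supp}(M)\subset V(I)$. A sequence $x_1,\ldots,x_r$ of elements of $I$ is coregular for $M$ if $x_1M=M$ and, for each $1\le i\le r-1$, $x_{i+1}\,(0:_M(x_1,\ldots,x_i))=0:_M(x_1,\ldots,x_i)$. (The definition includes the requirement $M\neq 0$.) *)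

theory Defs
  imports "HOL-Algebra.Module" "HOL-Algebra.Ideal_Product" "HOL-Algebra.Generated_Rings"
    "HOL-Algebra.Ring_Divisibility"
begin

section \<open>Rings\<close>

definition noetherian_local_ring :: "('a, 'c) ring_scheme \<Rightarrow> bool" where
  "noetherian_local_ring R \<longleftrightarrow> cring R \<and> noetherian_ring R \<and> (\<exists>!m. maximalideal m R)"

definition ring_grading :: "('a, 'c) ring_scheme \<Rightarrow> (nat \<Rightarrow> 'a set) \<Rightarrow> bool" where
  "ring_grading R \<A> \<longleftrightarrow>
     (\<forall>n. additive_subgroup (\<A> n) R) \<and>
     (\<forall>m n. \<forall>a\<in>\<A> m. \<forall>b\<in>\<A> n. a \<otimes>\<^bsub>R\<^esub> b \<in> \<A> (m + n)) \<and>
     (\<forall>a\<in>carrier R. \<exists>!f. (\<forall>n. f n \<in> \<A> n) \<and> finite {n. f n \<noteq> \<zero>\<^bsub>R\<^esub>} \<and>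
        a = finsum R f {n. f n \<noteq> \<zero>\<^bsub>R\<^esub>})"

definition standard_graded_ring :: "('a, 'c) ring_scheme \<Rightarrow> (nat \<Rightarrow> 'a set) \<Rightarrow> bool" where
  "standard_graded_ring R \<A> \<longleftrightarrow>
     cring R \<and> noetherian_ring R \<and> ring_grading R \<A> \<and> subfield (\<A> 0) R \<and>
     generate_ring R (\<A> 0 \<union> \<A> 1) = carrier R"

definition homogeneous_element :: "(nat \<Rightarrow> 'a set) \<Rightarrow> 'a \<Rightarrow> bool" where
  "homogeneous_element \<A> a \<longleftrightarrow> (\<exists>n. a \<in> \<A> n)"

definition homogeneous_ideal :: "('a, 'c) ring_scheme \<Rightarrow> (nat \<Rightarrow> 'a set) \<Rightarrow> 'a set \<Rightarrow> bool" where
  "homogeneous_ideal R \<A> I \<longleftrightarrow> ideal I R \<and> I = Idl\<^bsub>R\<^esub> {a \<in> I. homogeneous_element \<A> a}"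

definition radical :: "('a, 'c) ring_scheme \<Rightarrow> 'a set \<Rightarrow> 'a set" where
  "radical R I = {a \<in> carrier R. \<exists>n::nat. a [^]\<^bsub>R\<^esub> n \<in> I}"

text \<open>The entry \<open>xs ! i\<close> is a non-zero-divisor on \<open>R / (xs ! 0, \<dots>, xs ! (i - 1))\<close>,
  and \<open>R / (xs) \<noteq> 0\<close>.\<close>

definition regular_sequence :: "('a, 'c) ring_scheme \<Rightarrow> 'a list \<Rightarrow> bool" where
  "regular_sequence R xs \<longleftrightarrow>
     set xs \<subseteq> carrier R \<and>
     (\<forall>i<length xs. \<forall>a\<in>carrier R.
        (xs ! i) \<otimes>\<^bsub>R\<^esub> a \<in> Idl\<^bsub>R\<^esub> (set (take i xs)) \<longrightarrow> a \<in> Idl\<^bsub>R\<^esub> (set (take i xs))) \<and>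
     Idl\<^bsub>R\<^esub> (set xs) \<noteq> carrier R"


section \<open>Modules\<close>

definition regular_module :: "('a, 'c) ring_scheme \<Rightarrow> ('a, 'a) module" where
  "regular_module R =
     \<lparr>carrier = carrier R, monoid.mult = monoid.mult R, one = one R, zero = zero R, add = add R,
      smult = monoid.mult R\<rparr>"

definition mod_hom :: "('a, 'c) ring_scheme \<Rightarrow> ('a, 'm) module \<Rightarrow> ('a, 'n) module \<Rightarrow>
    ('m \<Rightarrow> 'n) set" where
  "mod_hom R M N =
     {f \<in> carrier M \<rightarrow> carrier N.
        (\<forall>x\<in>carrier M. \<forall>y\<in>carrier M. f (x \<oplus>\<^bsub>M\<^esub> y) = f x \<oplus>\<^bsub>N\<^esub> f y) \<and>
        (\<forall>a\<in>carrier R. \<forall>x\<in>carrier M. f (a \<odot>\<^bsub>M\<^esub> x) = a \<odot>\<^bsub>N\<^esub> f x)}"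

text \<open>The fields \<open>mult\<close> and \<open>one\<close> of a module record play no role in the locale \<open>module\<close>.\<close>

definition quotient_module :: "('a, 'm) module \<Rightarrow> 'm set \<Rightarrow> ('a, 'm set) module" where
  "quotient_module M N =
     \<lparr>carrier = a_rcosets\<^bsub>M\<^esub> N, monoid.mult = undefined, one = undefined, zero = N, add = set_add M,
      smult = (\<lambda>a X. \<Union>x\<in>X. N +>\<^bsub>M\<^esub> (a \<odot>\<^bsub>M\<^esub> x))\<rparr>"

definition zero_module :: "('a, 'm) module \<Rightarrow> bool" where
  "zero_module M \<longleftrightarrow> carrier M = {\<zero>\<^bsub>M\<^esub>}"

definition colon_zero :: "('a, 'm) module \<Rightarrow> 'a set \<Rightarrow> 'm set" where
  "colon_zero M J = {m \<in> carrier M. \<forall>a\<in>J. a \<odot>\<^bsub>M\<^esub> m = \<zero>\<^bsub>M\<^esub>}"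

text \<open>A fraction \<open>m / s\<close> is zero in the localization \<open>M\<^sub>P\<close> iff \<open>u \<odot> m = \<zero>\<close> for some
  \<open>u \<notin> P\<close>; the condition below is therefore \<open>M\<^sub>P \<noteq> 0\<close> written out.\<close>

definition module_support :: "('a, 'c) ring_scheme \<Rightarrow> ('a, 'm) module \<Rightarrow> 'a set set" where
  "module_support R M =
     {P. primeideal P R \<and> (\<exists>m\<in>carrier M. \<forall>u\<in>carrier R - P. u \<odot>\<^bsub>M\<^esub> m \<noteq> \<zero>\<^bsub>M\<^esub>)}"

definition prime_locus :: "('a, 'c) ring_scheme \<Rightarrow> 'a set \<Rightarrow> 'a set set" where
  "prime_locus R I = {P. primeideal P R \<and> I \<subseteq> P}"

text \<open>Indices start at \<open>0\<close>. The condition for \<open>i = 0\<close> is \<open>x\<^sub>1 M = M\<close>, because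
  \<open>Idl (set (take 0 xs)) = {\<zero>}\<close>. The empty sequence is coregular iff \<open>M \<noteq> 0\<close>
  and \<open>Supp M \<subseteq> V(I)\<close>.\<close>

definition coregular_sequence :: "('a, 'c) ring_scheme \<Rightarrow> 'a set \<Rightarrow> ('a, 'm) module \<Rightarrow>
    'a list \<Rightarrow> bool" where
  "coregular_sequence R I M xs \<longleftrightarrow>
     ideal I R \<and> module R M \<and> \<not> zero_module M \<and> module_support R M \<subseteq> prime_locus R I \<and>
     set xs \<subseteq> I \<and>
     (\<forall>i<length xs.
        (\<lambda>m. (xs ! i) \<odot>\<^bsub>M\<^esub> m) ` colon_zero M (Idl\<^bsub>R\<^esub> (set (take i xs))) =
          colon_zero M (Idl\<^bsub>R\<^esub> (set (take i xs))))"


section \<open>Local cohomology\<close>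

text \<open>The test modules range over the type \<open>'a\<close> of ring elements, since a definition cannot
  quantify over types. This loses nothing: all ideals of \<open>R\<close>, as \<open>R\<close>-modules, are among the
  test modules, so by Baer's criterion the extension property holds for monomorphisms between
  \<open>R\<close>-modules over arbitrary types.\<close>

definition injective_module :: "('a, 'c) ring_scheme \<Rightarrow> ('a, 'm) module \<Rightarrow> bool" where
  "injective_module R E \<longleftrightarrow> module R E \<and>
     (\<forall>(M :: ('a, 'a) module) (N :: ('a, 'a) module) i f.
        module R M \<and> module R N \<and> i \<in> mod_hom R M N \<and> inj_on i (carrier M) \<and>
        f \<in> mod_hom R M E \<longrightarrow>
        (\<exists>g\<in>mod_hom R N E. \<forall>x\<in>carrier M. g (i x) = f x))"

text \<open>\<open>0 \<rightarrow> M \<rightarrow> E 0 \<rightarrow> E 1 \<rightarrow> \<dots>\<close> is exact with augmentation \<open>\<epsilon>\<close>.\<close>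

definition injective_resolution :: "('a, 'c) ring_scheme \<Rightarrow> ('a, 'm) module \<Rightarrow>
    (nat \<Rightarrow> ('a, 'n) module) \<Rightarrow> (nat \<Rightarrow> 'n \<Rightarrow> 'n) \<Rightarrow> ('m \<Rightarrow> 'n) \<Rightarrow> bool" where
  "injective_resolution R M E d \<epsilon> \<longleftrightarrow>
     module R M \<and>
     (\<forall>i. injective_module R (E i)) \<and>
     \<epsilon> \<in> mod_hom R M (E 0) \<and> inj_on \<epsilon> (carrier M) \<and>
     (\<forall>i. d i \<in> mod_hom R (E i) (E (Suc i))) \<and>
     a_kernel (E 0) (E 1) (d 0) = \<epsilon> ` carrier M \<and>
     (\<forall>i. a_kernel (E (Suc i)) (E (Suc (Suc i))) (d (Suc i)) = d i ` carrier (E i))"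

definition torsion :: "('a, 'c) ring_scheme \<Rightarrow> 'a set \<Rightarrow> ('a, 'm) module \<Rightarrow> ('a, 'm) module" where
  "torsion R I M =
     M\<lparr>carrier := {m \<in> carrier M. \<exists>n::nat. \<forall>a \<in> I [^]\<^bsub>ideals_set R\<^esub> n. a \<odot>\<^bsub>M\<^esub> m = \<zero>\<^bsub>M\<^esub>}\<rparr>"

definition cohomology :: "(nat \<Rightarrow> ('a, 'n) module) \<Rightarrow> (nat \<Rightarrow> 'n \<Rightarrow> 'n) \<Rightarrow> nat \<Rightarrow>
    ('a, 'n set) module" where
  "cohomology C d i =
     quotient_module ((C i)\<lparr>carrier := a_kernel (C i) (C (Suc i)) (d i)\<rparr>)
       (case i of 0 \<Rightarrow> {\<zero>\<^bsub>C 0\<^esub>} | Suc j \<Rightarrow> d j ` carrier (C j))"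

text \<open>If \<open>(E, d)\<close> is an injective resolution of \<open>M\<close>, this is \<open>H\<^sup>i\<^sub>I(M)\<close>, the \<open>i\<close>-th right
  derived functor of \<open>\<Gamma>\<^sub>I\<close> at \<open>M\<close>. It does not depend on the resolution up to isomorphism.
  Statements about \<open>H\<^sup>i\<^sub>I(M)\<close> are made for every injective resolution over every type;
  for sufficiently large types, such as \<open>('a \<times> 'm \<times> nat) set\<close>, one exists.\<close>

definition local_cohomology :: "('a, 'c) ring_scheme \<Rightarrow> 'a set \<Rightarrow> (nat \<Rightarrow> ('a, 'n) module) \<Rightarrow>
    (nat \<Rightarrow> 'n \<Rightarrow> 'n) \<Rightarrow> nat \<Rightarrow> ('a, 'n set) module" where
  "local_cohomology R I E d i = cohomology (\<lambda>j. torsion R I (E j)) d i"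

end

theory Submission
  imports Defs
begin

text \<open>
  Let \<open>r\<close> be the length of \<open>xs\<close> and \<open>E\<close> an injective resolution of \<open>R\<close>. Each entry of \<open>xs\<close> acts
  surjectively on the complexes \<open>F k = 0 :\<^sub>E (x\<^sub>1, \<dots>, x\<^sub>k)\<close> and on their torsion subcomplexes
  \<open>G k = \<Gamma>\<^sub>I (F k)\<close>. So \<open>F r\<close> has cohomology \<open>B = R / (xs)\<close>, in degree \<open>r\<close> only, and there are long
  exact sequences relating \<open>G (k + 1)\<close> to multiplication by \<open>x\<^bsub>k+1\<^esub>\<close> on the cohomology of \<open>G k\<close>.

  If \<open>I\<close> and \<open>(xs)\<close> have the same radical, then \<open>G r = F r\<close>. Descending in \<open>k\<close>, the element \<open>x\<^bsub>k+1\<^esub>\<close> is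
  injective on the cohomology of \<open>G k\<close> outside degree \<open>r\<close>, where all classes are torsion; so that cohomology
  vanishes, and its vanishing in degree \<open>r + 1\<close> makes \<open>x\<^bsub>k+1\<^esub>\<close> surjective in degree \<open>r\<close>.

  Conversely, the hypotheses give, ascending in \<open>k\<close>, that \<open>G r\<close> has no cohomology above degree \<open>r\<close>. A
  generator \<open>y\<close> of \<open>I\<close> acts bijectively on the quotient of a torsion subcomplex of \<open>F r\<close> by its
  \<open>y\<close>-torsion. Forming the mapping cones of the generators one after the other, one finds that
  \<open>\<Gamma>\<^sub>I(B) \<rightarrow> B / I B\<close> is surjective. Hence some \<open>a \<in> I\<close> has the property that every \<open>y \<in> I\<close> satisfies
  \<open>(1 - a) y\<^sup>n \<in> (xs)\<close> for some \<open>n\<close>, and \<open>y\<^sup>n \<in> (xs)\<close> follows because \<open>1 - a\<close> is a unit (local case) or by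
  comparing degrees (graded case).
\<close>


section \<open>Modules and ideals of Noetherian rings\<close>

text \<open>The surjectivity of \<open>\<Gamma>_I(B) -> B / I B\<close> is a Koszul argument. The
  Koszul complex of generators of \<open>I\<close> over \<open>B\<close> has
  \<open>I\<close>-torsion cohomology, so replacing \<open>B\<close> by its derived
  \<open>I\<close>-torsion does not change it. The vanishing above degree \<open>r\<close> reduces
  the derived torsion to \<open>\<Gamma>_I(B)\<close>, and comparing top cohomology gives
  \<open>\<Gamma>_I(B) / I \<Gamma>_I(B) = B / I B\<close>; the element \<open>1 - a\<close>
  represents a torsion preimage of \<open>1\<close>. Dividing by \<open>y\<close>-torsion takes the
  place of localising at \<open>y\<close>. Two obstacles shape the setup. The terms of
  \<open>F r\<close> are injective over \<open>R / (xs)\<close> and not over \<open>R\<close>, and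
  injectivity as defined is bound to one type of test modules. Both are met by carrying Baer's
  criterion relative to an ideal, for subsets of fixed ambient modules. That \<open>I\<close> is
  proper, without which \<open>1 - a\<close> could be zero, comes from the non-vanishing of the
  local cohomology in degree \<open>r\<close> that coregularity includes.\<close>

context module
begin

lemma add_diff_eq: "x \<in> carrier M \<Longrightarrow> y \<in> carrier M \<Longrightarrow> z \<in> carrier M \<Longrightarrow>
    x \<oplus>\<^bsub>M\<^esub> (y \<ominus>\<^bsub>M\<^esub> z) = (x \<oplus>\<^bsub>M\<^esub> y) \<ominus>\<^bsub>M\<^esub> z"
  by (simp add: a_minus_def M.a_assoc)

lemma diff_add_eq: "x \<in> carrier M \<Longrightarrow> y \<in> carrier M \<Longrightarrow> z \<in> carrier M \<Longrightarrow>
    (x \<ominus>\<^bsub>M\<^esub> z) \<oplus>\<^bsub>M\<^esub> y = (x \<oplus>\<^bsub>M\<^esub> y) \<ominus>\<^bsub>M\<^esub> z"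
  by (simp add: a_minus_def M.a_ac)

lemma diff_diff_left: "x \<in> carrier M \<Longrightarrow> y \<in> carrier M \<Longrightarrow> z \<in> carrier M \<Longrightarrow>
    (x \<ominus>\<^bsub>M\<^esub> y) \<ominus>\<^bsub>M\<^esub> z = x \<ominus>\<^bsub>M\<^esub> (y \<oplus>\<^bsub>M\<^esub> z)"
  by (simp add: a_minus_def M.minus_add M.a_ac)

lemma diff_diff_right: "x \<in> carrier M \<Longrightarrow> y \<in> carrier M \<Longrightarrow> z \<in> carrier M \<Longrightarrow>
    x \<ominus>\<^bsub>M\<^esub> (y \<ominus>\<^bsub>M\<^esub> z) = (x \<oplus>\<^bsub>M\<^esub> z) \<ominus>\<^bsub>M\<^esub> y"
  by (simp add: a_minus_def M.minus_add M.a_ac)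

lemma diff_eq_iff: "x \<in> carrier M \<Longrightarrow> y \<in> carrier M \<Longrightarrow> z \<in> carrier M \<Longrightarrow>
    (x \<ominus>\<^bsub>M\<^esub> y = z) = (x = z \<oplus>\<^bsub>M\<^esub> y)"
  by (metis M.add.inv_solve_right a_minus_def M.a_closed)

lemma eq_diff_iff: "x \<in> carrier M \<Longrightarrow> y \<in> carrier M \<Longrightarrow> z \<in> carrier M \<Longrightarrow>
    (z = x \<ominus>\<^bsub>M\<^esub> y) = (z \<oplus>\<^bsub>M\<^esub> y = x)"
  using diff_eq_iff by metis

lemma smult_r_diff: "a \<in> carrier R \<Longrightarrow> x \<in> carrier M \<Longrightarrow> y \<in> carrier M \<Longrightarrow>
    a \<odot>\<^bsub>M\<^esub> (x \<ominus>\<^bsub>M\<^esub> y) = a \<odot>\<^bsub>M\<^esub> x \<ominus>\<^bsub>M\<^esub> a \<odot>\<^bsub>M\<^esub> y"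
  by (simp add: a_minus_def smult_r_distr smult_r_minus)

lemma smult_l_diff: "a \<in> carrier R \<Longrightarrow> b \<in> carrier R \<Longrightarrow> x \<in> carrier M \<Longrightarrow>
    (a \<ominus> b) \<odot>\<^bsub>M\<^esub> x = a \<odot>\<^bsub>M\<^esub> x \<ominus>\<^bsub>M\<^esub> b \<odot>\<^bsub>M\<^esub> x"
  by (simp add: a_minus_def smult_l_distr smult_l_minus)

lemma smult_lcomm: "a \<in> carrier R \<Longrightarrow> b \<in> carrier R \<Longrightarrow> x \<in> carrier M \<Longrightarrow>
    a \<odot>\<^bsub>M\<^esub> (b \<odot>\<^bsub>M\<^esub> x) = b \<odot>\<^bsub>M\<^esub> (a \<odot>\<^bsub>M\<^esub> x)"
  by (metis smult_assoc1 R.m_comm)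

text \<open>Used as one rewriting system: differences are moved across the equation and scalars
  inwards until both sides are sums, which \<open>M.a_ac\<close> then sorts.\<close>

lemmas module_simps = add_diff_eq diff_add_eq diff_diff_left diff_diff_right diff_eq_iff eq_diff_iff
  smult_r_diff smult_l_diff smult_lcomm smult_r_distr smult_l_distr smult_assoc1 M.a_ac

lemma smult_pow_zero_mono:
  assumes "a \<in> carrier R" "x \<in> carrier M" "(a [^] k) \<odot>\<^bsub>M\<^esub> x = \<zero>\<^bsub>M\<^esub>" "k \<le> (n::nat)"
  shows "(a [^] n) \<odot>\<^bsub>M\<^esub> x = \<zero>\<^bsub>M\<^esub>"
proof -
  have "a [^] n = a [^] (n - k) \<otimes> a [^] k"
    using assms by (simp add: R.nat_pow_mult)
  then show ?thesis using assms by (simp add: smult_assoc1)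
qed

end

definition annihilator :: "('a, 'c) ring_scheme \<Rightarrow> ('a, 'm, 'e) module_scheme \<Rightarrow> 'm \<Rightarrow> 'a set" where
  "annihilator R M m = {a \<in> carrier R. a \<odot>\<^bsub>M\<^esub> m = \<zero>\<^bsub>M\<^esub>}"

lemma (in module) ideal_annihilator:
  assumes "m \<in> carrier M"
  shows "ideal (annihilator R M m) R"
proof (rule idealI)
  show "ring R" by (rule R.ring_axioms)
  show "subgroup (annihilator R M m) (add_monoid R)"
    using assms by (intro R.add.subgroupI)
      (auto simp: annihilator_def smult_l_distr smult_l_minus simp flip: a_inv_def)
  show "x \<otimes> a \<in> annihilator R M m" if "a \<in> annihilator R M m" "x \<in> carrier R" for a x
    using that assms by (simp add: annihilator_def smult_assoc1)
  then show "a \<otimes> x \<in> annihilator R M m" if "a \<in> annihilator R M m" "x \<in> carrier R" for a x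
    using that R.m_comm[of a x] by (simp add: annihilator_def)
qed

lemma (in ring) ideal_closed:
  assumes "ideal Q R"
  shows "\<zero> \<in> Q" "a \<in> Q \<Longrightarrow> a \<in> carrier R" "a \<in> Q \<Longrightarrow> b \<in> Q \<Longrightarrow> a \<oplus> b \<in> Q"
    "a \<in> Q \<Longrightarrow> b \<in> Q \<Longrightarrow> a \<ominus> b \<in> Q" "a \<in> Q \<Longrightarrow> \<ominus> a \<in> Q"
    "r \<in> carrier R \<Longrightarrow> a \<in> Q \<Longrightarrow> r \<otimes> a \<in> Q" "r \<in> carrier R \<Longrightarrow> a \<in> Q \<Longrightarrow> a \<otimes> r \<in> Q"
proof -
  interpret ideal Q R by fact
  show "\<zero> \<in> Q" "a \<in> Q \<Longrightarrow> a \<in> carrier R" "a \<in> Q \<Longrightarrow> b \<in> Q \<Longrightarrow> a \<oplus> b \<in> Q"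
    "a \<in> Q \<Longrightarrow> \<ominus> a \<in> Q"
    "r \<in> carrier R \<Longrightarrow> a \<in> Q \<Longrightarrow> r \<otimes> a \<in> Q" "r \<in> carrier R \<Longrightarrow> a \<in> Q \<Longrightarrow> a \<otimes> r \<in> Q"
    by (auto intro: I_l_closed I_r_closed)
  then show "a \<in> Q \<Longrightarrow> b \<in> Q \<Longrightarrow> a \<ominus> b \<in> Q"
    by (simp add: a_minus_def)
qed

text \<open>A non-empty chain of ideals contains its own union by the Noetherian property, so Zorn's
  lemma applies although the family need not be closed under unions.\<close>

lemma (in noetherian_ring) maximal_in_ideal_family:
  assumes "\<F> \<noteq> {}" "\<And>Q. Q \<in> \<F> \<Longrightarrow> ideal Q R"
  obtains Q where "Q \<in> \<F>" "\<And>Q'. Q' \<in> \<F> \<Longrightarrow> Q \<subseteq> Q' \<Longrightarrow> Q' = Q"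
proof -
  have "\<exists>Q\<in>\<F>. \<forall>Q'\<in>\<F>. Q \<subseteq> Q' \<longrightarrow> Q' = Q"
  proof (rule subset_Zorn)
    fix C assume C: "subset.chain \<F> C"
    show "\<exists>U\<in>\<F>. \<forall>Q\<in>C. Q \<subseteq> U"
    proof (cases "C = {}")
      case True then show ?thesis using assms(1) by auto
    next
      case False
      have "subset.chain {I. ideal I R} C"
        using C assms(2) by (auto simp: pred_on.chain_def)
      then have "\<Union>C \<in> C" using ideal_chain_is_trivial False by blast
      moreover have "C \<subseteq> \<F>" using C by (auto simp: pred_on.chain_def)
      ultimately show ?thesis by blast
    qed
  qed
  then show ?thesis using that by blast
qed

lemma (in cring) set_add_cgenideal:
  assumes "ideal Q R" "a \<in> carrier R"
  shows "ideal (Q <+>\<^bsub>R\<^esub> PIdl a) R" "Q \<subseteq> Q <+>\<^bsub>R\<^esub> PIdl a" "a \<in> Q <+>\<^bsub>R\<^esub> PIdl a"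
    "b \<in> Q <+>\<^bsub>R\<^esub> PIdl a \<longleftrightarrow> (\<exists>q\<in>Q. \<exists>c\<in>carrier R. b = q \<oplus> c \<otimes> a)"
proof -
  have mem: "b \<in> Q <+>\<^bsub>R\<^esub> PIdl a \<longleftrightarrow> (\<exists>q\<in>Q. \<exists>c\<in>carrier R. b = q \<oplus> c \<otimes> a)" for b
    by (auto simp: set_add_def' cgenideal_def)
  show "ideal (Q <+>\<^bsub>R\<^esub> PIdl a) R"
    by (intro add_ideals cgenideal_ideal assms)
  show "Q \<subseteq> Q <+>\<^bsub>R\<^esub> PIdl a"
  proof
    fix q assume q: "q \<in> Q"
    then have "q = q \<oplus> \<zero> \<otimes> a" using assms ideal_closed(2)[OF assms(1)] by simp
    then show "q \<in> Q <+>\<^bsub>R\<^esub> PIdl a" using q mem by blast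
  qed
  have "a = \<zero> \<oplus> \<one> \<otimes> a" using assms by simp
  then show "a \<in> Q <+>\<^bsub>R\<^esub> PIdl a" using mem ideal_closed(1)[OF assms(1)] by blast
  show "b \<in> Q <+>\<^bsub>R\<^esub> PIdl a \<longleftrightarrow> (\<exists>q\<in>Q. \<exists>c\<in>carrier R. b = q \<oplus> c \<otimes> a)"
    by (rule mem)
qed

section \<open>Colon ideals and powers of ideals\<close>

locale noetherian_cring = noetherian_ring R + cring R for R (structure)

context noetherian_cring
begin

lemma colon_ideal:
  assumes "ideal Q R" "a \<in> carrier R"
  shows "ideal {b \<in> carrier R. a \<otimes> b \<in> Q} R"
  by (rule ideal.helper_max_prime[OF assms(1) _ assms(2)]) (rule is_cring)

text \<open>The colon ideals of the powers of \<open>a\<close> ascend, so a maximal one among them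
  equals all later ones. Beyond this \<open>k\<close>, surplus factors \<open>a\<close> can be
  cancelled modulo \<open>Q\<close> even when \<open>a\<close> is a zero divisor there.\<close>

lemma colon_stabilizes:
  assumes Q: "ideal Q R" and a: "a \<in> carrier R"
  obtains k :: nat where
    "\<And>n b. b \<in> carrier R \<Longrightarrow> a [^] (k + n) \<otimes> b \<in> Q \<Longrightarrow> a [^] k \<otimes> b \<in> Q"
proof -
  define K where "K k = {b \<in> carrier R. a [^] (k::nat) \<otimes> b \<in> Q}" for k
  obtain Q0 where Q0: "Q0 \<in> range K" "\<And>Q'. Q' \<in> range K \<Longrightarrow> Q0 \<subseteq> Q' \<Longrightarrow> Q' = Q0"
    by (rule maximal_in_ideal_family[of "range K"]) (auto simp: K_def intro: colon_ideal Q a)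
  then obtain k where k: "Q0 = K k" by blast
  have "K k \<subseteq> K (k + n)" for n
  proof
    fix b assume "b \<in> K k"
    moreover have "b \<in> carrier R \<Longrightarrow> a [^] (k + n) \<otimes> b = a [^] n \<otimes> (a [^] k \<otimes> b)"
      using a by (simp add: m_assoc[symmetric] nat_pow_mult add.commute)
    ultimately show "b \<in> K (k + n)"
      using a ideal_closed(6)[OF Q] by (simp add: K_def)
  qed
  then have "K (k + n) = K k" for n using Q0(2)[of "K (k + n)"] k by blast
  then show ?thesis using that[of k] unfolding K_def by blast
qed

lemma ideals_pow:
  assumes "ideal I R"
  shows "ideal (I [^]\<^bsub>ideals_set R\<^esub> (n::nat)) R"
    "I [^]\<^bsub>ideals_set R\<^esub> (m + n) = (I [^]\<^bsub>ideals_set R\<^esub> m) \<cdot> (I [^]\<^bsub>ideals_set R\<^esub> n)"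
proof -
  interpret S: comm_monoid "ideals_set R" by (rule ideals_set_is_comm_monoid)
  have I: "I \<in> carrier (ideals_set R)" using assms by (simp add: ideals_set_def)
  show "ideal (I [^]\<^bsub>ideals_set R\<^esub> n) R"
    using S.nat_pow_closed[OF I, of n] by (simp add: ideals_set_def)
  show "I [^]\<^bsub>ideals_set R\<^esub> (m + n) = (I [^]\<^bsub>ideals_set R\<^esub> m) \<cdot> (I [^]\<^bsub>ideals_set R\<^esub> n)"
    using S.nat_pow_mult[OF I, of m n] by (simp add: ideals_set_def)
qed

lemma pow_mem_ideals_pow:
  assumes "ideal I R" "a \<in> I"
  shows "a [^] n \<in> I [^]\<^bsub>ideals_set R\<^esub> (n::nat)"
proof (induction n)
  case 0
  then show ?case by (simp add: ideals_set_def)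
next
  case (Suc n)
  then show ?case using assms
    by (simp add: ideals_set_def ideal_prod.prod)
qed

text \<open>In the product of \<open>q + c a\<close> and \<open>q' + c' b\<close> every term
  contains \<open>q\<close>, \<open>q'\<close> or \<open>a \<otimes> b\<close>. This yields
  primeness of the maximal counterexample in \<open>ideals_pow_subset\<close>.\<close>

lemma ideal_prod_add_subset:
  assumes Q: "ideal Q R" and ab: "a \<in> carrier R" "b \<in> carrier R" "a \<otimes> b \<in> Q"
    and J: "J \<subseteq> Q <+>\<^bsub>R\<^esub> PIdl a" "K \<subseteq> Q <+>\<^bsub>R\<^esub> PIdl b"
  shows "J \<cdot> K \<subseteq> Q"
proof
  fix s assume "s \<in> J \<cdot> K"
  then show "s \<in> Q"
  proof induction
    case (prod i j)
    then obtain q c q' c' where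
      *: "q \<in> Q" "c \<in> carrier R" "i = q \<oplus> c \<otimes> a" "q' \<in> Q" "c' \<in> carrier R" "j = q' \<oplus> c' \<otimes> b"
      using J set_add_cgenideal(4)[OF Q] ab by (metis subsetD)
    note [simp] = ideal_closed(2)[OF Q]
    have "i \<otimes> j = q \<otimes> (q' \<oplus> c' \<otimes> b) \<oplus> (c \<otimes> a \<otimes> q' \<oplus> (c \<otimes> c') \<otimes> (a \<otimes> b))"
      using * ab by (simp add: r_distr l_distr m_ac a_ac)
    then show ?case using * ab by (simp add: ideal_closed(3,6,7)[OF Q])
  next
    case (sum s1 s2)
    then show ?case using ideal_closed(3)[OF Q] by simp
  qed
qed

text \<open>An ideal \<open>Q'\<close> maximal among those containing \<open>Q\<close> but no power of \<open>Idl Y\<close> would be prime,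
  hence would contain \<open>Y\<close>.\<close>

lemma ideals_pow_subset:
  assumes Q: "ideal Q R" and Y: "Y \<subseteq> carrier R" "\<And>y. y \<in> Y \<Longrightarrow> \<exists>k::nat. y [^] k \<in> Q"
  shows "\<exists>n::nat. (Idl Y) [^]\<^bsub>ideals_set R\<^esub> n \<subseteq> Q"
proof (rule ccontr)
  assume neg: "\<not> ?thesis"
  define \<F> where "\<F> = {Q'. ideal Q' R \<and> Q \<subseteq> Q' \<and> \<not> (\<exists>n::nat. (Idl Y) [^]\<^bsub>ideals_set R\<^esub> n \<subseteq> Q')}"
  obtain P where P: "P \<in> \<F>" and max: "\<And>Q'. Q' \<in> \<F> \<Longrightarrow> P \<subseteq> Q' \<Longrightarrow> Q' = P"
    by (rule maximal_in_ideal_family[of \<F>]) (use neg Q in \<open>auto simp: \<F>_def\<close>)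
  have idP: "ideal P R" and QP: "Q \<subseteq> P" using P by (auto simp: \<F>_def)
  have idY: "ideal (Idl Y) R" using genideal_ideal Y by blast
  have ex: "\<exists>n::nat. (Idl Y) [^]\<^bsub>ideals_set R\<^esub> n \<subseteq> P <+>\<^bsub>R\<^esub> PIdl a" if "a \<in> carrier R" "a \<notin> P" for a
  proof (rule ccontr)
    assume "\<not> ?thesis"
    then have "P <+>\<^bsub>R\<^esub> PIdl a \<in> \<F>"
      using set_add_cgenideal[OF idP that(1)] QP by (auto simp: \<F>_def)
    then have "P <+>\<^bsub>R\<^esub> PIdl a = P" using max set_add_cgenideal[OF idP that(1)] by blast
    then show False using set_add_cgenideal(3)[OF idP that(1)] that by blast
  qed
  have prime: "a \<in> P \<or> b \<in> P" if ab: "a \<in> carrier R" "b \<in> carrier R" "a \<otimes> b \<in> P" for a b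
  proof (rule ccontr)
    assume "\<not> ?thesis"
    then obtain m n :: nat where "(Idl Y) [^]\<^bsub>ideals_set R\<^esub> m \<subseteq> P <+>\<^bsub>R\<^esub> PIdl a"
      "(Idl Y) [^]\<^bsub>ideals_set R\<^esub> n \<subseteq> P <+>\<^bsub>R\<^esub> PIdl b"
      using ex ab by meson
    then have "(Idl Y) [^]\<^bsub>ideals_set R\<^esub> (m + n) \<subseteq> P"
      unfolding ideals_pow(2)[OF idY] using ideal_prod_add_subset[OF idP ab] by blast
    then show False using P by (auto simp: \<F>_def)
  qed
  have one: "\<one> \<notin> P"
  proof
    assume "\<one> \<in> P"
    then have "P = carrier R" using ideal.one_imp_carrier[OF idP] by blast
    \<comment> \<open>The power with exponent 0 is the whole ring, so properness of \<open>P\<close>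
      is the case of exponent 0 in the definition of the family.\<close>
    then have "(Idl Y) [^]\<^bsub>ideals_set R\<^esub> (0::nat) \<subseteq> P" by (simp add: ideals_set_def)
    then show False using P unfolding \<F>_def by blast
  qed
  have "y \<in> P" if y: "y \<in> Y" for y
  proof -
    have yc: "y \<in> carrier R" using y Y by blast
    have "y [^] k \<in> P \<Longrightarrow> y \<in> P" for k :: nat
    proof (induction k)
      case (Suc k)
      then show ?case using prime[of "y [^] k" y] yc by auto
    qed (use one in simp)
    then show ?thesis using Y(2)[OF y] QP by blast
  qed
  then have "Idl Y \<subseteq> P" using genideal_minimal[OF idP] by blast
  moreover have "(Idl Y) [^]\<^bsub>ideals_set R\<^esub> (1::nat) = Idl Y"
    using ideal_prod_one[OF idY] ideal_prod_commute[OF idY oneideal] by (simp add: ideals_set_def)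
  ultimately have "(Idl Y) [^]\<^bsub>ideals_set R\<^esub> (1::nat) \<subseteq> P" by simp
  then show False using P unfolding \<F>_def by blast
qed

text \<open>The \<open>n\<close>-th power of \<open>a\<close> lies in the \<open>n\<close>-th power
  of \<open>Idl Y\<close>, which is inside \<open>Q\<close> for some \<open>n\<close>. With
  \<open>Q\<close> an annihilator this reduces torsion to generators; in the graded case it reduces
  nilpotency to homogeneous elements.\<close>

lemma pow_mem_if_generators_pow_mem:
  assumes "ideal Q R" "Y \<subseteq> carrier R" "\<And>y. y \<in> Y \<Longrightarrow> \<exists>k::nat. y [^] k \<in> Q" "a \<in> Idl Y"
  shows "\<exists>k::nat. a [^] k \<in> Q"
  using ideals_pow_subset[OF assms(1-3)] pow_mem_ideals_pow[OF genideal_ideal[OF assms(2)] assms(4)]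
  by blast

end

section \<open>Baer's criterion and torsion\<close>

locale noetherian_module = module R M + noetherian_ring R for R (structure) and M (structure)

sublocale noetherian_module \<subseteq> noetherian_cring R ..

text \<open>The graph of a linear map from an ideal to \<open>M\<close>: differences of pairs stay
  in \<open>T\<close>, so the last clause is single-valuedness. As a relation, a partial map can be
  enlarged by adjoining pairs.\<close>

definition linear_graph :: "('a, 'c) ring_scheme \<Rightarrow> ('a, 'm, 'e) module_scheme \<Rightarrow> ('a \<times> 'm) set \<Rightarrow> bool" where
  "linear_graph R M T \<longleftrightarrow> T \<subseteq> carrier R \<times> carrier M \<and> (\<zero>\<^bsub>R\<^esub>, \<zero>\<^bsub>M\<^esub>) \<in> T \<and>
     (\<forall>a v b w. (a, v) \<in> T \<longrightarrow> (b, w) \<in> T \<longrightarrow> (a \<oplus>\<^bsub>R\<^esub> b, v \<oplus>\<^bsub>M\<^esub> w) \<in> T) \<and>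
     (\<forall>r a v. r \<in> carrier R \<longrightarrow> (a, v) \<in> T \<longrightarrow> (r \<otimes>\<^bsub>R\<^esub> a, r \<odot>\<^bsub>M\<^esub> v) \<in> T) \<and>
     (\<forall>v. (\<zero>\<^bsub>R\<^esub>, v) \<in> T \<longrightarrow> v = \<zero>\<^bsub>M\<^esub>)"

text \<open>The conclusion of Baer's criterion for \<open>S\<close> as a module over \<open>R / c\<close>: linear maps from ideals
  containing \<open>c\<close> that vanish on \<open>c\<close> extend to \<open>R\<close>. Maps are given by their graphs.\<close>

definition baer :: "('a, 'c) ring_scheme \<Rightarrow> 'a set \<Rightarrow> ('a, 'm, 'e) module_scheme \<Rightarrow> 'm set \<Rightarrow> bool" where
  "baer R c M S \<longleftrightarrow>
     (\<forall>T. linear_graph R M T \<and> snd ` T \<subseteq> S \<and> (\<forall>a\<in>c. (a, \<zero>\<^bsub>M\<^esub>) \<in> T) \<longrightarrow>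
        (\<exists>s\<in>S. \<forall>(a, v)\<in>T. v = a \<odot>\<^bsub>M\<^esub> s))"

text \<open>The exponent may depend on \<open>y\<close>, so only generators of an ideal matter and
  the set splits when an element is adjoined to \<open>Y\<close>. Over a Noetherian ring this is the
  torsion with respect to \<open>Idl Y\<close>.\<close>

definition power_torsion :: "('a, 'c) ring_scheme \<Rightarrow> 'a set \<Rightarrow> ('a, 'm, 'e) module_scheme \<Rightarrow> 'm set" where
  "power_torsion R Y M =
     {m \<in> carrier M. \<forall>y\<in>Y. \<exists>k::nat. (y [^]\<^bsub>R\<^esub> k) \<odot>\<^bsub>M\<^esub> m = \<zero>\<^bsub>M\<^esub>}"

lemma linear_graphD:
  assumes "linear_graph R M T"
  shows "(a, v) \<in> T \<Longrightarrow> a \<in> carrier R" "(a, v) \<in> T \<Longrightarrow> v \<in> carrier M"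
    "(\<zero>\<^bsub>R\<^esub>, \<zero>\<^bsub>M\<^esub>) \<in> T"
    "(a, v) \<in> T \<Longrightarrow> (b, w) \<in> T \<Longrightarrow> (a \<oplus>\<^bsub>R\<^esub> b, v \<oplus>\<^bsub>M\<^esub> w) \<in> T"
    "r \<in> carrier R \<Longrightarrow> (a, v) \<in> T \<Longrightarrow> (r \<otimes>\<^bsub>R\<^esub> a, r \<odot>\<^bsub>M\<^esub> v) \<in> T"
    "(\<zero>\<^bsub>R\<^esub>, v) \<in> T \<Longrightarrow> v = \<zero>\<^bsub>M\<^esub>"
  using assms unfolding linear_graph_def by blast+

lemma (in module) linear_graph_diff:
  assumes T: "linear_graph R M T" and "(a, v) \<in> T" "(b, w) \<in> T"
  shows "(a \<ominus> b, v \<ominus>\<^bsub>M\<^esub> w) \<in> T"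
proof -
  note [simp] = linear_graphD(1,2)[OF T]
  have "(\<ominus> \<one> \<otimes> b, \<ominus> \<one> \<odot>\<^bsub>M\<^esub> w) \<in> T"
    using linear_graphD(5)[OF T] assms by blast
  then have "(\<ominus> b, \<ominus>\<^bsub>M\<^esub> w) \<in> T"
    using assms by (simp add: R.l_minus smult_l_minus)
  then show ?thesis
    using linear_graphD(4)[OF T assms(2)] by (simp add: a_minus_def)
qed

lemma (in module) linear_graph_functional:
  assumes T: "linear_graph R M T" and "(a, v) \<in> T" "(a, w) \<in> T"
  shows "v = w"
proof -
  note [simp] = linear_graphD(1,2)[OF T]
  have "(a \<ominus> a, v \<ominus>\<^bsub>M\<^esub> w) \<in> T" using linear_graph_diff assms by blast
  moreover have "a \<ominus> a = \<zero>" using assms by (simp add: a_minus_def R.r_neg)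
  ultimately have "v \<ominus>\<^bsub>M\<^esub> w = \<zero>\<^bsub>M\<^esub>" using linear_graphD(6)[OF T] by simp
  then show ?thesis using assms by (simp add: diff_eq_iff)
qed

lemma (in module) ideal_Domain_linear_graph:
  assumes T: "linear_graph R M T"
  shows "ideal (fst ` T) R"
proof (rule idealI)
  show "ring R" by (rule R.ring_axioms)
  show "subgroup (fst ` T) (add_monoid R)"
  proof (rule R.add.subgroupI)
    show "fst ` T \<subseteq> carrier R" using linear_graphD(1)[OF T] by auto
    show "fst ` T \<noteq> {}" using linear_graphD(3)[OF T] by blast
    fix a assume "a \<in> fst ` T"
    then obtain v where v: "(a, v) \<in> T" by auto
    have "(\<ominus> \<one> \<otimes> a, \<ominus> \<one> \<odot>\<^bsub>M\<^esub> v) \<in> T"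
      using linear_graphD(5)[OF T] v by blast
    then show "\<ominus> a \<in> fst ` T"
      using linear_graphD(1)[OF T v] by (force simp: R.l_minus)
  next
    fix a b assume "a \<in> fst ` T" "b \<in> fst ` T"
    then show "a \<oplus> b \<in> fst ` T" using linear_graphD(4)[OF T] by force
  qed
  fix a x assume a: "a \<in> fst ` T" and x: "x \<in> carrier R"
  show "x \<otimes> a \<in> fst ` T" using a x linear_graphD(5)[OF T] by force
  moreover have "a \<in> carrier R" using a linear_graphD(1)[OF T] by auto
  ultimately show "a \<otimes> x \<in> fst ` T"
    using x R.m_comm[of a x] by simp
qed

lemma baerD:
  assumes "baer R c M S" "linear_graph R M T" "snd ` T \<subseteq> S" "\<And>a. a \<in> c \<Longrightarrow> (a, \<zero>\<^bsub>M\<^esub>) \<in> T"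
  obtains s where "s \<in> S" "\<And>a v. (a, v) \<in> T \<Longrightarrow> v = a \<odot>\<^bsub>M\<^esub> s"
proof -
  have "\<exists>s\<in>S. \<forall>(a, v)\<in>T. v = a \<odot>\<^bsub>M\<^esub> s"
    using assms unfolding baer_def by blast
  then show ?thesis using that by blast
qed

text \<open>By \<open>ann\<close>, the map on \<open>Q + R x\<close> that kills \<open>Q\<close> and
  sends \<open>x\<close> to \<open>m\<close> is well defined, and Baer's criterion represents it by
  an element. The divisibility statements below rest on this.\<close>

lemma (in module) baer_extend_principal:
  assumes S: "baer R c M S" "submodule S R M" and Q: "ideal Q R" "c \<subseteq> Q"
    and x: "x \<in> carrier R" and m: "m \<in> S"
    and ann: "\<And>u. u \<in> carrier R \<Longrightarrow> u \<otimes> x \<in> Q \<Longrightarrow> u \<odot>\<^bsub>M\<^esub> m = \<zero>\<^bsub>M\<^esub>"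
  shows "\<exists>s\<in>S. x \<odot>\<^bsub>M\<^esub> s = m \<and> (\<forall>q\<in>Q. q \<odot>\<^bsub>M\<^esub> s = \<zero>\<^bsub>M\<^esub>)"
proof -
  note Qc = R.ideal_closed[OF Q(1)]
  note [simp] = Qc(2)
  have mM[simp]: "m \<in> carrier M" using submoduleE(1)[OF S(2)] m by blast
  define T where "T = {(u \<otimes> x \<oplus> q, u \<odot>\<^bsub>M\<^esub> m) | u q. u \<in> carrier R \<and> q \<in> Q}"
  have TI: "(a, v) \<in> T" if "u \<in> carrier R" "q \<in> Q" "a = u \<otimes> x \<oplus> q" "v = u \<odot>\<^bsub>M\<^esub> m" for a v u q
    using that unfolding T_def by blast
  have TE: "\<exists>u q. u \<in> carrier R \<and> q \<in> Q \<and> a = u \<otimes> x \<oplus> q \<and> v = u \<odot>\<^bsub>M\<^esub> m" if "(a, v) \<in> T" for a v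
    using that unfolding T_def by blast
  have "linear_graph R M T"
    unfolding linear_graph_def
  proof (intro conjI allI impI)
    show "T \<subseteq> carrier R \<times> carrier M" using x by (auto simp: T_def)
    show "(\<zero>, \<zero>\<^bsub>M\<^esub>) \<in> T"
      by (rule TI[of \<zero> \<zero>]) (use x Qc in auto)
  next
    fix a v b w assume "(a, v) \<in> T" "(b, w) \<in> T"
    then obtain u q u' q' where "u \<in> carrier R" "q \<in> Q" "a = u \<otimes> x \<oplus> q" "v = u \<odot>\<^bsub>M\<^esub> m"
      "u' \<in> carrier R" "q' \<in> Q" "b = u' \<otimes> x \<oplus> q'" "w = u' \<odot>\<^bsub>M\<^esub> m" using TE by meson
    then show "(a \<oplus> b, v \<oplus>\<^bsub>M\<^esub> w) \<in> T"
      using x Qc by (intro TI[of "u \<oplus> u'" "q \<oplus> q'"]) (auto simp: R.l_distr R.a_ac smult_l_distr M.a_ac)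
  next
    fix r a v assume r: "r \<in> carrier R" "(a, v) \<in> T"
    then obtain u q where "u \<in> carrier R" "q \<in> Q" "a = u \<otimes> x \<oplus> q" "v = u \<odot>\<^bsub>M\<^esub> m"
      using TE by meson
    then show "(r \<otimes> a, r \<odot>\<^bsub>M\<^esub> v) \<in> T"
      using x Qc r by (intro TI[of "r \<otimes> u" "r \<otimes> q"]) (auto simp: R.r_distr R.m_assoc smult_assoc1)
  next
    fix v assume "(\<zero>, v) \<in> T"
    then obtain u q where u: "u \<in> carrier R" "q \<in> Q" "\<zero> = u \<otimes> x \<oplus> q" "v = u \<odot>\<^bsub>M\<^esub> m"
      using TE by meson
    then have "u \<otimes> x = \<ominus> q"
      using x by (metis R.m_closed R.minus_equality Qc(2))
    then have "u \<otimes> x \<in> Q" using Qc(5) u by simp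
    then show "v = \<zero>\<^bsub>M\<^esub>" using ann u by blast
  qed
  moreover have "snd ` T \<subseteq> S" using submoduleE(4)[OF S(2)] m by (auto simp: T_def)
  moreover have inQ: "(q, \<zero>\<^bsub>M\<^esub>) \<in> T" if "q \<in> Q" for q
    by (rule TI[of \<zero> q]) (use that x in auto)
  ultimately obtain s where s: "s \<in> S" "\<And>a v. (a, v) \<in> T \<Longrightarrow> v = a \<odot>\<^bsub>M\<^esub> s"
    using baerD[OF S(1)] Q(2) by (metis subsetD)
  have "(x, m) \<in> T" by (rule TI[of \<one> \<zero>]) (use x Qc in auto)
  then show ?thesis using s inQ by metis
qed

text \<open>This plays the role of the Artin--Rees lemma in the proof that torsion submodules of
  injective modules over Noetherian rings are injective. The ideal \<open>Q\<close> is maximal among those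
  containing the annihilator of \<open>e\<close> for which \<open>x \<otimes> b \<in> Q\<close> implies \<open>b \<odot> (x \<odot> e) = \<zero>\<close>.\<close>

lemma (in noetherian_module) power_torsion_divide:
  assumes S: "baer R c M S" "submodule S R M"
    and c: "\<And>a s. a \<in> c \<Longrightarrow> s \<in> S \<Longrightarrow> a \<in> carrier R \<and> a \<odot>\<^bsub>M\<^esub> s = \<zero>\<^bsub>M\<^esub>"
    and x: "x \<in> carrier R" and e: "e \<in> S"
    and Y: "Y \<subseteq> carrier R" "x \<odot>\<^bsub>M\<^esub> e \<in> power_torsion R Y M"
  shows "\<exists>s\<in>S \<inter> power_torsion R Y M. x \<odot>\<^bsub>M\<^esub> s = x \<odot>\<^bsub>M\<^esub> e"
proof -
  have eM[simp]: "e \<in> carrier M" using submoduleE(1)[OF S(2)] e by blast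
  define good where "good Q \<longleftrightarrow> ideal Q R \<and> annihilator R M e \<subseteq> Q \<and>
      (\<forall>b\<in>carrier R. b \<otimes> x \<in> Q \<longrightarrow> (b \<otimes> x) \<odot>\<^bsub>M\<^esub> e = \<zero>\<^bsub>M\<^esub>)" for Q
  have "good (annihilator R M e)"
    unfolding good_def using ideal_annihilator[OF eM] by (auto simp: annihilator_def)
  then obtain Q where Q: "good Q" and max: "\<And>Q'. good Q' \<Longrightarrow> Q \<subseteq> Q' \<Longrightarrow> Q' = Q"
    using maximal_in_ideal_family[of "Collect good"] by (auto simp: good_def)
  have idQ: "ideal Q R" using Q by (simp add: good_def)
  note Qc = R.ideal_closed[OF idQ]
  have pow: "\<exists>k::nat. a [^] k \<in> Q" if a: "a \<in> Y" for a
  proof -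
    have aR[simp]: "a \<in> carrier R" using a Y by blast
    obtain n :: nat where n: "(a [^] n) \<odot>\<^bsub>M\<^esub> (x \<odot>\<^bsub>M\<^esub> e) = \<zero>\<^bsub>M\<^esub>"
      using Y(2) a by (auto simp: power_torsion_def)
    \<comment> \<open>Adjoining \<open>a [^] k\<close> to \<open>Q\<close> keeps it good: torsion of
      \<open>x \<odot> e\<close> costs a factor \<open>a [^] n\<close>, which past \<open>k\<close>
      can be cancelled modulo \<open>Q\<close>. Maximality then puts \<open>a [^] k\<close> into
      \<open>Q\<close>.\<close>
    obtain k :: nat where k: "\<And>n b. b \<in> carrier R \<Longrightarrow> a [^] (k + n) \<otimes> b \<in> Q \<Longrightarrow> a [^] k \<otimes> b \<in> Q"
      by (rule colon_stabilizes[OF idQ aR]) blast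
    note sum = set_add_cgenideal[OF idQ R.nat_pow_closed[OF aR, of k]]
    have "(b \<otimes> x) \<odot>\<^bsub>M\<^esub> e = \<zero>\<^bsub>M\<^esub>" if b: "b \<in> carrier R" "b \<otimes> x \<in> Q <+>\<^bsub>R\<^esub> PIdl (a [^] k)" for b
    proof -
      obtain q d where qd: "q \<in> Q" "d \<in> carrier R" "b \<otimes> x = q \<oplus> d \<otimes> a [^] k"
        using b sum(4) by blast
      have [simp]: "q \<in> carrier R" using qd Qc by blast
      have "(a [^] n \<otimes> (b \<otimes> x)) \<odot>\<^bsub>M\<^esub> e = b \<odot>\<^bsub>M\<^esub> ((a [^] n) \<odot>\<^bsub>M\<^esub> (x \<odot>\<^bsub>M\<^esub> e))"
        using b x by (simp add: smult_assoc1 smult_lcomm)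
      then have "a [^] n \<otimes> (b \<otimes> x) \<in> annihilator R M e"
        using n b x by (simp add: annihilator_def)
      then have "a [^] n \<otimes> (b \<otimes> x) \<in> Q" using Q by (auto simp: good_def)
      moreover have "a [^] (k + n) \<otimes> d = a [^] n \<otimes> (b \<otimes> x) \<ominus> a [^] n \<otimes> q"
      proof -
        have "a [^] (k + n) \<otimes> d = a [^] n \<otimes> (d \<otimes> a [^] k)"
          using qd by (simp add: m_ac flip: R.nat_pow_mult)
        moreover have "p \<otimes> (q \<oplus> r) \<ominus> p \<otimes> q = p \<otimes> r"
          if "p \<in> carrier R" "r \<in> carrier R" for p r
          using that \<open>q \<in> carrier R\<close> by algebra
        ultimately show ?thesis unfolding qd(3) using qd(2) by simp
      qed
      ultimately have "a [^] (k + n) \<otimes> d \<in> Q" using Qc(4,6) qd by simp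
      then have "a [^] k \<otimes> d \<in> Q" using k qd by blast
      then have "b \<otimes> x \<in> Q" unfolding qd(3) using qd Qc(3) by (simp add: m_comm)
      then show ?thesis using Q b by (auto simp: good_def)
    qed
    then have "good (Q <+>\<^bsub>R\<^esub> PIdl (a [^] k))"
      using sum(1,2) Q unfolding good_def by blast
    then show ?thesis using max sum(2,3) by blast
  qed
  \<comment> \<open>Since \<open>Q\<close> contains a power of each element of \<open>Y\<close>, a
    solution killed by \<open>Q\<close> is torsion.\<close>
  have "\<exists>s\<in>S. x \<odot>\<^bsub>M\<^esub> s = x \<odot>\<^bsub>M\<^esub> e \<and> (\<forall>q\<in>Q. q \<odot>\<^bsub>M\<^esub> s = \<zero>\<^bsub>M\<^esub>)"
  proof (rule baer_extend_principal[OF S idQ])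
    show "c \<subseteq> Q" using c e Q by (auto simp: good_def annihilator_def)
    show "x \<odot>\<^bsub>M\<^esub> e \<in> S" using submoduleE(4)[OF S(2)] x e by blast
    show "u \<odot>\<^bsub>M\<^esub> (x \<odot>\<^bsub>M\<^esub> e) = \<zero>\<^bsub>M\<^esub>" if "u \<in> carrier R" "u \<otimes> x \<in> Q" for u
      using Q that x by (simp add: good_def flip: smult_assoc1)
  qed (rule x)
  then obtain s where s: "s \<in> S" "x \<odot>\<^bsub>M\<^esub> s = x \<odot>\<^bsub>M\<^esub> e" "\<And>q. q \<in> Q \<Longrightarrow> q \<odot>\<^bsub>M\<^esub> s = \<zero>\<^bsub>M\<^esub>"
    by blast
  moreover have "s \<in> power_torsion R Y M"
    using s pow submoduleE(1)[OF S(2)] by (fastforce simp: power_torsion_def)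
  ultimately show ?thesis by blast
qed

text \<open>If \<open>y\<close> is a zero divisor modulo \<open>c\<close>, the equation
  \<open>y \<odot> w = z\<close> can be unsolvable. Multiplied by \<open>y [^] k\<close>, with
  \<open>k\<close> past the stabilisation of the colon ideals of \<open>c\<close>, it has a
  solution, which can be taken torsion. So \<open>y\<close> is surjective modulo
  \<open>y\<close>-torsion.\<close>

lemma (in noetherian_module) power_torsion_divisible_mod:
  assumes S: "baer R c M S" "submodule S R M" and c: "ideal c R"
    and cS: "\<And>a s. a \<in> c \<Longrightarrow> s \<in> S \<Longrightarrow> a \<odot>\<^bsub>M\<^esub> s = \<zero>\<^bsub>M\<^esub>"
    and y: "y \<in> carrier R" and Y: "Y \<subseteq> carrier R" and z: "z \<in> S \<inter> power_torsion R Y M"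
  shows "\<exists>w\<in>S \<inter> power_torsion R Y M. \<exists>n::nat. (y [^] n) \<odot>\<^bsub>M\<^esub> (z \<ominus>\<^bsub>M\<^esub> y \<odot>\<^bsub>M\<^esub> w) = \<zero>\<^bsub>M\<^esub>"
proof -
  note [simp] = R.ideal_closed(2)[OF c]
  have zM[simp]: "z \<in> carrier M" using submoduleE(1)[OF S(2)] z by blast
  obtain k :: nat where k: "\<And>n b. b \<in> carrier R \<Longrightarrow> y [^] (k + n) \<otimes> b \<in> c \<Longrightarrow> y [^] k \<otimes> b \<in> c"
    by (rule colon_stabilizes[OF c y]) blast
  have "\<exists>s\<in>S. (y [^] Suc k) \<odot>\<^bsub>M\<^esub> s = (y [^] k) \<odot>\<^bsub>M\<^esub> z \<and> (\<forall>q\<in>c. q \<odot>\<^bsub>M\<^esub> s = \<zero>\<^bsub>M\<^esub>)"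
  proof (rule baer_extend_principal[OF S c order_refl])
    show "(y [^] k) \<odot>\<^bsub>M\<^esub> z \<in> S" using submoduleE(4)[OF S(2)] y z by blast
    fix u assume u: "u \<in> carrier R" "u \<otimes> y [^] Suc k \<in> c"
    have "y [^] (k + 1) \<otimes> u \<in> c" using u y by (simp add: m_comm)
    then have "y [^] k \<otimes> u \<in> c" using k u by blast
    then have "(y [^] k \<otimes> u) \<odot>\<^bsub>M\<^esub> z = \<zero>\<^bsub>M\<^esub>" using cS z by blast
    then show "u \<odot>\<^bsub>M\<^esub> ((y [^] k) \<odot>\<^bsub>M\<^esub> z) = \<zero>\<^bsub>M\<^esub>" using u y by (simp add: smult_assoc1 smult_lcomm)
  qed (use y in simp)
  then obtain e where e: "e \<in> S" "(y [^] Suc k) \<odot>\<^bsub>M\<^esub> e = (y [^] k) \<odot>\<^bsub>M\<^esub> z" by blast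
  have "(y [^] k) \<odot>\<^bsub>M\<^esub> z \<in> power_torsion R Y M"
    unfolding power_torsion_def
  proof (intro CollectI conjI ballI)
    fix a assume a: "a \<in> Y"
    then obtain n :: nat where "(a [^] n) \<odot>\<^bsub>M\<^esub> z = \<zero>\<^bsub>M\<^esub>" using z by (auto simp: power_torsion_def)
    then have "(a [^] n) \<odot>\<^bsub>M\<^esub> ((y [^] k) \<odot>\<^bsub>M\<^esub> z) = \<zero>\<^bsub>M\<^esub>"
      using a Y y smult_lcomm[of "a [^] n" "y [^] k" z] by auto
    then show "\<exists>n::nat. (a [^] n) \<odot>\<^bsub>M\<^esub> ((y [^] k) \<odot>\<^bsub>M\<^esub> z) = \<zero>\<^bsub>M\<^esub>" by blast
  qed (use y in simp)
  then obtain w where w: "w \<in> S \<inter> power_torsion R Y M" "(y [^] Suc k) \<odot>\<^bsub>M\<^esub> w = (y [^] k) \<odot>\<^bsub>M\<^esub> z"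
    using power_torsion_divide[OF S _ _ e(1) Y, of "y [^] Suc k"] cS e y by auto
  have wM[simp]: "w \<in> carrier M" using submoduleE(1)[OF S(2)] w by blast
  have "(y [^] k) \<odot>\<^bsub>M\<^esub> (z \<ominus>\<^bsub>M\<^esub> y \<odot>\<^bsub>M\<^esub> w) = \<zero>\<^bsub>M\<^esub>"
    using y w(2) by (simp add: smult_r_diff diff_eq_iff smult_assoc1)
  then show ?thesis using w by blast
qed

lemma mod_hom_closed: "h \<in> mod_hom R M N \<Longrightarrow> x \<in> carrier M \<Longrightarrow> h x \<in> carrier N"
  and mod_hom_add: "h \<in> mod_hom R M N \<Longrightarrow> x \<in> carrier M \<Longrightarrow> y \<in> carrier M \<Longrightarrow>
    h (x \<oplus>\<^bsub>M\<^esub> y) = h x \<oplus>\<^bsub>N\<^esub> h y"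
  and mod_hom_smult: "h \<in> mod_hom R M N \<Longrightarrow> a \<in> carrier R \<Longrightarrow> x \<in> carrier M \<Longrightarrow>
    h (a \<odot>\<^bsub>M\<^esub> x) = a \<odot>\<^bsub>N\<^esub> h x"
  by (auto simp: mod_hom_def)

lemma
  assumes "module R M" "module R N" "h \<in> mod_hom R M N"
  shows mod_hom_zero: "h \<zero>\<^bsub>M\<^esub> = \<zero>\<^bsub>N\<^esub>"
    and mod_hom_diff: "\<lbrakk>x \<in> carrier M; y \<in> carrier M\<rbrakk> \<Longrightarrow> h (x \<ominus>\<^bsub>M\<^esub> y) = h x \<ominus>\<^bsub>N\<^esub> h y"
proof -
  interpret M: module R M by fact
  interpret N: module R N by fact
  note h = mod_hom_closed[OF assms(3)] mod_hom_add[OF assms(3)] mod_hom_smult[OF assms(3)]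
  have "h (\<zero>\<^bsub>R\<^esub> \<odot>\<^bsub>M\<^esub> \<zero>\<^bsub>M\<^esub>) = \<zero>\<^bsub>R\<^esub> \<odot>\<^bsub>N\<^esub> h \<zero>\<^bsub>M\<^esub>" by (rule h(3)) simp_all
  then show "h \<zero>\<^bsub>M\<^esub> = \<zero>\<^bsub>N\<^esub>"
    using N.smult_l_null[OF h(1)[OF M.M.zero_closed]] by (metis M.smult_l_null M.M.zero_closed)
  assume xy: "x \<in> carrier M" "y \<in> carrier M"
  have "(x \<ominus>\<^bsub>M\<^esub> y) \<oplus>\<^bsub>M\<^esub> y = x"
    using xy by (simp add: M.module_simps)
  then have "h (x \<ominus>\<^bsub>M\<^esub> y) \<oplus>\<^bsub>N\<^esub> h y = h x"
    using xy h(2)[of "x \<ominus>\<^bsub>M\<^esub> y" y] by simp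
  then show "h (x \<ominus>\<^bsub>M\<^esub> y) = h x \<ominus>\<^bsub>N\<^esub> h y"
    using xy h(1) by (simp add: N.eq_diff_iff)
qed

text \<open>By \<open>compat\<close> the old and the new values agree where the domain of
  \<open>U\<close> meets \<open>R a\<close>, which is what makes the sum of the two partial maps
  single-valued.\<close>

lemma (in module) linear_graph_extend:
  assumes U: "linear_graph R M U" and a: "a \<in> carrier R" and v: "v \<in> carrier M"
    and compat: "\<And>b w. b \<in> carrier R \<Longrightarrow> (b \<otimes> a, w) \<in> U \<Longrightarrow> w = b \<odot>\<^bsub>M\<^esub> v"
  shows "linear_graph R M {(p \<oplus> b \<otimes> a, w \<oplus>\<^bsub>M\<^esub> b \<odot>\<^bsub>M\<^esub> v) | p w b. (p, w) \<in> U \<and> b \<in> carrier R}"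
    (is "linear_graph R M ?T")
proof -
  note [simp] = linear_graphD(1,2)[OF U]
  have TI: "(x, y) \<in> ?T" if "(p, w) \<in> U" "b \<in> carrier R" "x = p \<oplus> b \<otimes> a" "y = w \<oplus>\<^bsub>M\<^esub> b \<odot>\<^bsub>M\<^esub> v"
    for x y p w b using that by blast
  have TE: "\<exists>p w b. (p, w) \<in> U \<and> b \<in> carrier R \<and> x = p \<oplus> b \<otimes> a \<and> y = w \<oplus>\<^bsub>M\<^esub> b \<odot>\<^bsub>M\<^esub> v"
    if "(x, y) \<in> ?T" for x y using that by blast
  show ?thesis
    unfolding linear_graph_def
  proof (intro conjI allI impI)
    show "?T \<subseteq> carrier R \<times> carrier M" using a v by auto
    show "(\<zero>, \<zero>\<^bsub>M\<^esub>) \<in> ?T" by (rule TI[OF linear_graphD(3)[OF U], of \<zero>]) (use a v in auto)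
  next
    fix x y x' y' assume "(x, y) \<in> ?T" "(x', y') \<in> ?T"
    then obtain p w b p' w' b' where "(p, w) \<in> U" "b \<in> carrier R" "x = p \<oplus> b \<otimes> a" "y = w \<oplus>\<^bsub>M\<^esub> b \<odot>\<^bsub>M\<^esub> v"
      "(p', w') \<in> U" "b' \<in> carrier R" "x' = p' \<oplus> b' \<otimes> a" "y' = w' \<oplus>\<^bsub>M\<^esub> b' \<odot>\<^bsub>M\<^esub> v"
      using TE by meson
    then show "(x \<oplus> x', y \<oplus>\<^bsub>M\<^esub> y') \<in> ?T"
      using a v by (intro TI[OF linear_graphD(4)[OF U, of p w p' w'], of "b \<oplus> b'"])
        (auto simp: R.l_distr R.a_ac smult_l_distr M.a_ac)
  next
    fix r x y assume r: "r \<in> carrier R" "(x, y) \<in> ?T"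
    then obtain p w b where "(p, w) \<in> U" "b \<in> carrier R" "x = p \<oplus> b \<otimes> a" "y = w \<oplus>\<^bsub>M\<^esub> b \<odot>\<^bsub>M\<^esub> v"
      using TE by meson
    then show "(r \<otimes> x, r \<odot>\<^bsub>M\<^esub> y) \<in> ?T"
      using a v r by (intro TI[OF linear_graphD(5)[OF U, of r p w], of "r \<otimes> b"])
        (auto simp: R.r_distr R.m_assoc smult_r_distr smult_assoc1)
  next
    fix y assume "(\<zero>, y) \<in> ?T"
    then obtain p w b where *: "(p, w) \<in> U" "b \<in> carrier R" "\<zero> = p \<oplus> b \<otimes> a" "y = w \<oplus>\<^bsub>M\<^esub> b \<odot>\<^bsub>M\<^esub> v"
      using TE by meson
    have [simp]: "p \<in> carrier R" "w \<in> carrier M" using * by auto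
    have "b \<otimes> a \<oplus> p = \<zero>" using * a by (simp add: R.a_comm)
    then have "\<ominus> p = b \<otimes> a" using * a R.minus_equality by simp
    moreover have "(\<ominus> \<one> \<otimes> p, \<ominus> \<one> \<odot>\<^bsub>M\<^esub> w) \<in> U"
      using linear_graphD(5)[OF U] * by blast
    ultimately have "(b \<otimes> a, \<ominus>\<^bsub>M\<^esub> w) \<in> U" using * by (simp add: R.l_minus smult_l_minus)
    then have "\<ominus>\<^bsub>M\<^esub> w = b \<odot>\<^bsub>M\<^esub> v" using compat * by blast
    then show "y = \<zero>\<^bsub>M\<^esub>" using * by (simp add: M.r_neg flip: \<open>\<ominus>\<^bsub>M\<^esub> w = b \<odot>\<^bsub>M\<^esub> v\<close>)
  qed
qed

text \<open>A linear map into \<open>h ` S\<close> lifts to \<open>S\<close>, one generator of its domain at a time: the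
  obstruction is a linear map into the kernel of \<open>h\<close> on \<open>S\<close>, which extends to \<open>R\<close>.\<close>

lemma baer_image:
  assumes M: "noetherian_module R M" and N: "module R N" and h: "h \<in> mod_hom R M N"
    and S: "submodule S R M" and c: "ideal c R"
    and cS: "\<And>a s. a \<in> c \<Longrightarrow> s \<in> S \<Longrightarrow> a \<odot>\<^bsub>M\<^esub> s = \<zero>\<^bsub>M\<^esub>"
    and baerS: "baer R c M S" and baerK: "baer R c M {v \<in> S. h v = \<zero>\<^bsub>N\<^esub>}"
  shows "baer R c N (h ` S)"
proof -
  interpret M: noetherian_module R M by fact
  interpret N: module R N by fact
  note SE = M.submoduleE[OF S]
  note [simp] = M.R.ideal_closed(2)[OF c] subsetD[OF SE(1)]
  note h0 = mod_hom_zero[OF M.module_axioms N h] and hdiff = mod_hom_diff[OF M.module_axioms N h]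
    and hc[simp] = mod_hom_closed[OF h]
  have S0: "\<zero>\<^bsub>M\<^esub> \<in> S"
    using subgroup.one_closed[OF submodule.axioms(1)[OF S]] by simp
  have Sdiff: "x \<ominus>\<^bsub>M\<^esub> y \<in> S" if "x \<in> S" "y \<in> S" for x y
    using that SE(3,5) by (simp add: a_minus_def)
  show ?thesis
    unfolding baer_def
  proof (intro allI impI, elim conjE)
    fix T assume T: "linear_graph R N T" and TS: "snd ` T \<subseteq> h ` S" and Tc: "\<forall>a\<in>c. (a, \<zero>\<^bsub>N\<^esub>) \<in> T"
    define good where "good U \<longleftrightarrow> linear_graph R M U \<and> snd ` U \<subseteq> S \<and> (\<forall>a\<in>c. (a, \<zero>\<^bsub>M\<^esub>) \<in> U) \<and>
        (\<forall>(a, v)\<in>U. (a, h v) \<in> T)" for U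
    have lift: "\<exists>U. good U \<and> A \<subseteq> fst ` U" if "finite A" "A \<subseteq> fst ` T" for A
      using that
    proof induction
      case empty
      have "good (c \<times> {\<zero>\<^bsub>M\<^esub>})"
        unfolding good_def linear_graph_def
        using Tc S0 h0 M.R.ideal_closed[OF c] by auto
      then show ?case by blast
    next
      case (insert a A)
      then obtain U where U: "good U" "A \<subseteq> fst ` U" by auto
      have Ul: "linear_graph R M U" and US: "\<And>p w. (p, w) \<in> U \<Longrightarrow> w \<in> S"
        and Uc: "\<And>b. b \<in> c \<Longrightarrow> (b, \<zero>\<^bsub>M\<^esub>) \<in> U" and UT: "\<And>p w. (p, w) \<in> U \<Longrightarrow> (p, h w) \<in> T"
        using U(1) by (auto simp: good_def)
      note [simp] = linear_graphD(1,2)[OF Ul]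
      obtain t where at: "(a, t) \<in> T" using insert by auto
      then obtain v0 where v0: "v0 \<in> S" "h v0 = t" using TS by force
      have a[simp]: "a \<in> carrier R" using linear_graphD(1)[OF T at] .
      have v0M[simp]: "v0 \<in> carrier M" using v0 by simp
      \<comment> \<open>On the ideal of all \<open>b\<close> with \<open>b \<otimes> a\<close> in
        the domain of \<open>U\<close>, this is the difference between the tentative value
        \<open>b \<odot> v0\<close> and the value prescribed by \<open>U\<close>. It lies in the
        kernel of \<open>h\<close> because both lift the same value of \<open>T\<close>.\<close>
      define T0 where "T0 = {(b, b \<odot>\<^bsub>M\<^esub> v0 \<ominus>\<^bsub>M\<^esub> w) | b w. b \<in> carrier R \<and> (b \<otimes>\<^bsub>R\<^esub> a, w) \<in> U}"
      have T0I: "(b, y) \<in> T0" if "b \<in> carrier R" "(b \<otimes>\<^bsub>R\<^esub> a, w) \<in> U" "y = b \<odot>\<^bsub>M\<^esub> v0 \<ominus>\<^bsub>M\<^esub> w" for b y w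
        using that unfolding T0_def by blast
      have T0E: "\<exists>w. b \<in> carrier R \<and> (b \<otimes>\<^bsub>R\<^esub> a, w) \<in> U \<and> y = b \<odot>\<^bsub>M\<^esub> v0 \<ominus>\<^bsub>M\<^esub> w" if "(b, y) \<in> T0" for b y
        using that unfolding T0_def by blast
      have T0l: "linear_graph R M T0"
        unfolding linear_graph_def
      proof (intro conjI allI impI)
        show "T0 \<subseteq> carrier R \<times> carrier M" by (auto simp: T0_def)
        show "(\<zero>\<^bsub>R\<^esub>, \<zero>\<^bsub>M\<^esub>) \<in> T0"
          by (rule T0I[of _ "\<zero>\<^bsub>M\<^esub>"]) (use linear_graphD(3)[OF Ul] in \<open>auto simp: M.module_simps\<close>)
      next
        fix b y b' y' assume "(b, y) \<in> T0" "(b', y') \<in> T0"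
        then obtain w w' where *: "b \<in> carrier R" "(b \<otimes>\<^bsub>R\<^esub> a, w) \<in> U" "y = b \<odot>\<^bsub>M\<^esub> v0 \<ominus>\<^bsub>M\<^esub> w"
          "b' \<in> carrier R" "(b' \<otimes>\<^bsub>R\<^esub> a, w') \<in> U" "y' = b' \<odot>\<^bsub>M\<^esub> v0 \<ominus>\<^bsub>M\<^esub> w'"
          using T0E by meson
        moreover have "w \<in> carrier M" "w' \<in> carrier M" using * by auto
        ultimately show "(b \<oplus>\<^bsub>R\<^esub> b', y \<oplus>\<^bsub>M\<^esub> y') \<in> T0"
          using linear_graphD(4)[OF Ul *(2,5)]
          by (intro T0I[of _ "w \<oplus>\<^bsub>M\<^esub> w'"]) (auto simp: M.R.l_distr M.module_simps)
      next
        fix r b y assume r: "r \<in> carrier R" "(b, y) \<in> T0"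
        then obtain w where *: "b \<in> carrier R" "(b \<otimes>\<^bsub>R\<^esub> a, w) \<in> U" "y = b \<odot>\<^bsub>M\<^esub> v0 \<ominus>\<^bsub>M\<^esub> w"
          using T0E by meson
        moreover have "w \<in> carrier M" using * by auto
        ultimately show "(r \<otimes>\<^bsub>R\<^esub> b, r \<odot>\<^bsub>M\<^esub> y) \<in> T0"
          using linear_graphD(5)[OF Ul r(1) *(2)] r
          by (intro T0I[of _ "r \<odot>\<^bsub>M\<^esub> w"]) (auto simp: M.R.m_assoc M.smult_assoc1 M.smult_r_diff)
      next
        fix y assume "(\<zero>\<^bsub>R\<^esub>, y) \<in> T0"
        then obtain w where *: "(\<zero>\<^bsub>R\<^esub> \<otimes>\<^bsub>R\<^esub> a, w) \<in> U" "y = \<zero>\<^bsub>R\<^esub> \<odot>\<^bsub>M\<^esub> v0 \<ominus>\<^bsub>M\<^esub> w"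
          using T0E by meson
        then have "w = \<zero>\<^bsub>M\<^esub>" using linear_graphD(6)[OF Ul] by simp
        then show "y = \<zero>\<^bsub>M\<^esub>" using * by (simp add: M.module_simps)
      qed
      have T0K: "snd ` T0 \<subseteq> {v \<in> S. h v = \<zero>\<^bsub>N\<^esub>}"
      proof clarsimp
        fix b y assume "(b, y) \<in> T0"
        then obtain w where *: "b \<in> carrier R" "(b \<otimes>\<^bsub>R\<^esub> a, w) \<in> U" "y = b \<odot>\<^bsub>M\<^esub> v0 \<ominus>\<^bsub>M\<^esub> w"
          using T0E by meson
        have wM: "w \<in> carrier M" using * by auto
        have "h w = b \<odot>\<^bsub>N\<^esub> t"
          using N.linear_graph_functional[OF T UT[OF *(2)]] linear_graphD(5)[OF T *(1) at] by blast
        then have "h y = \<zero>\<^bsub>N\<^esub>"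
          using * wM v0 linear_graphD(2)[OF T at]
          by (simp add: hdiff mod_hom_smult[OF h] N.diff_eq_iff)
        moreover have "y \<in> S" using * Sdiff SE(4) v0 US by blast
        ultimately show "y \<in> S \<and> h y = \<zero>\<^bsub>N\<^esub>" by blast
      qed
      have T0c: "(b, \<zero>\<^bsub>M\<^esub>) \<in> T0" if "b \<in> c" for b
      proof (rule T0I)
        show "b \<in> carrier R" using that by simp
        show "(b \<otimes>\<^bsub>R\<^esub> a, \<zero>\<^bsub>M\<^esub>) \<in> U" using Uc M.R.ideal_closed(7)[OF c a that] by blast
        show "\<zero>\<^bsub>M\<^esub> = b \<odot>\<^bsub>M\<^esub> v0 \<ominus>\<^bsub>M\<^esub> \<zero>\<^bsub>M\<^esub>"
          using cS[OF that v0(1)] by (simp add: M.eq_diff_iff)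
      qed
      obtain u0 where u0: "u0 \<in> S" "h u0 = \<zero>\<^bsub>N\<^esub>" "\<And>b y. (b, y) \<in> T0 \<Longrightarrow> y = b \<odot>\<^bsub>M\<^esub> u0"
        by (rule baerD[OF baerK T0l T0K T0c]) blast+
      \<comment> \<open>Subtracting the element that represents the obstruction makes the lift
        compatible with \<open>U\<close>; as \<open>h\<close> kills it, \<open>v\<close> still lifts
        \<open>t\<close>.\<close>
      define v where "v = v0 \<ominus>\<^bsub>M\<^esub> u0"
      have vS: "v \<in> S" using v_def Sdiff u0 v0 by simp
      have hv: "h v = t" using v_def u0 v0 linear_graphD(2)[OF T at]
        by (simp add: hdiff N.diff_eq_iff)
      define U' where "U' = {(p \<oplus>\<^bsub>R\<^esub> b \<otimes>\<^bsub>R\<^esub> a, w \<oplus>\<^bsub>M\<^esub> b \<odot>\<^bsub>M\<^esub> v) | p w b. (p, w) \<in> U \<and> b \<in> carrier R}"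
      have U'I: "(x, y) \<in> U'" if "(p, w) \<in> U" "b \<in> carrier R" "x = p \<oplus>\<^bsub>R\<^esub> b \<otimes>\<^bsub>R\<^esub> a"
        "y = w \<oplus>\<^bsub>M\<^esub> b \<odot>\<^bsub>M\<^esub> v" for x y p w b using that unfolding U'_def by blast
      have "linear_graph R M U'"
        unfolding U'_def
      proof (rule M.linear_graph_extend[OF Ul a])
        fix b w assume bw: "b \<in> carrier R" "(b \<otimes>\<^bsub>R\<^esub> a, w) \<in> U"
        have wM: "w \<in> carrier M" using bw by auto
        have "b \<odot>\<^bsub>M\<^esub> v0 \<ominus>\<^bsub>M\<^esub> w = b \<odot>\<^bsub>M\<^esub> u0" using u0(3) T0I bw by blast
        then show "w = b \<odot>\<^bsub>M\<^esub> v"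
          using bw wM u0(1) by (simp add: v_def M.module_simps)
      qed (use vS in simp)
      moreover have "snd ` U' \<subseteq> S" using US SE(4,5) vS by (auto simp: U'_def)
      moreover have "(b, \<zero>\<^bsub>M\<^esub>) \<in> U'" if "b \<in> c" for b
        by (rule U'I[OF Uc[OF that], of "\<zero>\<^bsub>R\<^esub>"]) (use that vS in auto)
      moreover have "(x, h y) \<in> T" if xy: "(x, y) \<in> U'" for x y
      proof -
        obtain p w b where *: "(p, w) \<in> U" "b \<in> carrier R" "x = p \<oplus>\<^bsub>R\<^esub> b \<otimes>\<^bsub>R\<^esub> a" "y = w \<oplus>\<^bsub>M\<^esub> b \<odot>\<^bsub>M\<^esub> v"
          using xy unfolding U'_def by blast
        have "w \<in> carrier M" using * by auto
        then have "h y = h w \<oplus>\<^bsub>N\<^esub> b \<odot>\<^bsub>N\<^esub> t"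
          using * vS hv by (simp add: mod_hom_add[OF h] mod_hom_smult[OF h])
        then show ?thesis
          using linear_graphD(4)[OF T UT[OF *(1)] linear_graphD(5)[OF T *(2) at]] * by simp
      qed
      ultimately have "good U'" unfolding good_def by blast
      moreover have "insert a A \<subseteq> fst ` U'"
      proof
        fix x assume "x \<in> insert a A"
        then consider "x = a" | w where "(x, w) \<in> U" using U(2) by force
        then have "\<exists>y. (x, y) \<in> U'"
        proof cases
          case 1
          have "(x, v) \<in> U'"
            by (rule U'I[OF linear_graphD(3)[OF Ul], of "\<one>\<^bsub>R\<^esub>"]) (use 1 vS in auto)
          then show ?thesis ..
        next
          case 2
          have "(x, w) \<in> U'"
            by (rule U'I[OF 2, of "\<zero>\<^bsub>R\<^esub>"]) (use 2 vS in auto)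
          then show ?thesis ..
        qed
        then show "x \<in> fst ` U'" by force
      qed
      ultimately show ?case by blast
    qed
    \<comment> \<open>The Noetherian property makes the domain of \<open>T\<close> finitely
      generated, so finitely many lifting steps exhaust it.\<close>
    obtain A where A: "A \<subseteq> carrier R" "finite A" "fst ` T = Idl\<^bsub>R\<^esub> A"
      using M.finetely_gen[OF N.ideal_Domain_linear_graph[OF T]] by auto
    have "A \<subseteq> fst ` T" using A M.genideal_self by simp
    then obtain U where U: "good U" "A \<subseteq> fst ` U" using lift[OF A(2)] by auto
    have Ul: "linear_graph R M U" using U by (simp add: good_def)
    have dom: "fst ` T \<subseteq> fst ` U"
      unfolding A(3) by (rule M.genideal_minimal[OF M.ideal_Domain_linear_graph[OF Ul] U(2)])
    obtain s where s: "s \<in> S" "\<And>a v. (a, v) \<in> U \<Longrightarrow> v = a \<odot>\<^bsub>M\<^esub> s"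
    proof (rule baerD[OF baerS Ul])
      show "snd ` U \<subseteq> S" "\<And>a. a \<in> c \<Longrightarrow> (a, \<zero>\<^bsub>M\<^esub>) \<in> U" using U(1) by (auto simp: good_def)
    qed blast
    have "t = a \<odot>\<^bsub>N\<^esub> h s" if at: "(a, t) \<in> T" for a t
    proof -
      obtain v where v: "(a, v) \<in> U" using dom at by force
      then have "(a, h v) \<in> T" using U by (auto simp: good_def)
      then have "t = h v" using N.linear_graph_functional[OF T at] by blast
      also have "\<dots> = a \<odot>\<^bsub>N\<^esub> h s"
        using s(2)[OF v] s(1) linear_graphD(1)[OF Ul v] by (simp add: mod_hom_smult[OF h])
      finally show ?thesis .
    qed
    then show "\<exists>s\<in>h ` S. \<forall>(a, t)\<in>T. t = a \<odot>\<^bsub>N\<^esub> s" using s(1) by blast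
  qed
qed

section \<open>Injective modules, annihilated submodules and torsion submodules\<close>

lemma module_regular_module:
  assumes "cring R"
  shows "module R (regular_module R)"
proof -
  interpret cring R by fact
  have "abelian_group (regular_module R)"
  proof (rule abelian_groupI)
    fix x assume "x \<in> carrier (regular_module R)"
    then have "\<ominus>\<^bsub>R\<^esub> x \<in> carrier R" "\<ominus>\<^bsub>R\<^esub> x \<oplus>\<^bsub>R\<^esub> x = \<zero>\<^bsub>R\<^esub>" by (auto simp: regular_module_def l_neg)
    then show "\<exists>y\<in>carrier (regular_module R). y \<oplus>\<^bsub>regular_module R\<^esub> x = \<zero>\<^bsub>regular_module R\<^esub>"
      unfolding regular_module_def by (simp, blast)
  qed (simp_all add: regular_module_def a_ac)
  then show ?thesis
    by (intro moduleI is_cring) (auto simp: regular_module_def l_distr r_distr m_assoc)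
qed

lemma injective_moduleD:
  fixes M N :: "('a, 'a) module"
  assumes "injective_module R E" "module R M" "module R N" "i \<in> mod_hom R M N"
    "inj_on i (carrier M)" "f \<in> mod_hom R M E"
  shows "\<exists>g\<in>mod_hom R N E. \<forall>x\<in>carrier M. g (i x) = f x"
  using assms unfolding injective_module_def by blast

text \<open>Both modules of the extension problem, the domain ideal of the graph and
  \<open>R\<close> itself, live on the type of ring elements, so they are admissible test modules.
  The image of \<open>\<one>\<close> under the extension represents the map.\<close>

lemma baer_injective:
  assumes E: "injective_module R E"
  shows "baer R {\<zero>\<^bsub>R\<^esub>} E (carrier E)"
  unfolding baer_def
proof (intro allI impI, elim conjE)
  interpret E: module R E using E by (simp add: injective_module_def)
  interpret A: module R "regular_module R" by (rule module_regular_module) (rule E.is_cring)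
  have regs: "carrier (regular_module R) = carrier R" "add (regular_module R) = add R"
    "smult (regular_module R) = monoid.mult R" "zero (regular_module R) = zero R"
    by (simp_all add: regular_module_def)
  fix T assume T: "linear_graph R E T"
  define L where "L = fst ` T"
  have idL: "ideal L R" unfolding L_def by (rule E.ideal_Domain_linear_graph[OF T])
  note Lc = E.R.ideal_closed[OF idL]
  have "a_inv (regular_module R) a \<in> L" if "a \<in> L" for a
  proof -
    have "a_inv (regular_module R) a = a_inv R a"
      by (simp add: a_inv_def m_inv_def regs)
    then show ?thesis using that Lc(5) by simp
  qed
  then have sub: "submodule L R (regular_module R)"
    by (intro A.submoduleI) (use Lc in \<open>auto simp: regs\<close>)
  let ?L = "(regular_module R)\<lparr>carrier := L\<rparr>"
  have modL: "module R ?L" by (rule submodule.submodule_is_module[OF sub A.module_axioms])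
  define f where "f a = (THE v. (a, v) \<in> T)" for a
  have f: "f a = v" if "(a, v) \<in> T" for a v
    unfolding f_def using that E.linear_graph_functional[OF T] by blast
  have fT: "(a, f a) \<in> T" if "a \<in> L" for a
    using that f unfolding L_def by force
  have "f \<in> mod_hom R ?L E"
    unfolding mod_hom_def
  proof (intro CollectI conjI ballI)
    show "f \<in> carrier ?L \<rightarrow> carrier E" using fT linear_graphD(2)[OF T] by auto
    show "f (x \<oplus>\<^bsub>?L\<^esub> y) = f x \<oplus>\<^bsub>E\<^esub> f y" if "x \<in> carrier ?L" "y \<in> carrier ?L" for x y
      using that f[OF linear_graphD(4)[OF T fT fT]] by (simp add: regs)
    show "f (a \<odot>\<^bsub>?L\<^esub> x) = a \<odot>\<^bsub>E\<^esub> f x" if "a \<in> carrier R" "x \<in> carrier ?L" for a x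
      using that f[OF linear_graphD(5)[OF T _ fT]] by (simp add: regs)
  qed
  moreover have "(\<lambda>x. x) \<in> mod_hom R ?L (regular_module R)"
    using Lc(2) by (auto simp: mod_hom_def regs)
  ultimately obtain g where g: "g \<in> mod_hom R (regular_module R) E" "\<And>x. x \<in> L \<Longrightarrow> g x = f x"
    using injective_moduleD[OF E modL A.module_axioms, of "\<lambda>x. x" f] by auto
  have "v = a \<odot>\<^bsub>E\<^esub> g \<one>\<^bsub>R\<^esub>" if av: "(a, v) \<in> T" for a v
  proof -
    have a: "a \<in> L" "a \<in> carrier R" using av linear_graphD(1)[OF T av] by (force simp: L_def)+
    have "v = g a" using f[OF av] g(2)[OF a(1)] by simp
    also have "\<dots> = a \<odot>\<^bsub>E\<^esub> g \<one>\<^bsub>R\<^esub>"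
      using mod_hom_smult[OF g(1), of a "\<one>\<^bsub>R\<^esub>"] a by (simp add: regs)
    finally show ?thesis .
  qed
  moreover have "g \<one>\<^bsub>R\<^esub> \<in> carrier E" using mod_hom_closed[OF g(1)] by (simp add: regs)
  ultimately show "\<exists>s\<in>carrier E. \<forall>(a, v)\<in>T. v = a \<odot>\<^bsub>E\<^esub> s" by blast
qed

lemma (in module) submodule_colon_zero:
  assumes "c \<subseteq> carrier R"
  shows "submodule {m \<in> carrier M. \<forall>a\<in>c. a \<odot>\<^bsub>M\<^esub> m = \<zero>\<^bsub>M\<^esub>} R M"
proof (rule submoduleI)
  fix r m assume r: "r \<in> carrier R" and m: "m \<in> {m \<in> carrier M. \<forall>a\<in>c. a \<odot>\<^bsub>M\<^esub> m = \<zero>\<^bsub>M\<^esub>}"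
  have "a \<odot>\<^bsub>M\<^esub> (r \<odot>\<^bsub>M\<^esub> m) = \<zero>\<^bsub>M\<^esub>" if "a \<in> c" for a
    using that r m assms smult_lcomm[of a r m] by auto
  then show "r \<odot>\<^bsub>M\<^esub> m \<in> {m \<in> carrier M. \<forall>a\<in>c. a \<odot>\<^bsub>M\<^esub> m = \<zero>\<^bsub>M\<^esub>}" using r m by auto
qed (use subsetD[OF assms] in \<open>auto simp: smult_r_distr smult_r_minus\<close>)

text \<open>For injective \<open>M\<close>, the elements killed by \<open>c\<close> form
  \<open>Hom(R / c, M)\<close>, which is injective over \<open>R / c\<close>. An element
  representing a map that vanishes on \<open>c\<close> is itself killed by \<open>c\<close>.\<close>

lemma (in module) baer_colon_zero:
  assumes "baer R {\<zero>} M (carrier M)" "\<zero> \<in> c"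
  shows "baer R c M {m \<in> carrier M. \<forall>a\<in>c. a \<odot>\<^bsub>M\<^esub> m = \<zero>\<^bsub>M\<^esub>}"
  unfolding baer_def
proof (intro allI impI, elim conjE)
  fix T assume T: "linear_graph R M T" and c: "\<forall>a\<in>c. (a, \<zero>\<^bsub>M\<^esub>) \<in> T"
  have "snd ` T \<subseteq> carrier M" using linear_graphD(2)[OF T] by auto
  moreover have "(a, \<zero>\<^bsub>M\<^esub>) \<in> T" if "a \<in> {\<zero>}" for a
    using that linear_graphD(3)[OF T] by simp
  ultimately obtain s where s: "s \<in> carrier M" "\<And>a v. (a, v) \<in> T \<Longrightarrow> v = a \<odot>\<^bsub>M\<^esub> s"
    by (rule baerD[OF assms(1) T]) blast+
  have "\<zero>\<^bsub>M\<^esub> = a \<odot>\<^bsub>M\<^esub> s" if "a \<in> c" for a by (rule s(2)) (use c that in blast)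
  then have "a \<odot>\<^bsub>M\<^esub> s = \<zero>\<^bsub>M\<^esub>" if "a \<in> c" for a using that by simp
  with s show "\<exists>s\<in>{m \<in> carrier M. \<forall>a\<in>c. a \<odot>\<^bsub>M\<^esub> m = \<zero>\<^bsub>M\<^esub>}. \<forall>(a, v)\<in>T. v = a \<odot>\<^bsub>M\<^esub> s"
    by blast
qed

lemma (in module) submodule_Int:
  assumes "submodule A R M" "submodule B R M"
  shows "submodule (A \<inter> B) R M"
proof (rule submoduleI)
  show "A \<inter> B \<subseteq> carrier M" using submoduleE(1)[OF assms(1)] by blast
  have "\<zero>\<^bsub>M\<^esub> \<in> S" if "submodule S R M" for S
    using subgroup.one_closed[OF submodule.axioms(1)[OF that]] by simp
  then show "\<zero>\<^bsub>M\<^esub> \<in> A \<inter> B" using assms by blast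
  note A = submoduleE(3,4,5)[OF assms(1)] and B = submoduleE(3,4,5)[OF assms(2)]
  show "\<ominus>\<^bsub>M\<^esub> a \<in> A \<inter> B" if "a \<in> A \<inter> B" for a using that A(1) B(1) by simp
  show "a \<oplus>\<^bsub>M\<^esub> b \<in> A \<inter> B" if "a \<in> A \<inter> B" "b \<in> A \<inter> B" for a b using that A(3) B(3) by simp
  show "a \<odot>\<^bsub>M\<^esub> b \<in> A \<inter> B" if "a \<in> carrier R" "b \<in> A \<inter> B" for a b using that A(2) B(2) by simp
qed

lemma (in module) submodule_power_torsion:
  assumes "Y \<subseteq> carrier R"
  shows "submodule (power_torsion R Y M) R M"
proof (rule submoduleI)
  show "power_torsion R Y M \<subseteq> carrier M" by (auto simp: power_torsion_def)
  have "y [^] (0::nat) \<odot>\<^bsub>M\<^esub> \<zero>\<^bsub>M\<^esub> = \<zero>\<^bsub>M\<^esub>" for y by simp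
  then show "\<zero>\<^bsub>M\<^esub> \<in> power_torsion R Y M"
    unfolding power_torsion_def by blast
  fix m assume m: "m \<in> power_torsion R Y M"
  have mM: "m \<in> carrier M" using m by (simp add: power_torsion_def)
  show smult: "r \<odot>\<^bsub>M\<^esub> m \<in> power_torsion R Y M" if r: "r \<in> carrier R" for r
  proof -
    have "\<exists>k::nat. (y [^] k) \<odot>\<^bsub>M\<^esub> (r \<odot>\<^bsub>M\<^esub> m) = \<zero>\<^bsub>M\<^esub>" if y: "y \<in> Y" for y
    proof -
      obtain k :: nat where "(y [^] k) \<odot>\<^bsub>M\<^esub> m = \<zero>\<^bsub>M\<^esub>"
        using m y unfolding power_torsion_def by blast
      moreover have "y [^] k \<in> carrier R" using y assms by auto
      ultimately have "(y [^] k) \<odot>\<^bsub>M\<^esub> (r \<odot>\<^bsub>M\<^esub> m) = \<zero>\<^bsub>M\<^esub>"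
        using smult_lcomm[of "y [^] k" r m] r mM by simp
      then show ?thesis ..
    qed
    then show ?thesis using r mM unfolding power_torsion_def by simp
  qed
  show "\<ominus>\<^bsub>M\<^esub> m \<in> power_torsion R Y M"
    using smult[of "\<ominus> \<one>"] mM by (simp add: smult_l_minus)
  fix m' assume m': "m' \<in> power_torsion R Y M"
  have "\<exists>k::nat. (y [^] k) \<odot>\<^bsub>M\<^esub> (m \<oplus>\<^bsub>M\<^esub> m') = \<zero>\<^bsub>M\<^esub>" if y: "y \<in> Y" for y
  proof -
    have yR: "y \<in> carrier R" using y assms by blast
    have mM: "m \<in> carrier M" "m' \<in> carrier M" using m m' unfolding power_torsion_def by simp_all
    obtain k :: nat where k: "(y [^] k) \<odot>\<^bsub>M\<^esub> m = \<zero>\<^bsub>M\<^esub>"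
      using m y unfolding power_torsion_def by blast
    obtain l :: nat where l: "(y [^] l) \<odot>\<^bsub>M\<^esub> m' = \<zero>\<^bsub>M\<^esub>"
      using m' y unfolding power_torsion_def by blast
    have "(y [^] (k + l)) \<odot>\<^bsub>M\<^esub> m = \<zero>\<^bsub>M\<^esub>" "(y [^] (k + l)) \<odot>\<^bsub>M\<^esub> m' = \<zero>\<^bsub>M\<^esub>"
      using smult_pow_zero_mono[OF yR mM(1) k, of "k + l"] smult_pow_zero_mono[OF yR mM(2) l, of "k + l"]
      by simp_all
    then have "(y [^] (k + l)) \<odot>\<^bsub>M\<^esub> (m \<oplus>\<^bsub>M\<^esub> m') = \<zero>\<^bsub>M\<^esub>"
      using yR mM by (simp add: smult_r_distr)
    then show ?thesis ..
  qed
  then show "m \<oplus>\<^bsub>M\<^esub> m' \<in> power_torsion R Y M"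
    using m m' unfolding power_torsion_def by simp
qed

section \<open>Complexes and multiplication by a ring element\<close>

text \<open>A subcomplex is a family of subsets of the terms of \<open>C\<close>. So all
  subcomplexes share the operations and the differential of \<open>C\<close>, and inclusions between
  them need no maps.\<close>

definition cycles :: "(nat \<Rightarrow> ('a, 'm) module) \<Rightarrow> (nat \<Rightarrow> 'm \<Rightarrow> 'm) \<Rightarrow> (nat \<Rightarrow> 'm set) \<Rightarrow> nat \<Rightarrow> 'm set" where
  "cycles C \<delta> S j = {z \<in> S j. \<delta> j z = \<zero>\<^bsub>C (Suc j)\<^esub>}"

text \<open>The index \<open>j\<close> refers to exactness at the term of degree \<open>Suc j\<close>.\<close>

definition exact_at :: "(nat \<Rightarrow> ('a, 'm) module) \<Rightarrow> (nat \<Rightarrow> 'm \<Rightarrow> 'm) \<Rightarrow> (nat \<Rightarrow> 'm set) \<Rightarrow> nat \<Rightarrow> bool" where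
  "exact_at C \<delta> S j \<longleftrightarrow> cycles C \<delta> S (Suc j) \<subseteq> \<delta> j ` S j"

definition boundaries :: "(nat \<Rightarrow> ('a, 'm) module) \<Rightarrow> (nat \<Rightarrow> 'm \<Rightarrow> 'm) \<Rightarrow> (nat \<Rightarrow> 'm set) \<Rightarrow> nat \<Rightarrow> 'm set" where
  "boundaries C \<delta> S j = (case j of 0 \<Rightarrow> {\<zero>\<^bsub>C 0\<^esub>} | Suc i \<Rightarrow> \<delta> i ` S i)"

locale module_complex = noetherian_cring R for R (structure) +
  fixes C :: "nat \<Rightarrow> ('a, 'm) module" and \<delta> :: "nat \<Rightarrow> 'm \<Rightarrow> 'm"
  assumes modules: "module R (C j)"
    and d_hom: "\<delta> j \<in> mod_hom R (C j) (C (Suc j))"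
    and dd: "x \<in> carrier (C j) \<Longrightarrow> \<delta> (Suc j) (\<delta> j x) = \<zero>\<^bsub>C (Suc (Suc j))\<^esub>"

sublocale module_complex \<subseteq> C: module R "C j" for j
  by (rule modules)

context module_complex
begin

lemma d_closed [simp]: "x \<in> carrier (C j) \<Longrightarrow> \<delta> j x \<in> carrier (C (Suc j))"
  by (rule mod_hom_closed[OF d_hom])

lemma d_add: "x \<in> carrier (C j) \<Longrightarrow> y \<in> carrier (C j) \<Longrightarrow>
    \<delta> j (x \<oplus>\<^bsub>C j\<^esub> y) = \<delta> j x \<oplus>\<^bsub>C (Suc j)\<^esub> \<delta> j y"
  by (rule mod_hom_add[OF d_hom])

lemma d_smult: "a \<in> carrier R \<Longrightarrow> x \<in> carrier (C j) \<Longrightarrow>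
    \<delta> j (a \<odot>\<^bsub>C j\<^esub> x) = a \<odot>\<^bsub>C (Suc j)\<^esub> \<delta> j x"
  by (rule mod_hom_smult[OF d_hom])

lemma d_zero [simp]: "\<delta> j \<zero>\<^bsub>C j\<^esub> = \<zero>\<^bsub>C (Suc j)\<^esub>"
  by (rule mod_hom_zero[OF modules modules d_hom])

lemma d_diff: "x \<in> carrier (C j) \<Longrightarrow> y \<in> carrier (C j) \<Longrightarrow>
    \<delta> j (x \<ominus>\<^bsub>C j\<^esub> y) = \<delta> j x \<ominus>\<^bsub>C (Suc j)\<^esub> \<delta> j y"
  by (rule mod_hom_diff[OF modules modules d_hom])

lemmas d_simps = d_add d_smult d_diff dd

end

locale subcomplex = module_complex R C \<delta> for R (structure) and C :: "nat \<Rightarrow> ('a, 'm) module" and \<delta> +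
  fixes S :: "nat \<Rightarrow> 'm set"
  assumes sub: "submodule (S j) R (C j)" and sub_d: "x \<in> S j \<Longrightarrow> \<delta> j x \<in> S (Suc j)"
begin

lemma sub_carrier [simp]: "x \<in> S j \<Longrightarrow> x \<in> carrier (C j)"
  using C.submoduleE(1)[OF sub] by blast

lemma sub_add: "x \<in> S j \<Longrightarrow> y \<in> S j \<Longrightarrow> x \<oplus>\<^bsub>C j\<^esub> y \<in> S j"
  and sub_smult: "a \<in> carrier R \<Longrightarrow> x \<in> S j \<Longrightarrow> a \<odot>\<^bsub>C j\<^esub> x \<in> S j"
  using C.submoduleE(4,5)[OF sub] by blast+

lemma sub_diff: "x \<in> S j \<Longrightarrow> y \<in> S j \<Longrightarrow> x \<ominus>\<^bsub>C j\<^esub> y \<in> S j"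
  using C.submoduleE(3,5)[OF sub] by (simp add: a_minus_def)

lemma sub_zero: "\<zero>\<^bsub>C j\<^esub> \<in> S j"
  using subgroup.one_closed[OF submodule.axioms(1)[OF sub[of j]]] by simp

lemmas sub_closed = sub_d sub_add sub_smult sub_diff sub_zero

lemma cycles_sub: "z \<in> cycles C \<delta> S j \<Longrightarrow> z \<in> S j"
  and cycles_d: "z \<in> cycles C \<delta> S j \<Longrightarrow> \<delta> j z = \<zero>\<^bsub>C (Suc j)\<^esub>"
  by (auto simp: cycles_def)

lemma d_cycle: "x \<in> S j \<Longrightarrow> \<delta> j x \<in> cycles C \<delta> S (Suc j)"
  by (simp add: cycles_def sub_closed dd)

lemma cycles_closed:
  assumes "z \<in> cycles C \<delta> S j"
  shows "w \<in> cycles C \<delta> S j \<Longrightarrow> z \<oplus>\<^bsub>C j\<^esub> w \<in> cycles C \<delta> S j"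
    "w \<in> cycles C \<delta> S j \<Longrightarrow> z \<ominus>\<^bsub>C j\<^esub> w \<in> cycles C \<delta> S j"
    "a \<in> carrier R \<Longrightarrow> a \<odot>\<^bsub>C j\<^esub> z \<in> cycles C \<delta> S j"
  using assms by (auto simp: cycles_def sub_closed d_simps C.diff_eq_iff)

lemma zero_boundary: "\<zero>\<^bsub>C j\<^esub> \<in> boundaries C \<delta> S j"
proof (cases j)
  case (Suc i)
  then show ?thesis using image_eqI[of _ "\<delta> i" "\<zero>\<^bsub>C i\<^esub>" "S i"] by (simp add: boundaries_def sub_zero)
qed (simp add: boundaries_def)

lemma exact_imp_boundary:
  assumes "exact_at C \<delta> S j" "z \<in> cycles C \<delta> S (Suc j)"
  shows "\<exists>w\<in>S j. z = \<delta> j w"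
  using assms by (auto simp: exact_at_def)

end

context module_complex
begin

lemma subcomplex_carrier: "subcomplex R C \<delta> (\<lambda>j. carrier (C j))"
  by (intro subcomplex.intro subcomplex_axioms.intro module_complex_axioms C.carrier_is_submodule) simp

lemma subcomplex_power_torsion:
  assumes "Y \<subseteq> carrier R"
  shows "subcomplex R C \<delta> (\<lambda>j. power_torsion R Y (C j))"
proof (intro subcomplex.intro subcomplex_axioms.intro module_complex_axioms C.submodule_power_torsion assms)
  fix m j assume m: "m \<in> power_torsion R Y (C j)"
  then have mM: "m \<in> carrier (C j)" by (simp add: power_torsion_def)
  have "\<exists>n::nat. (y [^] n) \<odot>\<^bsub>C (Suc j)\<^esub> \<delta> j m = \<zero>\<^bsub>C (Suc j)\<^esub>" if y: "y \<in> Y" for y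
  proof -
    obtain n :: nat where n: "(y [^] n) \<odot>\<^bsub>C j\<^esub> m = \<zero>\<^bsub>C j\<^esub>"
      using m y unfolding power_torsion_def by blast
    have "y \<in> carrier R" using y assms by blast
    then have "(y [^] n) \<odot>\<^bsub>C (Suc j)\<^esub> \<delta> j m = \<delta> j ((y [^] n) \<odot>\<^bsub>C j\<^esub> m)"
      using mM by (simp add: d_smult)
    then show ?thesis using n by (intro exI[of _ n]) simp
  qed
  then show "\<delta> j m \<in> power_torsion R Y (C (Suc j))" using mM unfolding power_torsion_def by simp
qed

end

text \<open>Multiplication by \<open>x\<close> gives a short exact sequence
  \<open>0 -> K -> S -> S -> 0\<close> of complexes. The lemmas of this locale are the pieces of its
  long exact cohomology sequence, stated for cycles and boundaries.\<close>

locale divisible_subcomplex = subcomplex R C \<delta> S for R (structure) and C :: "nat \<Rightarrow> ('a, 'm) module" and \<delta> S +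
  fixes x :: 'a
  assumes x [simp]: "x \<in> carrier R"
    and divisible: "m \<in> S j \<Longrightarrow> \<exists>e\<in>S j. x \<odot>\<^bsub>C j\<^esub> e = m"
begin

definition "K j = {m \<in> S j. x \<odot>\<^bsub>C j\<^esub> m = \<zero>\<^bsub>C j\<^esub>}"

sublocale K: subcomplex R C \<delta> K
proof (intro subcomplex.intro subcomplex_axioms.intro)
  show "module_complex R C \<delta>" by (rule module_complex_axioms)
  fix j
  show "submodule (K j) R (C j)"
  proof (rule C.submoduleI)
    show "r \<odot>\<^bsub>C j\<^esub> m \<in> K j" if "r \<in> carrier R" "m \<in> K j" for r m
      using that C.smult_lcomm[of x r m] by (simp add: K_def sub_smult)
    show "\<ominus>\<^bsub>C j\<^esub> m \<in> K j" if "m \<in> K j" for m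
      using that C.submoduleE(3)[OF sub[of j]] by (simp add: K_def C.smult_r_minus)
  qed (auto simp: K_def sub_closed C.smult_r_distr)
  show "\<delta> j m \<in> K (Suc j)" if "m \<in> K j" for m
    using that by (simp add: K_def sub_closed flip: d_smult)
qed

text \<open>If \<open>x\<close> is surjective on the cohomology of \<open>S\<close> in degree
  \<open>j\<close>, the connecting map into degree \<open>Suc j\<close> of \<open>K\<close> is zero,
  so the cohomology of \<open>K\<close> there injects into that of \<open>S\<close>.\<close>

lemma boundary_in_kernel:
  assumes z: "z \<in> K (Suc j)" "z \<in> \<delta> j ` S j"
    and surj: "\<And>z. z \<in> cycles C \<delta> S j \<Longrightarrow>
      \<exists>z'\<in>cycles C \<delta> S j. z \<ominus>\<^bsub>C j\<^esub> x \<odot>\<^bsub>C j\<^esub> z' \<in> boundaries C \<delta> S j"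
  shows "z \<in> \<delta> j ` K j"
proof -
  obtain v where v: "v \<in> S j" "z = \<delta> j v" using z by blast
  have "x \<odot>\<^bsub>C j\<^esub> v \<in> cycles C \<delta> S j"
    using v z by (simp add: cycles_def sub_closed d_simps K_def)
  then obtain z' where z': "z' \<in> cycles C \<delta> S j"
    and b: "x \<odot>\<^bsub>C j\<^esub> v \<ominus>\<^bsub>C j\<^esub> x \<odot>\<^bsub>C j\<^esub> z' \<in> boundaries C \<delta> S j" using surj by blast
  have z'S: "z' \<in> S j" using z' by (simp add: cycles_def)
  \<comment> \<open>The error term is a boundary, and by divisibility one degree lower it is
    \<open>x\<close> times a boundary; so it can be subtracted from \<open>v\<close> before
    \<open>x\<close> is applied.\<close>
  have "\<exists>b\<in>S j. \<delta> j b = \<zero>\<^bsub>C (Suc j)\<^esub> \<and>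
      x \<odot>\<^bsub>C j\<^esub> v \<ominus>\<^bsub>C j\<^esub> x \<odot>\<^bsub>C j\<^esub> z' = x \<odot>\<^bsub>C j\<^esub> b"
  proof (cases j)
    case 0
    then show ?thesis using b by (intro bexI[of _ "\<zero>\<^bsub>C j\<^esub>"]) (auto simp: boundaries_def sub_zero)
  next
    case (Suc i)
    then obtain u where u: "u \<in> S i" "x \<odot>\<^bsub>C j\<^esub> v \<ominus>\<^bsub>C j\<^esub> x \<odot>\<^bsub>C j\<^esub> z' = \<delta> i u"
      using b by (auto simp: boundaries_def)
    then obtain u' where "u' \<in> S i" "x \<odot>\<^bsub>C i\<^esub> u' = u" using divisible by blast
    then show ?thesis using u Suc by (intro bexI[of _ "\<delta> i u'"]) (auto simp: sub_closed d_simps)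
  qed
  then obtain b where b: "b \<in> S j" "\<delta> j b = \<zero>\<^bsub>C (Suc j)\<^esub>"
    "x \<odot>\<^bsub>C j\<^esub> v \<ominus>\<^bsub>C j\<^esub> x \<odot>\<^bsub>C j\<^esub> z' = x \<odot>\<^bsub>C j\<^esub> b" by blast
  have "v \<ominus>\<^bsub>C j\<^esub> z' \<ominus>\<^bsub>C j\<^esub> b \<in> K j"
    using b v z'S by (simp add: K_def sub_closed C.module_simps)
  moreover have "z = \<delta> j (v \<ominus>\<^bsub>C j\<^esub> z' \<ominus>\<^bsub>C j\<^esub> b)"
    using b v z'S cycles_d[OF z'] by (simp add: d_simps sub_closed C.module_simps)
  ultimately show ?thesis by blast
qed

text \<open>The kernel of \<open>x\<close> on the cohomology in degree \<open>Suc j\<close> is the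
  image of the cohomology of \<open>K\<close> there, which is zero.\<close>

lemma mult_injective_mod_boundaries:
  assumes ex: "exact_at C \<delta> K j" and z: "z \<in> cycles C \<delta> S (Suc j)"
    and b: "x \<odot>\<^bsub>C (Suc j)\<^esub> z \<in> \<delta> j ` S j"
  shows "z \<in> \<delta> j ` S j"
proof -
  have zS: "z \<in> S (Suc j)" using z by (rule cycles_sub)
  obtain b where b: "b \<in> S j" "x \<odot>\<^bsub>C (Suc j)\<^esub> z = \<delta> j b" using b by blast
  then obtain b' where b': "b' \<in> S j" "x \<odot>\<^bsub>C j\<^esub> b' = b" using divisible by blast
  have "z \<ominus>\<^bsub>C (Suc j)\<^esub> \<delta> j b' \<in> cycles C \<delta> K (Suc j)"
    using b b' zS cycles_d[OF z] unfolding cycles_def K_def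
    by (auto simp: sub_closed d_simps C.module_simps)
  then obtain t where t: "t \<in> K j" "z \<ominus>\<^bsub>C (Suc j)\<^esub> \<delta> j b' = \<delta> j t"
    using K.exact_imp_boundary[OF ex] by blast
  have tS: "t \<in> S j" using t by (simp add: K_def)
  have "z = \<delta> j (t \<oplus>\<^bsub>C j\<^esub> b')"
    using t(2) tS b' zS by (simp add: d_simps C.diff_eq_iff)
  then show ?thesis using tS b' sub_add by blast
qed

text \<open>The connecting map out of degree \<open>j\<close> has zero target. Since
  \<open>x\<close> is surjective on \<open>S\<close> itself, cycles are divided exactly and not just
  up to boundaries.\<close>

lemma mult_surjective_on_cycles:
  assumes ex: "exact_at C \<delta> K j" and z: "z \<in> cycles C \<delta> S j"
  shows "\<exists>z'\<in>cycles C \<delta> S j. x \<odot>\<^bsub>C j\<^esub> z' = z"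
proof -
  have zS: "z \<in> S j" using z by (rule cycles_sub)
  obtain w where w: "w \<in> S j" "x \<odot>\<^bsub>C j\<^esub> w = z" using divisible zS by blast
  have "\<delta> j w \<in> cycles C \<delta> K (Suc j)"
    using w cycles_d[OF z] by (simp add: cycles_def K_def sub_closed dd flip: d_smult)
  then obtain t where t: "t \<in> K j" "\<delta> j w = \<delta> j t" using K.exact_imp_boundary[OF ex] by blast
  have tS: "t \<in> S j" "x \<odot>\<^bsub>C j\<^esub> t = \<zero>\<^bsub>C j\<^esub>" using t by (auto simp: K_def)
  have "w \<ominus>\<^bsub>C j\<^esub> t \<in> cycles C \<delta> S j"
    using w t tS by (simp add: cycles_def sub_closed d_simps C.diff_eq_iff)
  moreover have "x \<odot>\<^bsub>C j\<^esub> (w \<ominus>\<^bsub>C j\<^esub> t) = z"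
    using w tS zS by (simp add: C.smult_r_diff C.diff_eq_iff)
  ultimately show ?thesis by blast
qed

text \<open>\<open>x\<close> acts injectively and locally nilpotently on the cohomology of \<open>S\<close>.\<close>

lemma exact_if_kernel_exact:
  assumes ex: "exact_at C \<delta> K j"
    and tors: "\<And>m. m \<in> S (Suc j) \<Longrightarrow> \<exists>k::nat. (x [^] k) \<odot>\<^bsub>C (Suc j)\<^esub> m = \<zero>\<^bsub>C (Suc j)\<^esub>"
  shows "exact_at C \<delta> S j"
  unfolding exact_at_def
proof
  fix z assume z: "z \<in> cycles C \<delta> S (Suc j)"
  then obtain k :: nat where k: "(x [^] k) \<odot>\<^bsub>C (Suc j)\<^esub> z = \<zero>\<^bsub>C (Suc j)\<^esub>"
    using tors cycles_sub by blast
  have "z \<in> \<delta> j ` S j" if "(x [^] k) \<odot>\<^bsub>C (Suc j)\<^esub> z \<in> \<delta> j ` S j" "z \<in> cycles C \<delta> S (Suc j)" for k :: nat and z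
    using that
  proof (induction k arbitrary: z)
    case 0
    then show ?case using cycles_sub by simp
  next
    case (Suc k)
    have zS: "z \<in> S (Suc j)" using Suc by (simp add: cycles_sub)
    have "(x [^] k) \<odot>\<^bsub>C (Suc j)\<^esub> (x \<odot>\<^bsub>C (Suc j)\<^esub> z) \<in> \<delta> j ` S j"
      using Suc zS by (simp add: C.smult_assoc1)
    then have "x \<odot>\<^bsub>C (Suc j)\<^esub> z \<in> \<delta> j ` S j"
      using Suc.IH cycles_closed(3)[OF Suc.prems(2) x] by blast
    then show ?case using mult_injective_mod_boundaries[OF ex Suc.prems(2)] by blast
  qed
  moreover have "\<zero>\<^bsub>C (Suc j)\<^esub> \<in> \<delta> j ` S j"
    using zero_boundary[of "Suc j"] by (simp add: boundaries_def)
  ultimately show "z \<in> \<delta> j ` S j" using z k by metis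
qed

text \<open>In degree \<open>Suc j\<close>, the cohomology of \<open>K\<close> lies between the
  cokernel of \<open>x\<close> in degree \<open>j\<close> and the cohomology of \<open>S\<close>,
  both of which vanish.\<close>

lemma kernel_exact_if_exact:
  assumes ex: "exact_at C \<delta> S j"
    and surj: "\<And>z. z \<in> cycles C \<delta> S j \<Longrightarrow>
      \<exists>z'\<in>cycles C \<delta> S j. z \<ominus>\<^bsub>C j\<^esub> x \<odot>\<^bsub>C j\<^esub> z' \<in> boundaries C \<delta> S j"
  shows "exact_at C \<delta> K j"
  unfolding exact_at_def
proof
  fix z assume "z \<in> cycles C \<delta> K (Suc j)"
  moreover from this have "z \<in> cycles C \<delta> S (Suc j)" by (simp add: cycles_def K_def)
  ultimately show "z \<in> \<delta> j ` K j"
    using boundary_in_kernel[OF _ _ surj] ex by (auto simp: exact_at_def cycles_def)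
qed

lemma surj_if_boundaries:
  assumes "cycles C \<delta> S j \<subseteq> boundaries C \<delta> S j" "z \<in> cycles C \<delta> S j"
  shows "\<exists>z'\<in>cycles C \<delta> S j. z \<ominus>\<^bsub>C j\<^esub> x \<odot>\<^bsub>C j\<^esub> z' \<in> boundaries C \<delta> S j"
proof -
  have "\<zero>\<^bsub>C j\<^esub> \<in> cycles C \<delta> S j" by (simp add: cycles_def sub_zero)
  moreover have "z \<ominus>\<^bsub>C j\<^esub> x \<odot>\<^bsub>C j\<^esub> \<zero>\<^bsub>C j\<^esub> = z"
    using cycles_sub[OF assms(2)] by (simp add: C.diff_eq_iff)
  ultimately show ?thesis using assms by (metis subsetD)
qed

end

section \<open>Injective resolutions and regular sequences\<close>

lemma (in module) colon_genideal:
  assumes "Y \<subseteq> carrier R" "m \<in> carrier M"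
  shows "(\<forall>a\<in>Idl Y. a \<odot>\<^bsub>M\<^esub> m = \<zero>\<^bsub>M\<^esub>) \<longleftrightarrow> (\<forall>a\<in>Y. a \<odot>\<^bsub>M\<^esub> m = \<zero>\<^bsub>M\<^esub>)"
proof
  assume "\<forall>a\<in>Y. a \<odot>\<^bsub>M\<^esub> m = \<zero>\<^bsub>M\<^esub>"
  then have "Y \<subseteq> annihilator R M m" using assms by (auto simp: annihilator_def)
  then have "Idl Y \<subseteq> annihilator R M m"
    by (rule R.genideal_minimal[OF ideal_annihilator[OF assms(2)]])
  then show "\<forall>a\<in>Idl Y. a \<odot>\<^bsub>M\<^esub> m = \<zero>\<^bsub>M\<^esub>" by (auto simp: annihilator_def)
qed (use R.genideal_self[OF assms(1)] in blast)

text \<open>An injective resolution \<open>C 1 \<rightarrow> C 2 \<rightarrow> \<dots>\<close> of \<open>R\<close>, where \<open>e0\<close> is the image of \<open>\<one>\<close>, preceded by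
  \<open>C 0 = 0\<close>.\<close>

locale regular_resolution = module_complex R C \<delta>
  for R (structure) and C :: "nat \<Rightarrow> ('a, 'm) module" and \<delta> +
  fixes xs :: "'a list" and e0 :: 'm
  assumes regular: "regular_sequence R xs"
    and C0: "carrier (C 0) = {\<zero>\<^bsub>C 0\<^esub>}"
    and baer: "baer R {\<zero>} (C j) (carrier (C j))"
    and exact: "j \<noteq> 0 \<Longrightarrow> exact_at C \<delta> (\<lambda>j. carrier (C j)) j"
    and e0: "e0 \<in> cycles C \<delta> (\<lambda>j. carrier (C j)) (Suc 0)"
    and e0_free: "a \<in> carrier R \<Longrightarrow> a \<odot>\<^bsub>C (Suc 0)\<^esub> e0 = \<zero>\<^bsub>C (Suc 0)\<^esub> \<Longrightarrow> a = \<zero>"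
    and e0_gen: "z \<in> cycles C \<delta> (\<lambda>j. carrier (C j)) (Suc 0) \<Longrightarrow>
      \<exists>a\<in>carrier R. z = a \<odot>\<^bsub>C (Suc 0)\<^esub> e0"
begin

abbreviation "r \<equiv> length xs"

definition "c k = Idl (set (take k xs))"

text \<open>This is \<open>Hom(R / c k, C j)\<close>; the cohomology of \<open>F k\<close> is
  therefore \<open>Ext(R / c k, R)\<close>, with degrees raised by one.\<close>

definition "F k j = {m \<in> carrier (C j). \<forall>a\<in>c k. a \<odot>\<^bsub>C j\<^esub> m = \<zero>\<^bsub>C j\<^esub>}"

lemma xs_carrier: "set xs \<subseteq> carrier R" "k < r \<Longrightarrow> xs ! k \<in> carrier R"
  using regular nth_mem[of k xs] by (auto simp only: regular_sequence_def)

lemma take_carrier: "set (take k xs) \<subseteq> carrier R"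
  using xs_carrier(1) set_take_subset by fast

lemma ideal_c: "ideal (c k) R"
  unfolding c_def by (rule genideal_ideal[OF take_carrier])

lemma c_carrier [simp]: "a \<in> c k \<Longrightarrow> a \<in> carrier R"
  using ideal_closed(2)[OF ideal_c] .

lemma c0: "c 0 = {\<zero>}"
proof -
  have "c 0 \<subseteq> {\<zero>}" unfolding c_def by (rule genideal_minimal[OF zeroideal]) simp
  then show ?thesis using ideal_closed(1)[OF ideal_c] by blast
qed

lemma regular_c: "k < r \<Longrightarrow> a \<in> carrier R \<Longrightarrow> xs ! k \<otimes> a \<in> c k \<Longrightarrow> a \<in> c k"
  using regular by (auto simp: regular_sequence_def c_def)

lemma one_notin_c: "\<one> \<notin> c r"
  using ideal.one_imp_carrier[OF ideal_c, of r] regular by (auto simp only: regular_sequence_def c_def take_all)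

lemma F_iff:
  assumes "k \<le> r"
  shows "m \<in> F k j \<longleftrightarrow> m \<in> carrier (C j) \<and> (\<forall>i<k. (xs ! i) \<odot>\<^bsub>C j\<^esub> m = \<zero>\<^bsub>C j\<^esub>)"
proof (cases "m \<in> carrier (C j)")
  case True
  then have "m \<in> F k j \<longleftrightarrow> (\<forall>a\<in>set (take k xs). a \<odot>\<^bsub>C j\<^esub> m = \<zero>\<^bsub>C j\<^esub>)"
    unfolding F_def c_def by (simp add: C.colon_genideal[OF take_carrier])
  then show ?thesis using True assms by (auto simp flip: nth_image)
qed (simp add: F_def)

lemma F_0: "F 0 j = carrier (C j)"
  using F_iff[of 0] by auto

lemma F_Suc: "k < r \<Longrightarrow> F (Suc k) j = {m \<in> F k j. (xs ! k) \<odot>\<^bsub>C j\<^esub> m = \<zero>\<^bsub>C j\<^esub>}"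
  by (auto simp: F_iff less_Suc_eq)

lemma F_kill: "m \<in> F k j \<Longrightarrow> a \<in> c k \<Longrightarrow> a \<odot>\<^bsub>C j\<^esub> m = \<zero>\<^bsub>C j\<^esub>"
  by (simp add: F_def)

lemma subcomplex_F: "subcomplex R C \<delta> (F k)"
proof (intro subcomplex.intro subcomplex_axioms.intro)
  show "module_complex R C \<delta>" by (rule module_complex_axioms)
  show "submodule (F k j) R (C j)" for j
    unfolding F_def by (rule C.submodule_colon_zero) auto
  show "\<delta> j m \<in> F k (Suc j)" if "m \<in> F k j" for m j
    using that by (auto simp: F_def simp flip: d_smult)
qed

sublocale F: subcomplex R C \<delta> "F k" for k
  by (rule subcomplex_F)

lemma baer_F: "baer R (c k) (C j) (F k j)"
  unfolding F_def by (rule C.baer_colon_zero[OF baer]) (simp add: ideal_closed(1)[OF ideal_c])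

text \<open>As \<open>xs ! k\<close> is regular modulo \<open>c k\<close>, every \<open>u\<close>
  with \<open>u \<otimes> xs ! k\<close> in \<open>c k\<close> already lies in \<open>c k\<close>
  and kills \<open>m\<close>, so the principal extension applies.\<close>

lemma divisible_F:
  assumes "k < r" "m \<in> F k j"
  shows "\<exists>e\<in>F k j. (xs ! k) \<odot>\<^bsub>C j\<^esub> e = m"
proof -
  have "u \<odot>\<^bsub>C j\<^esub> m = \<zero>\<^bsub>C j\<^esub>" if "u \<in> carrier R" "u \<otimes> xs ! k \<in> c k" for u
    using that regular_c[OF assms(1), of u] xs_carrier(2)[OF assms(1)] F_kill[OF assms(2)]
    by (simp add: m_comm)
  then show ?thesis
    using C.baer_extend_principal[OF baer_F F.sub ideal_c order_refl xs_carrier(2)[OF assms(1)] assms(2)]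
    by blast
qed

lemma divisible_subcomplex_F: "k < r \<Longrightarrow> divisible_subcomplex R C \<delta> (F k) (xs ! k)"
  by (intro divisible_subcomplex.intro divisible_subcomplex_axioms.intro subcomplex_F
      xs_carrier divisible_F)

lemma kernel_F:
  assumes "k < r"
  shows "divisible_subcomplex.K C (F k) (xs ! k) = F (Suc k)"
  by (rule ext) (simp add: divisible_subcomplex.K_def[OF divisible_subcomplex_F[OF assms]] F_Suc[OF assms])

text \<open>In degree 0 there is no exactness to invoke, but \<open>C 0\<close> is zero. This is
  what the zero term in front of the resolution provides: every degree can be treated alike.\<close>

lemma cycles_subset_boundaries:
  assumes "\<And>i. j = Suc i \<Longrightarrow> exact_at C \<delta> S i" "subcomplex R C \<delta> S"
  shows "cycles C \<delta> S j \<subseteq> boundaries C \<delta> S j"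
proof (cases j)
  case 0
  interpret S: subcomplex R C \<delta> S by fact
  have "z = \<zero>\<^bsub>C 0\<^esub>" if "z \<in> S 0" for z using S.sub_carrier[OF that] C0 by blast
  then show ?thesis unfolding 0 cycles_def boundaries_def by auto
next
  case (Suc i)
  then show ?thesis using assms(1)[of i] by (simp add: exact_at_def boundaries_def)
qed

text \<open>The generator for \<open>Suc k\<close> is the image of \<open>e\<close> under the connecting homomorphism of
  \<open>0 \<rightarrow> F (Suc k) \<rightarrow> F k \<rightarrow> F k \<rightarrow> 0\<close>.\<close>

lemma cohomology_F:
  assumes "k \<le> r"
  shows "(\<forall>j. j \<noteq> k \<longrightarrow> exact_at C \<delta> (F k) j) \<and>
    (\<exists>e\<in>cycles C \<delta> (F k) (Suc k).
       (\<forall>z\<in>cycles C \<delta> (F k) (Suc k). \<exists>a\<in>carrier R. z \<ominus>\<^bsub>C (Suc k)\<^esub> a \<odot>\<^bsub>C (Suc k)\<^esub> e \<in> \<delta> k ` F k k) \<and>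
       (\<forall>a\<in>carrier R. a \<odot>\<^bsub>C (Suc k)\<^esub> e \<in> \<delta> k ` F k k \<longrightarrow> a \<in> c k))"
  using assms
proof (induction k)
  case 0
  have F0: "F 0 = (\<lambda>j. carrier (C j))" using F_0 by blast
  have "\<delta> 0 ` carrier (C 0) = {\<zero>\<^bsub>C (Suc 0)\<^esub>}" using C0 by auto
  moreover have "\<exists>a\<in>carrier R. z \<ominus>\<^bsub>C (Suc 0)\<^esub> a \<odot>\<^bsub>C (Suc 0)\<^esub> e0 = \<zero>\<^bsub>C (Suc 0)\<^esub>"
    if z: "z \<in> cycles C \<delta> (F 0) (Suc 0)" for z
  proof -
    obtain a where "a \<in> carrier R" "z = a \<odot>\<^bsub>C (Suc 0)\<^esub> e0" using z e0_gen F0 by auto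
    moreover have "e0 \<in> carrier (C (Suc 0))" using e0 by (simp add: cycles_def)
    ultimately show ?thesis by (intro bexI[of _ a]) (auto simp: C.diff_eq_iff)
  qed
  ultimately show ?case
    using exact e0 e0_free unfolding F0 c0 by (auto intro!: bexI[of _ e0])
next
  case (Suc k)
  then have k: "k < r" by simp
  let ?x = "xs ! k"
  interpret D: divisible_subcomplex R C \<delta> "F k" ?x by (rule divisible_subcomplex_F[OF k])
  have DK: "D.K = F (Suc k)" by (rule kernel_F[OF k])
  have ck: "c k \<subseteq> c (Suc k)"
    unfolding c_def[of k]
  proof (rule genideal_minimal[OF ideal_c])
    have "set (take k xs) \<subseteq> set (take (Suc k) xs)" by (rule set_take_subset_set_take) simp
    then show "set (take k xs) \<subseteq> c (Suc k)"
      unfolding c_def using genideal_self[OF take_carrier] by blast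
  qed
  have xk: "?x \<in> c (Suc k)"
    unfolding c_def using k genideal_self[OF take_carrier, of "Suc k"]
    by (auto simp: take_Suc_conv_app_nth)
  note IH = Suc.IH[OF less_imp_le[OF k]]
  have ex: "exact_at C \<delta> (F k) j" if "j \<noteq> k" for j using IH that by blast
  from IH obtain e where e: "e \<in> cycles C \<delta> (F k) (Suc k)"
    and gen': "\<forall>z\<in>cycles C \<delta> (F k) (Suc k). \<exists>a\<in>carrier R. z \<ominus>\<^bsub>C (Suc k)\<^esub> a \<odot>\<^bsub>C (Suc k)\<^esub> e \<in> \<delta> k ` F k k"
    and free': "\<forall>a\<in>carrier R. a \<odot>\<^bsub>C (Suc k)\<^esub> e \<in> \<delta> k ` F k k \<longrightarrow> a \<in> c k"
    by (elim conjE bexE)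
  have gen: "\<exists>a\<in>carrier R. z \<ominus>\<^bsub>C (Suc k)\<^esub> a \<odot>\<^bsub>C (Suc k)\<^esub> e \<in> \<delta> k ` F k k"
    if "z \<in> cycles C \<delta> (F k) (Suc k)" for z using gen' that by (rule bspec)
  have free: "a \<in> c k" if "a \<in> carrier R" "a \<odot>\<^bsub>C (Suc k)\<^esub> e \<in> \<delta> k ` F k k" for a
    using free' that by simp
  have eF: "e \<in> F k (Suc k)" using e by (rule F.cycles_sub)
  have exact': "exact_at C \<delta> (F (Suc k)) j" if j: "j \<noteq> Suc k" for j
    unfolding exact_at_def
  proof
    fix z assume z: "z \<in> cycles C \<delta> (F (Suc k)) (Suc j)"
    then have zK: "z \<in> D.K (Suc j)" unfolding DK by (rule F.cycles_sub)
    then have zF: "z \<in> F k (Suc j)" and xz: "?x \<odot>\<^bsub>C (Suc j)\<^esub> z = \<zero>\<^bsub>C (Suc j)\<^esub>"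
      by (auto simp: D.K_def)
    have zc: "z \<in> cycles C \<delta> (F k) (Suc j)" using z zF by (simp add: cycles_def)
    have "z \<in> \<delta> j ` F k j"
    proof (cases "j = k")
      case False
      then show ?thesis using ex[of j] zc by (auto simp: exact_at_def)
    next
      \<comment> \<open>Here regularity enters: \<open>x\<close> is injective on the cohomology
        \<open>R / c k\<close> of \<open>F k\<close>, so a class killed by \<open>x\<close> is
        zero.\<close>
      case True
      then obtain a u where a: "a \<in> carrier R" "u \<in> F k k" "z \<ominus>\<^bsub>C (Suc k)\<^esub> a \<odot>\<^bsub>C (Suc k)\<^esub> e = \<delta> k u"
        using gen zc by blast
      have z_eq: "z = \<delta> k u \<oplus>\<^bsub>C (Suc k)\<^esub> a \<odot>\<^bsub>C (Suc k)\<^esub> e"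
        using a eF zF True by (simp add: C.diff_eq_iff)
      have "(?x \<otimes> a) \<odot>\<^bsub>C (Suc k)\<^esub> e = ?x \<odot>\<^bsub>C (Suc k)\<^esub> z \<ominus>\<^bsub>C (Suc k)\<^esub> ?x \<odot>\<^bsub>C (Suc k)\<^esub> \<delta> k u"
        using a eF by (simp add: z_eq C.smult_r_distr C.smult_assoc1 C.eq_diff_iff C.M.a_comm)
      also have "\<dots> = \<delta> k (\<zero>\<^bsub>C k\<^esub> \<ominus>\<^bsub>C k\<^esub> ?x \<odot>\<^bsub>C k\<^esub> u)"
        using a xz True by (simp add: d_simps)
      finally have "(?x \<otimes> a) \<odot>\<^bsub>C (Suc k)\<^esub> e = \<delta> k (\<zero>\<^bsub>C k\<^esub> \<ominus>\<^bsub>C k\<^esub> ?x \<odot>\<^bsub>C k\<^esub> u)" .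
      moreover have "\<zero>\<^bsub>C k\<^esub> \<ominus>\<^bsub>C k\<^esub> ?x \<odot>\<^bsub>C k\<^esub> u \<in> F k k"
        using a by (simp add: F.sub_closed)
      ultimately have "(?x \<otimes> a) \<odot>\<^bsub>C (Suc k)\<^esub> e \<in> \<delta> k ` F k k" by (rule image_eqI)
      then have "?x \<otimes> a \<in> c k" by (rule free[rotated]) (simp add: a(1))
      then have "a \<in> c k" using regular_c[OF k a(1)] by blast
      then have "z = \<delta> k u" using z_eq F_kill[OF eF] a by simp
      then show ?thesis using a True by blast
    qed
    moreover have "cycles C \<delta> (F k) j \<subseteq> boundaries C \<delta> (F k) j"
      by (rule cycles_subset_boundaries[OF _ subcomplex_F]) (use ex j in auto)
    ultimately show "z \<in> \<delta> j ` F (Suc k) j"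
      using D.boundary_in_kernel[OF zK _ D.surj_if_boundaries] unfolding DK by blast
  qed
  obtain w where w: "w \<in> F k (Suc k)" "?x \<odot>\<^bsub>C (Suc k)\<^esub> w = e" using D.divisible[OF eF] by blast
  define e' where "e' = \<delta> (Suc k) w"
  have "e' \<in> D.K (Suc (Suc k))"
    using w F.cycles_d[OF e] by (simp add: e'_def D.K_def F.sub_closed flip: d_smult)
  then have e': "e' \<in> cycles C \<delta> (F (Suc k)) (Suc (Suc k))"
    using w by (simp add: cycles_def DK e'_def dd)
  have gen2: "\<exists>a\<in>carrier R. z \<ominus>\<^bsub>C (Suc (Suc k))\<^esub> a \<odot>\<^bsub>C (Suc (Suc k))\<^esub> e' \<in> \<delta> (Suc k) ` F (Suc k) (Suc k)"
    if z: "z \<in> cycles C \<delta> (F (Suc k)) (Suc (Suc k))" for z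
  proof -
    have zF: "z \<in> F k (Suc (Suc k))" "?x \<odot>\<^bsub>C (Suc (Suc k))\<^esub> z = \<zero>\<^bsub>C (Suc (Suc k))\<^esub>"
      using F.cycles_sub[OF z] F_Suc[OF k] by auto
    have "z \<in> cycles C \<delta> (F k) (Suc (Suc k))" using z zF by (simp add: cycles_def)
    then obtain v where v: "v \<in> F k (Suc k)" "z = \<delta> (Suc k) v"
      using F.exact_imp_boundary[OF ex, of "Suc k"] by auto
    have "?x \<odot>\<^bsub>C (Suc k)\<^esub> v \<in> cycles C \<delta> (F k) (Suc k)"
      using v zF by (simp add: cycles_def F.sub_closed d_simps)
    then obtain a u where a: "a \<in> carrier R" "u \<in> F k k"
      "?x \<odot>\<^bsub>C (Suc k)\<^esub> v \<ominus>\<^bsub>C (Suc k)\<^esub> a \<odot>\<^bsub>C (Suc k)\<^esub> e = \<delta> k u" using gen by blast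
    obtain u' where u': "u' \<in> F k k" "?x \<odot>\<^bsub>C k\<^esub> u' = u" using D.divisible[OF a(2)] by blast
    \<comment> \<open>The preimage \<open>v\<close> of \<open>z\<close>, corrected so that
      \<open>x\<close> kills it: \<open>a \<odot> w\<close> accounts for the multiple of
      \<open>e\<close> in \<open>x \<odot> v\<close>, and \<open>\<delta> k u'\<close> for the
      boundary.\<close>
    define t where "t = v \<ominus>\<^bsub>C (Suc k)\<^esub> (a \<odot>\<^bsub>C (Suc k)\<^esub> w \<oplus>\<^bsub>C (Suc k)\<^esub> \<delta> k u')"
    have tF: "t \<in> F k (Suc k)" using a u' v w by (simp add: t_def F.sub_closed)
    have "?x \<odot>\<^bsub>C (Suc k)\<^esub> v = \<delta> k u \<oplus>\<^bsub>C (Suc k)\<^esub> a \<odot>\<^bsub>C (Suc k)\<^esub> e"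
      using a v eF by (simp add: C.diff_eq_iff)
    moreover have "?x \<odot>\<^bsub>C (Suc k)\<^esub> \<delta> k u' = \<delta> k u" using u' by (simp flip: d_smult)
    moreover have "?x \<odot>\<^bsub>C (Suc k)\<^esub> (a \<odot>\<^bsub>C (Suc k)\<^esub> w) = a \<odot>\<^bsub>C (Suc k)\<^esub> e"
      using w a C.smult_lcomm[of ?x a w] by simp
    ultimately have "?x \<odot>\<^bsub>C (Suc k)\<^esub> t = \<zero>\<^bsub>C (Suc k)\<^esub>"
      using a u' v w eF by (simp add: t_def C.smult_r_diff C.smult_r_distr C.diff_eq_iff C.M.a_comm)
    then have "t \<in> F (Suc k) (Suc k)" using tF F_Suc[OF k] by simp
    moreover have "z \<ominus>\<^bsub>C (Suc (Suc k))\<^esub> a \<odot>\<^bsub>C (Suc (Suc k))\<^esub> e' = \<delta> (Suc k) t"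
      using a u' v w by (simp add: t_def e'_def d_simps)
    ultimately show ?thesis using a by blast
  qed
  have free2: "a \<in> c (Suc k)"
    if a: "a \<in> carrier R" "a \<odot>\<^bsub>C (Suc (Suc k))\<^esub> e' \<in> \<delta> (Suc k) ` F (Suc k) (Suc k)" for a
  proof -
    obtain v where vF: "v \<in> F (Suc k) (Suc k)" and av: "a \<odot>\<^bsub>C (Suc (Suc k))\<^esub> e' = \<delta> (Suc k) v"
      using a(2) by (elim imageE)
    have v: "v \<in> F k (Suc k)" "?x \<odot>\<^bsub>C (Suc k)\<^esub> v = \<zero>\<^bsub>C (Suc k)\<^esub>"
      using vF F_Suc[OF k] by simp_all
    \<comment> \<open>If \<open>a \<odot> e'\<close> bounds by \<open>v\<close>, this difference is
      a cycle of \<open>F k\<close>, hence \<open>b \<odot> e\<close> up to boundaries. Multiplying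
      by \<open>x\<close>, which kills \<open>v\<close> and sends \<open>w\<close> to
      \<open>e\<close>, shows that \<open>a - x b\<close> kills the class of \<open>e\<close>, so
      \<open>a\<close> lies in \<open>c k + R x\<close>.\<close>
    have "a \<odot>\<^bsub>C (Suc k)\<^esub> w \<ominus>\<^bsub>C (Suc k)\<^esub> v \<in> cycles C \<delta> (F k) (Suc k)"
      using a(1) v(1) w(1) av[unfolded e'_def] by (simp add: cycles_def F.sub_closed d_simps C.diff_eq_iff)
    then obtain b u where b: "b \<in> carrier R" "u \<in> F k k"
      "a \<odot>\<^bsub>C (Suc k)\<^esub> w \<ominus>\<^bsub>C (Suc k)\<^esub> v \<ominus>\<^bsub>C (Suc k)\<^esub> b \<odot>\<^bsub>C (Suc k)\<^esub> e = \<delta> k u" using gen by blast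
    have "?x \<odot>\<^bsub>C (Suc k)\<^esub> (a \<odot>\<^bsub>C (Suc k)\<^esub> w \<ominus>\<^bsub>C (Suc k)\<^esub> v \<ominus>\<^bsub>C (Suc k)\<^esub> b \<odot>\<^bsub>C (Suc k)\<^esub> e) =
        a \<odot>\<^bsub>C (Suc k)\<^esub> e \<ominus>\<^bsub>C (Suc k)\<^esub> (?x \<otimes> b) \<odot>\<^bsub>C (Suc k)\<^esub> e"
      using a(1) b(1) v w eF C.smult_lcomm[of ?x a w]
      by (simp add: C.smult_r_diff C.smult_r_distr C.smult_assoc1 C.diff_eq_iff C.eq_diff_iff C.diff_diff_left C.diff_add_eq C.add_diff_eq)
    then have "(a \<ominus> ?x \<otimes> b) \<odot>\<^bsub>C (Suc k)\<^esub> e = \<delta> k (?x \<odot>\<^bsub>C k\<^esub> u)"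
      using a(1) b eF by (simp add: C.smult_l_diff d_simps)
    moreover have "?x \<odot>\<^bsub>C k\<^esub> u \<in> F k k" using b(2) by (simp add: F.sub_closed)
    ultimately have "(a \<ominus> ?x \<otimes> b) \<odot>\<^bsub>C (Suc k)\<^esub> e \<in> \<delta> k ` F k k" by (rule image_eqI)
    then have "a \<ominus> ?x \<otimes> b \<in> c k" by (rule free[rotated]) (simp add: a(1) b(1))
    then have "a \<ominus> ?x \<otimes> b \<in> c (Suc k)" "?x \<otimes> b \<in> c (Suc k)"
      using subsetD[OF ck] ideal_closed(7)[OF ideal_c b(1) xk] by blast+
    then have "(a \<ominus> ?x \<otimes> b) \<oplus> ?x \<otimes> b \<in> c (Suc k)" using ideal_closed(3)[OF ideal_c] by blast
    moreover have "(a \<ominus> ?x \<otimes> b) \<oplus> ?x \<otimes> b = a"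
      using a(1) b(1) by (simp add: a_minus_def a_assoc l_neg)
    ultimately show ?thesis by simp
  qed
  show ?case
  proof (intro conjI allI impI)
    show "exact_at C \<delta> (F (Suc k)) j" if "j \<noteq> Suc k" for j using that by (rule exact')
    show "\<exists>e\<in>cycles C \<delta> (F (Suc k)) (Suc (Suc k)).
       (\<forall>z\<in>cycles C \<delta> (F (Suc k)) (Suc (Suc k)). \<exists>a\<in>carrier R. z \<ominus>\<^bsub>C (Suc (Suc k))\<^esub> a \<odot>\<^bsub>C (Suc (Suc k))\<^esub> e \<in> \<delta> (Suc k) ` F (Suc k) (Suc k)) \<and>
       (\<forall>a\<in>carrier R. a \<odot>\<^bsub>C (Suc (Suc k))\<^esub> e \<in> \<delta> (Suc k) ` F (Suc k) (Suc k) \<longrightarrow> a \<in> c (Suc k))"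
    proof (rule bexI[OF _ e'], rule conjI)
      show "\<forall>z\<in>cycles C \<delta> (F (Suc k)) (Suc (Suc k)). \<exists>a\<in>carrier R. z \<ominus>\<^bsub>C (Suc (Suc k))\<^esub> a \<odot>\<^bsub>C (Suc (Suc k))\<^esub> e' \<in> \<delta> (Suc k) ` F (Suc k) (Suc k)"
        by (rule ballI) (rule gen2)
      show "\<forall>a\<in>carrier R. a \<odot>\<^bsub>C (Suc (Suc k))\<^esub> e' \<in> \<delta> (Suc k) ` F (Suc k) (Suc k) \<longrightarrow> a \<in> c (Suc k)"
        by (intro ballI impI) (rule free2)
    qed
  qed
qed

end

section \<open>Torsion subcomplexes\<close>

locale torsion_resolution = regular_resolution +
  fixes I :: "'a set"
  assumes I: "ideal I R" and xs_I: "set xs \<subseteq> I"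
begin

lemma I_carrier: "I \<subseteq> carrier R"
  using ideal_closed(2)[OF I] by blast

definition "G k j = F k j \<inter> power_torsion R I (C j)"

lemma G_F: "m \<in> G k j \<Longrightarrow> m \<in> F k j"
  by (simp add: G_def)

lemma G_torsion: "m \<in> G k j \<Longrightarrow> y \<in> I \<Longrightarrow> \<exists>n::nat. (y [^] n) \<odot>\<^bsub>C j\<^esub> m = \<zero>\<^bsub>C j\<^esub>"
  by (simp add: G_def power_torsion_def)

lemma subcomplex_G: "subcomplex R C \<delta> (G k)"
proof (intro subcomplex.intro subcomplex_axioms.intro)
  show "module_complex R C \<delta>" by (rule module_complex_axioms)
  show "submodule (G k j) R (C j)" for j
    unfolding G_def by (rule C.submodule_Int[OF F.sub C.submodule_power_torsion[OF I_carrier]])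
  show "\<delta> j m \<in> G k (Suc j)" if "m \<in> G k j" for m j
    using that F.sub_d subcomplex.sub_d[OF subcomplex_power_torsion[OF I_carrier]] unfolding G_def by blast
qed

sublocale G: subcomplex R C \<delta> "G k" for k
  by (rule subcomplex_G)

lemma noetherian_module_C: "noetherian_module R (C j)"
  by (intro noetherian_module.intro modules noetherian_ring_axioms)

lemma x_torsion: "k < r \<Longrightarrow> m \<in> G k' j \<Longrightarrow> \<exists>n::nat. (xs ! k [^] n) \<odot>\<^bsub>C j\<^esub> m = \<zero>\<^bsub>C j\<^esub>"
  using G_torsion xs_I nth_mem by blast

text \<open>A solution \<open>e\<close> in \<open>F k\<close> need not be torsion, but its multiple
  \<open>m\<close> is; \<open>power_torsion_divide\<close> exchanges \<open>e\<close> for a torsion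
  element with the same multiple.\<close>

lemma divisible_G:
  assumes k: "k < r" and m: "m \<in> G k j"
  shows "\<exists>e\<in>G k j. (xs ! k) \<odot>\<^bsub>C j\<^esub> e = m"
proof -
  interpret N: noetherian_module R "C j" by (rule noetherian_module_C)
  obtain e where e: "e \<in> F k j" "(xs ! k) \<odot>\<^bsub>C j\<^esub> e = m" using divisible_F[OF k G_F[OF m]] by blast
  have "\<exists>s\<in>F k j \<inter> power_torsion R I (C j). (xs ! k) \<odot>\<^bsub>C j\<^esub> s = (xs ! k) \<odot>\<^bsub>C j\<^esub> e"
    by (rule N.power_torsion_divide[OF baer_F F.sub _ xs_carrier(2)[OF k] e(1) I_carrier])
      (use F_kill c_carrier m e(2) in \<open>auto simp: G_def\<close>)
  then show ?thesis using e(2) by (simp add: G_def)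
qed

lemma divisible_subcomplex_G: "k < r \<Longrightarrow> divisible_subcomplex R C \<delta> (G k) (xs ! k)"
  by (intro divisible_subcomplex.intro divisible_subcomplex_axioms.intro subcomplex_G
      xs_carrier divisible_G)

lemma kernel_G:
  assumes "k < r"
  shows "divisible_subcomplex.K C (G k) (xs ! k) = G (Suc k)"
  by (rule ext) (auto simp: divisible_subcomplex.K_def[OF divisible_subcomplex_G[OF assms]]
      G_def F_Suc[OF assms])

text \<open>The kernel of \<open>xs ! k\<close> on \<open>G k\<close> is \<open>G (Suc k)\<close>,
  and \<open>xs ! k\<close> is locally nilpotent on \<open>G k\<close> because it lies in
  \<open>I\<close>; so exactness passes from the kernel to \<open>G k\<close>.\<close>

lemma exact_G_descend:
  assumes "exact_at C \<delta> (G r) j" "k \<le> r"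
  shows "exact_at C \<delta> (G k) j"
  using assms(2)
proof (induction k rule: inc_induct)
  case base
  show ?case by (rule assms(1))
next
  case (step k)
  interpret D: divisible_subcomplex R C \<delta> "G k" "xs ! k" by (rule divisible_subcomplex_G[OF step(2)])
  show ?case
    by (rule D.exact_if_kernel_exact) (use step kernel_G x_torsion in auto)
qed

text \<open>By exactness the cycles in degree \<open>Suc j\<close> are the image of
  \<open>F r j\<close>, and the kernel of this surjection consists of the cycles in degree
  \<open>j\<close>. So Baer's criterion climbs by \<open>baer_image\<close>, as long as exactness
  lasts.\<close>

lemma baer_cycles_F:
  assumes "j \<le> r"
  shows "baer R (c r) (C j) (cycles C \<delta> (F r) j)"
  using assms
proof (induction j)
  case 0
  have "cycles C \<delta> (F r) 0 \<subseteq> {\<zero>\<^bsub>C 0\<^esub>}"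
    using F.sub_carrier C0 unfolding cycles_def by blast
  moreover have "\<zero>\<^bsub>C 0\<^esub> \<in> cycles C \<delta> (F r) 0"
    by (simp add: cycles_def F.sub_zero)
  ultimately have Z: "cycles C \<delta> (F r) 0 = {\<zero>\<^bsub>C 0\<^esub>}" by blast
  show ?case
    unfolding baer_def Z
  proof (intro allI impI, elim conjE)
    fix T assume T: "linear_graph R (C 0) T" "snd ` T \<subseteq> {\<zero>\<^bsub>C 0\<^esub>}"
    have "v = a \<odot>\<^bsub>C 0\<^esub> \<zero>\<^bsub>C 0\<^esub>" if "(a, v) \<in> T" for a v
      using linear_graphD(1)[OF T(1) that] T(2) that by force
    then show "\<exists>s\<in>{\<zero>\<^bsub>C 0\<^esub>}. \<forall>(a, v)\<in>T. v = a \<odot>\<^bsub>C 0\<^esub> s" by blast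
  qed
next
  case (Suc j)
  have "exact_at C \<delta> (F r) j" using cohomology_F[of r] Suc(2) by simp
  then have "cycles C \<delta> (F r) (Suc j) = \<delta> j ` F r j"
    using F.d_cycle unfolding exact_at_def by blast
  moreover have "baer R (c r) (C (Suc j)) (\<delta> j ` F r j)"
    by (rule baer_image[OF noetherian_module_C modules d_hom F.sub ideal_c _ baer_F])
      (use Suc F_kill in \<open>auto simp: cycles_def\<close>)
  ultimately show ?case by simp
qed

text \<open>The complex \<open>F r\<close> of injective \<open>R / c r\<close>-modules splits in degrees below \<open>r\<close>, so taking torsion
  preserves its exactness there.\<close>

lemma exact_G_below:
  assumes j: "j < r"
  shows "exact_at C \<delta> (G r) j"
  unfolding exact_at_def
proof
  fix z assume z: "z \<in> cycles C \<delta> (G r) (Suc j)"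
  then have zG: "z \<in> G r (Suc j)" by (rule G.cycles_sub)
  have zM: "z \<in> carrier (C (Suc j))" using zG by simp
  have "z \<in> cycles C \<delta> (F r) (Suc j)" using z G_F by (simp add: cycles_def)
  moreover have "exact_at C \<delta> (F r) j" using cohomology_F[of r] j by simp
  ultimately obtain v where v: "v \<in> F r j" "z = \<delta> j v" using F.exact_imp_boundary by blast
  have vM: "v \<in> carrier (C j)" using v by simp
  \<comment> \<open>Whatever kills \<open>z\<close> sends \<open>v\<close> into the cycles. If the
    cycle \<open>u\<close> represents this map, then \<open>v - u\<close> is a preimage of
    \<open>z\<close> killed by the whole annihilator of \<open>z\<close>, so it inherits torsion
    from \<open>z\<close>.\<close>
  define T where "T = {(a, a \<odot>\<^bsub>C j\<^esub> v) | a. a \<in> annihilator R (C (Suc j)) z}"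
  note ann = ideal_closed[OF C.ideal_annihilator[OF zM]]
  have T: "linear_graph R (C j) T"
    unfolding linear_graph_def
  proof (intro conjI allI impI)
    show "T \<subseteq> carrier R \<times> carrier (C j)" using ann(2) vM by (auto simp: T_def)
    show "(\<zero>, \<zero>\<^bsub>C j\<^esub>) \<in> T" using ann(1) vM unfolding T_def by force
    show "(a \<oplus> b, u \<oplus>\<^bsub>C j\<^esub> w) \<in> T" if "(a, u) \<in> T" "(b, w) \<in> T" for a b u w
      using that ann(2,3) vM C.smult_l_distr[of a b v] unfolding T_def by force
    show "(s \<otimes> a, s \<odot>\<^bsub>C j\<^esub> u) \<in> T" if "s \<in> carrier R" "(a, u) \<in> T" for s a u
      using that ann(2,6) vM C.smult_assoc1[of s a v] unfolding T_def by force
    show "u = \<zero>\<^bsub>C j\<^esub>" if "(\<zero>, u) \<in> T" for u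
      using that vM by (auto simp: T_def)
  qed
  have "snd ` T \<subseteq> cycles C \<delta> (F r) j"
  proof
    fix u assume "u \<in> snd ` T"
    then obtain a where a: "a \<in> annihilator R (C (Suc j)) z" "u = a \<odot>\<^bsub>C j\<^esub> v" by (auto simp: T_def)
    then have "a \<in> carrier R" "a \<odot>\<^bsub>C (Suc j)\<^esub> \<delta> j v = \<zero>\<^bsub>C (Suc j)\<^esub>"
      using v(2) by (simp_all add: annihilator_def)
    then show "u \<in> cycles C \<delta> (F r) j" using v(1) by (simp add: cycles_def a(2) F.sub_closed d_smult)
  qed
  moreover have "(a, \<zero>\<^bsub>C j\<^esub>) \<in> T" if a: "a \<in> c r" for a
  proof -
    have "a \<in> annihilator R (C (Suc j)) z"
      using F_kill[OF G_F[OF zG] a] a by (simp add: annihilator_def)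
    moreover have "\<zero>\<^bsub>C j\<^esub> = a \<odot>\<^bsub>C j\<^esub> v" using F_kill[OF v(1) a] by simp
    ultimately show ?thesis unfolding T_def by blast
  qed
  ultimately obtain u where u: "u \<in> cycles C \<delta> (F r) j" "\<And>a w. (a, w) \<in> T \<Longrightarrow> w = a \<odot>\<^bsub>C j\<^esub> u"
    using baerD[OF baer_cycles_F[OF less_imp_le[OF j]] T] by blast
  have uF: "u \<in> F r j" using u(1) by (rule F.cycles_sub)
  define w where "w = v \<ominus>\<^bsub>C j\<^esub> u"
  have wF: "w \<in> F r j" using uF v by (simp add: w_def F.sub_closed)
  have "\<exists>n::nat. (y [^] n) \<odot>\<^bsub>C j\<^esub> w = \<zero>\<^bsub>C j\<^esub>" if y: "y \<in> I" for y
  proof -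
    have yR: "y \<in> carrier R" using y I_carrier by blast
    obtain n :: nat where "(y [^] n) \<odot>\<^bsub>C (Suc j)\<^esub> z = \<zero>\<^bsub>C (Suc j)\<^esub>" using G_torsion[OF zG y] by blast
    then have "(y [^] n, (y [^] n) \<odot>\<^bsub>C j\<^esub> v) \<in> T" using yR by (auto simp: T_def annihilator_def)
    then have "(y [^] n) \<odot>\<^bsub>C j\<^esub> v = (y [^] n) \<odot>\<^bsub>C j\<^esub> u" by (rule u(2))
    then have "(y [^] n) \<odot>\<^bsub>C j\<^esub> w = \<zero>\<^bsub>C j\<^esub>"
      using yR vM uF by (simp add: w_def C.smult_r_diff C.diff_eq_iff)
    then show ?thesis ..
  qed
  then have "w \<in> G r j" using wF F.sub_carrier unfolding G_def power_torsion_def by blast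
  moreover have "z = \<delta> j w"
    using v(2) vM uF F.cycles_d[OF u(1)] by (simp add: w_def d_diff C.eq_diff_iff)
  ultimately show "z \<in> \<delta> j ` G r j" by blast
qed

lemma exact_G_low: "j < r \<Longrightarrow> k \<le> r \<Longrightarrow> exact_at C \<delta> (G k) j"
  by (rule exact_G_descend[OF exact_G_below])

text \<open>The cohomology of each \<open>G k\<close> vanishes in degrees up to \<open>r\<close>, so
  no connecting map reaches degree \<open>Suc r\<close>: there the inclusion of \<open>G k\<close>
  into \<open>G 0\<close> is injective on cohomology.\<close>

lemma boundary_G_0_imp_boundary_G:
  assumes "k \<le> r" "z \<in> cycles C \<delta> (G k) (Suc r)" "z \<in> \<delta> r ` G 0 r"
  shows "z \<in> \<delta> r ` G k r"
  using assms
proof (induction k)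
  case (Suc k)
  then have k: "k < r" by simp
  interpret D: divisible_subcomplex R C \<delta> "G k" "xs ! k" by (rule divisible_subcomplex_G[OF k])
  have DK: "D.K = G (Suc k)" by (rule kernel_G[OF k])
  have zK: "z \<in> D.K (Suc r)" using Suc.prems(2) unfolding DK by (rule G.cycles_sub)
  then have "z \<in> G k (Suc r)" by (simp add: D.K_def)
  then have "z \<in> cycles C \<delta> (G k) (Suc r)" using Suc.prems(2) by (simp add: cycles_def)
  then have z: "z \<in> \<delta> r ` G k r" using Suc by simp
  have "cycles C \<delta> (G k) r \<subseteq> boundaries C \<delta> (G k) r"
    by (rule cycles_subset_boundaries[OF _ subcomplex_G]) (use exact_G_low k in simp)
  then show ?case using D.boundary_in_kernel[OF zK z D.surj_if_boundaries] unfolding DK by blast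
qed simp

lemma G_subset_G_0: "m \<in> G k j \<Longrightarrow> m \<in> G 0 j"
  using F.sub_carrier F_0 by (auto simp: G_def)

text \<open>With the preceding injectivity, this identifies the cohomology of \<open>G k\<close> in
  degree \<open>Suc r\<close> with the classes of \<open>G 0\<close> killed by the first
  \<open>k\<close> entries. At each step \<open>x \<odot> z' = \<delta> b\<close> is divided by
  \<open>x\<close>, and subtracting the boundary so found moves \<open>z'\<close> into the kernel of
  \<open>x\<close>.\<close>

lemma colon_class_lift:
  assumes "k \<le> r" "z \<in> cycles C \<delta> (G 0) (Suc r)"
    "\<And>i. i < k \<Longrightarrow> (xs ! i) \<odot>\<^bsub>C (Suc r)\<^esub> z \<in> \<delta> r ` G 0 r"
  shows "\<exists>z'\<in>cycles C \<delta> (G k) (Suc r). z \<ominus>\<^bsub>C (Suc r)\<^esub> z' \<in> \<delta> r ` G 0 r"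
  using assms
proof (induction k)
  case 0
  have "z \<in> carrier (C (Suc r))" using G.cycles_sub[OF 0(2)] by simp
  then have "z \<ominus>\<^bsub>C (Suc r)\<^esub> z = \<delta> r \<zero>\<^bsub>C r\<^esub>" by (simp add: C.diff_eq_iff)
  then show ?case using 0(2) G.sub_zero by blast
next
  case (Suc k)
  then have k: "k < r" by simp
  let ?x = "xs ! k"
  interpret D: divisible_subcomplex R C \<delta> "G k" ?x by (rule divisible_subcomplex_G[OF k])
  have DK: "D.K = G (Suc k)" by (rule kernel_G[OF k])
  obtain z' w where z': "z' \<in> cycles C \<delta> (G k) (Suc r)"
    and w: "w \<in> G 0 r" "z \<ominus>\<^bsub>C (Suc r)\<^esub> z' = \<delta> r w"
    using Suc by (auto simp: less_Suc_eq)
  obtain w' where w': "w' \<in> G 0 r" "?x \<odot>\<^bsub>C (Suc r)\<^esub> z = \<delta> r w'" using Suc(4)[of k] by auto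
  have zM: "z \<in> carrier (C (Suc r))" "z' \<in> carrier (C (Suc r))"
    using G.cycles_sub[OF Suc(3)] G.cycles_sub[OF z'] by auto
  have "?x \<odot>\<^bsub>C (Suc r)\<^esub> z \<ominus>\<^bsub>C (Suc r)\<^esub> ?x \<odot>\<^bsub>C (Suc r)\<^esub> z' = \<delta> r (?x \<odot>\<^bsub>C r\<^esub> w)"
    using w zM by (simp add: d_smult flip: C.smult_r_diff)
  then have "?x \<odot>\<^bsub>C (Suc r)\<^esub> z' = \<delta> r (w' \<ominus>\<^bsub>C r\<^esub> ?x \<odot>\<^bsub>C r\<^esub> w)"
    using w w' zM by (simp add: d_diff C.diff_eq_iff C.eq_diff_iff C.M.a_comm)
  moreover have "w' \<ominus>\<^bsub>C r\<^esub> ?x \<odot>\<^bsub>C r\<^esub> w \<in> G 0 r" using w w' by (simp add: G.sub_closed)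
  ultimately have "?x \<odot>\<^bsub>C (Suc r)\<^esub> z' \<in> \<delta> r ` G 0 r" by (rule image_eqI)
  \<comment> \<open>The bounding element must lie in \<open>G k\<close> and not merely in
    \<open>G 0\<close>, because \<open>x\<close> is divisible only on \<open>G k\<close>.\<close>
  then have "?x \<odot>\<^bsub>C (Suc r)\<^esub> z' \<in> \<delta> r ` G k r"
    using boundary_G_0_imp_boundary_G[OF less_imp_le[OF k] G.cycles_closed(3)[OF z' D.x]] by blast
  then obtain b where b: "b \<in> G k r" "?x \<odot>\<^bsub>C (Suc r)\<^esub> z' = \<delta> r b" by (elim imageE)
  obtain b' where b': "b' \<in> G k r" "?x \<odot>\<^bsub>C r\<^esub> b' = b" using D.divisible[OF b(1)] by blast
  define z'' where "z'' = z' \<ominus>\<^bsub>C (Suc r)\<^esub> \<delta> r b'"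
  have "?x \<odot>\<^bsub>C (Suc r)\<^esub> \<delta> r b' = \<delta> r b" using b' by (simp flip: d_smult)
  then have "z'' \<in> D.K (Suc r)"
    using b b' G.cycles_sub[OF z'] zM
    by (simp add: z''_def D.K_def G.sub_closed C.smult_r_diff C.diff_eq_iff)
  moreover have "\<delta> (Suc r) z'' = \<zero>\<^bsub>C (Suc (Suc r))\<^esub>"
    using b' zM G.cycles_d[OF z'] by (simp add: z''_def d_simps C.diff_eq_iff)
  ultimately have "z'' \<in> cycles C \<delta> (G (Suc k)) (Suc r)" by (simp add: cycles_def DK)
  moreover have "z \<ominus>\<^bsub>C (Suc r)\<^esub> z'' = \<delta> r (w \<oplus>\<^bsub>C r\<^esub> b')"
  proof -
    have "z = \<delta> r w \<oplus>\<^bsub>C (Suc r)\<^esub> z'" using w zM by (simp add: C.diff_eq_iff)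
    then show ?thesis using w b' zM(2) by (simp add: z''_def d_add C.module_simps)
  qed
  moreover have "w \<oplus>\<^bsub>C r\<^esub> b' \<in> G 0 r"
    by (rule G.sub_add[OF w(1) G_subset_G_0[OF b'(1)]])
  ultimately show ?case by blast
qed

text \<open>The image conditions of a coregular sequence for the cohomology of \<open>G 0\<close> in
  degree \<open>Suc r\<close>, expressed by representing cycles. Non-vanishing and support are kept
  apart.\<close>

definition "coregular \<longleftrightarrow> (\<forall>k<r. \<forall>z\<in>cycles C \<delta> (G 0) (Suc r).
    (\<forall>i<k. (xs ! i) \<odot>\<^bsub>C (Suc r)\<^esub> z \<in> \<delta> r ` G 0 r) \<longrightarrow>
    (\<exists>z'\<in>cycles C \<delta> (G 0) (Suc r). (\<forall>i<k. (xs ! i) \<odot>\<^bsub>C (Suc r)\<^esub> z' \<in> \<delta> r ` G 0 r) \<and>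
       z \<ominus>\<^bsub>C (Suc r)\<^esub> (xs ! k) \<odot>\<^bsub>C (Suc r)\<^esub> z' \<in> \<delta> r ` G 0 r))"

lemma cycles_G_0: "z \<in> cycles C \<delta> (G k) j \<Longrightarrow> z \<in> cycles C \<delta> (G 0) j"
  using G_subset_G_0 by (auto simp: cycles_def)

lemma kill_cycles_G:
  assumes "k \<le> r" "i < k" "z \<in> cycles C \<delta> (G k) (Suc r)"
  shows "(xs ! i) \<odot>\<^bsub>C (Suc r)\<^esub> z \<in> \<delta> r ` G 0 r"
proof -
  have "(xs ! i) \<odot>\<^bsub>C (Suc r)\<^esub> z = \<delta> r \<zero>\<^bsub>C r\<^esub>"
    using G_F[OF G.cycles_sub[OF assms(3)]] assms by (simp add: F_iff)
  then show ?thesis using G.sub_zero by (rule image_eqI)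
qed

lemma radical_imp_coregular:
  assumes rad: "\<And>y. y \<in> I \<Longrightarrow> \<exists>n::nat. y [^] n \<in> c r"
  shows "coregular" "\<exists>z\<in>cycles C \<delta> (G 0) (Suc r). z \<notin> \<delta> r ` G 0 r"
    "j > r \<Longrightarrow> exact_at C \<delta> (G 0) j"
proof -
  have "m \<in> power_torsion R I (C j)" if "m \<in> F r j" for m j
    using that rad F_kill F.sub_carrier unfolding power_torsion_def by blast
  then have GF: "G r = F r" unfolding G_def by blast
  note coh = cohomology_F[OF order_refl, folded GF]
  have ex: "exact_at C \<delta> (G k) j" if "k \<le> r" "j \<noteq> r" for k j
    using exact_G_descend[OF _ that(1)] coh that(2) by blast
  then show "j > r \<Longrightarrow> exact_at C \<delta> (G 0) j" by simp
  show "coregular"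
    unfolding coregular_def
  proof (intro allI ballI impI)
    fix k z assume k: "k < r" and z: "z \<in> cycles C \<delta> (G 0) (Suc r)"
      "\<forall>i<k. (xs ! i) \<odot>\<^bsub>C (Suc r)\<^esub> z \<in> \<delta> r ` G 0 r"
    interpret D: divisible_subcomplex R C \<delta> "G k" "xs ! k" by (rule divisible_subcomplex_G[OF k])
    obtain z' where z': "z' \<in> cycles C \<delta> (G k) (Suc r)" "z \<ominus>\<^bsub>C (Suc r)\<^esub> z' \<in> \<delta> r ` G 0 r"
      using colon_class_lift[OF less_imp_le[OF k] z(1)] z(2) by blast
    \<comment> \<open>Exactness of the kernel one degree higher makes \<open>xs ! k\<close>
      surjective on the cohomology of \<open>G k\<close> in degree \<open>Suc r\<close>. It is
      available because cohomology survives only at index \<open>r\<close>.\<close>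
    have "exact_at C \<delta> D.K (Suc r)" unfolding kernel_G[OF k] using k by (intro ex) auto
    then obtain z'' where z'': "z'' \<in> cycles C \<delta> (G k) (Suc r)" "(xs ! k) \<odot>\<^bsub>C (Suc r)\<^esub> z'' = z'"
      using D.mult_surjective_on_cycles[OF _ z'(1)] by blast
    then show "\<exists>z'\<in>cycles C \<delta> (G 0) (Suc r). (\<forall>i<k. (xs ! i) \<odot>\<^bsub>C (Suc r)\<^esub> z' \<in> \<delta> r ` G 0 r) \<and>
       z \<ominus>\<^bsub>C (Suc r)\<^esub> (xs ! k) \<odot>\<^bsub>C (Suc r)\<^esub> z' \<in> \<delta> r ` G 0 r"
      using z'(2) kill_cycles_G[OF less_imp_le[OF k] _ z''(1)]
      by (intro bexI[OF _ cycles_G_0[OF z''(1)]]) simp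
  qed
  obtain e where e: "e \<in> cycles C \<delta> (G r) (Suc r)"
    and free: "\<forall>a\<in>carrier R. a \<odot>\<^bsub>C (Suc r)\<^esub> e \<in> \<delta> r ` G r r \<longrightarrow> a \<in> c r"
    using coh by (elim conjE bexE)
  \<comment> \<open>The cohomology of \<open>G r\<close> is \<open>R / c r\<close>, which is
    non-zero as \<open>\<one>\<close> is not in \<open>c r\<close>, and it injects into that of
    \<open>G 0\<close>.\<close>
  have "e \<notin> \<delta> r ` G r r"
    using bspec[OF free one_closed] one_notin_c G.cycles_sub[OF e] by simp
  then have "e \<notin> \<delta> r ` G 0 r"
    using boundary_G_0_imp_boundary_G[OF order_refl e] by blast
  then show "\<exists>z\<in>cycles C \<delta> (G 0) (Suc r). z \<notin> \<delta> r ` G 0 r"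
    using cycles_G_0[OF e] by (rule bexI)
qed

text \<open>Passing from \<open>G k\<close> to the kernel of \<open>xs ! k\<close> needs
  surjectivity of \<open>xs ! k\<close> in degree \<open>j\<close>. Above \<open>Suc r\<close> the
  cohomology is zero by induction; in degree \<open>Suc r\<close> it is the submodule killed by the
  first \<open>k\<close> entries, where coregularity gives surjectivity.\<close>

lemma coregular_imp_exact:
  assumes cor: "coregular" and ex0: "\<And>j. j > r \<Longrightarrow> exact_at C \<delta> (G 0) j"
  shows "k \<le> r \<Longrightarrow> j > r \<Longrightarrow> exact_at C \<delta> (G k) j"
proof (induction k arbitrary: j)
  case 0
  then show ?case by (simp add: ex0)
next
  case (Suc k)
  then have k: "k < r" by simp
  let ?x = "xs ! k"
  interpret D: divisible_subcomplex R C \<delta> "G k" ?x by (rule divisible_subcomplex_G[OF k])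
  obtain i where i: "j = Suc i" "r \<le> i" using Suc(3) by (cases j) auto
  have "exact_at C \<delta> D.K j"
  proof (rule D.kernel_exact_if_exact)
    show "exact_at C \<delta> (G k) j" using Suc k by simp
    fix z assume z: "z \<in> cycles C \<delta> (G k) j"
    show "\<exists>z'\<in>cycles C \<delta> (G k) j. z \<ominus>\<^bsub>C j\<^esub> ?x \<odot>\<^bsub>C j\<^esub> z' \<in> boundaries C \<delta> (G k) j"
    proof (cases "i = r")
      case False
      then have "exact_at C \<delta> (G k) i" using Suc.IH[of i] k i by simp
      then have "cycles C \<delta> (G k) j \<subseteq> boundaries C \<delta> (G k) j"
        by (simp add: i exact_at_def boundaries_def)
      then show ?thesis using D.surj_if_boundaries z by blast
    next
      case True
      then have j: "j = Suc r" using i by simp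
      have "\<forall>i<k. (xs ! i) \<odot>\<^bsub>C (Suc r)\<^esub> z \<in> \<delta> r ` G 0 r"
        using kill_cycles_G[OF less_imp_le[OF k]] z unfolding j by blast
      then obtain z1 where z1: "z1 \<in> cycles C \<delta> (G 0) (Suc r)"
        "\<forall>i<k. (xs ! i) \<odot>\<^bsub>C (Suc r)\<^esub> z1 \<in> \<delta> r ` G 0 r"
        "z \<ominus>\<^bsub>C (Suc r)\<^esub> ?x \<odot>\<^bsub>C (Suc r)\<^esub> z1 \<in> \<delta> r ` G 0 r"
        using cor cycles_G_0[OF z] k unfolding coregular_def j by blast
      then obtain z2 where z2: "z2 \<in> cycles C \<delta> (G k) (Suc r)" "z1 \<ominus>\<^bsub>C (Suc r)\<^esub> z2 \<in> \<delta> r ` G 0 r"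
        using colon_class_lift[OF less_imp_le[OF k] z1(1)] by blast
      obtain p where p: "p \<in> G 0 r" "z \<ominus>\<^bsub>C (Suc r)\<^esub> ?x \<odot>\<^bsub>C (Suc r)\<^esub> z1 = \<delta> r p" using z1(3) by (elim imageE)
      obtain q where q: "q \<in> G 0 r" "z1 \<ominus>\<^bsub>C (Suc r)\<^esub> z2 = \<delta> r q" using z2(2) by (elim imageE)
      have M: "z \<in> carrier (C (Suc r))" "z1 \<in> carrier (C (Suc r))" "z2 \<in> carrier (C (Suc r))"
        using G.cycles_sub[OF z] G.cycles_sub[OF z1(1)] G.cycles_sub[OF z2(1)] j by auto
      have "z = \<delta> r p \<oplus>\<^bsub>C (Suc r)\<^esub> ?x \<odot>\<^bsub>C (Suc r)\<^esub> z1" "z1 = \<delta> r q \<oplus>\<^bsub>C (Suc r)\<^esub> z2"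
        using p q M by (simp_all add: C.diff_eq_iff)
      then have z_eq: "z = \<delta> r p \<oplus>\<^bsub>C (Suc r)\<^esub> ?x \<odot>\<^bsub>C (Suc r)\<^esub> (\<delta> r q \<oplus>\<^bsub>C (Suc r)\<^esub> z2)" by simp
      have "z \<ominus>\<^bsub>C (Suc r)\<^esub> ?x \<odot>\<^bsub>C (Suc r)\<^esub> z2 = \<delta> r (p \<oplus>\<^bsub>C r\<^esub> ?x \<odot>\<^bsub>C r\<^esub> q)"
        unfolding z_eq using p q M by (simp add: d_simps C.module_simps)
      moreover have "p \<oplus>\<^bsub>C r\<^esub> ?x \<odot>\<^bsub>C r\<^esub> q \<in> G 0 r" using p q by (simp add: G.sub_closed)
      ultimately have "z \<ominus>\<^bsub>C (Suc r)\<^esub> ?x \<odot>\<^bsub>C (Suc r)\<^esub> z2 \<in> \<delta> r ` G 0 r" by (rule image_eqI)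
      moreover have "z \<ominus>\<^bsub>C (Suc r)\<^esub> ?x \<odot>\<^bsub>C (Suc r)\<^esub> z2 \<in> cycles C \<delta> (G k) (Suc r)"
        using z[unfolded j] z2(1) G.cycles_closed D.x by blast
      ultimately have "z \<ominus>\<^bsub>C (Suc r)\<^esub> ?x \<odot>\<^bsub>C (Suc r)\<^esub> z2 \<in> \<delta> r ` G k r"
        using boundary_G_0_imp_boundary_G k by simp
      then show ?thesis using z2(1) by (auto simp: j boundaries_def)
    qed
  qed
  then show ?case by (simp add: kernel_G[OF k])
qed

end

section \<open>Mapping cones\<close>

text \<open>A pairing on one type \<open>'c\<close> allows iterated mapping cones to be formed in an induction.\<close>

locale pairing =
  fixes pr :: "'c \<Rightarrow> 'c \<Rightarrow> 'c" and p1 p2 :: "'c \<Rightarrow> 'c"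
  assumes p1 [simp]: "p1 (pr a b) = a" and p2 [simp]: "p2 (pr a b) = b"
begin

lemma pr_eq [simp]: "pr a b = pr a' b' \<longleftrightarrow> a = a' \<and> b = b'"
  using p1 p2 by metis

definition direct_sum :: "('a, 'c) module \<Rightarrow> ('a, 'c) module \<Rightarrow> ('a, 'c) module" where
  "direct_sum M N =
     \<lparr>carrier = {pr a b | a b. a \<in> carrier M \<and> b \<in> carrier N}, monoid.mult = undefined,
      one = undefined, zero = pr \<zero>\<^bsub>M\<^esub> \<zero>\<^bsub>N\<^esub>,
      add = (\<lambda>u v. pr (p1 u \<oplus>\<^bsub>M\<^esub> p1 v) (p2 u \<oplus>\<^bsub>N\<^esub> p2 v)),
      smult = (\<lambda>a u. pr (a \<odot>\<^bsub>M\<^esub> p1 u) (a \<odot>\<^bsub>N\<^esub> p2 u))\<rparr>"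

lemma direct_sum_carrier [simp]: "pr a b \<in> carrier (direct_sum M N) \<longleftrightarrow> a \<in> carrier M \<and> b \<in> carrier N"
  by (auto simp: direct_sum_def)

lemma direct_sum_cases:
  assumes "u \<in> carrier (direct_sum M N)"
  obtains a b where "u = pr a b" "a \<in> carrier M" "b \<in> carrier N"
  using assms by (auto simp: direct_sum_def)

lemma direct_sum_simps [simp]:
  "\<zero>\<^bsub>direct_sum M N\<^esub> = pr \<zero>\<^bsub>M\<^esub> \<zero>\<^bsub>N\<^esub>"
  "pr a b \<oplus>\<^bsub>direct_sum M N\<^esub> pr a' b' = pr (a \<oplus>\<^bsub>M\<^esub> a') (b \<oplus>\<^bsub>N\<^esub> b')"
  "c \<odot>\<^bsub>direct_sum M N\<^esub> pr a b = pr (c \<odot>\<^bsub>M\<^esub> a) (c \<odot>\<^bsub>N\<^esub> b)"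
  by (simp_all add: direct_sum_def)

lemma module_direct_sum:
  assumes "module R M" "module R N"
  shows "module R (direct_sum M N)"
proof -
  interpret M: module R M by fact
  interpret N: module R N by fact
  have "abelian_group (direct_sum M N)"
  proof (rule abelian_groupI)
    fix u assume "u \<in> carrier (direct_sum M N)"
    then obtain a b where u: "u = pr a b" "a \<in> carrier M" "b \<in> carrier N" by (rule direct_sum_cases)
    then show "\<exists>v\<in>carrier (direct_sum M N). v \<oplus>\<^bsub>direct_sum M N\<^esub> u = \<zero>\<^bsub>direct_sum M N\<^esub>"
      by (intro bexI[of _ "pr (\<ominus>\<^bsub>M\<^esub> a) (\<ominus>\<^bsub>N\<^esub> b)"]) (simp_all add: M.M.l_neg N.M.l_neg)
  qed (auto elim!: direct_sum_cases simp: M.M.a_ac N.M.a_ac)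
  then show ?thesis
    by (intro moduleI M.R.is_cring)
      (auto elim!: direct_sum_cases simp: M.smult_l_distr N.smult_l_distr M.smult_r_distr
        N.smult_r_distr M.smult_assoc1 N.smult_assoc1)
qed

lemma direct_sum_diff:
  assumes "module R M" "module R N" "a \<in> carrier M" "b \<in> carrier N" "a' \<in> carrier M" "b' \<in> carrier N"
  shows "pr a b \<ominus>\<^bsub>direct_sum M N\<^esub> pr a' b' = pr (a \<ominus>\<^bsub>M\<^esub> a') (b \<ominus>\<^bsub>N\<^esub> b')"
proof -
  interpret M: module R M by fact
  interpret N: module R N by fact
  interpret S: module R "direct_sum M N" by (rule module_direct_sum) fact+
  have "(a \<ominus>\<^bsub>M\<^esub> a') \<oplus>\<^bsub>M\<^esub> a' = a" "(b \<ominus>\<^bsub>N\<^esub> b') \<oplus>\<^bsub>N\<^esub> b' = b"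
    using assms by (simp_all add: M.module_simps N.module_simps)
  then show ?thesis using assms by (subst S.diff_eq_iff) simp_all
qed

lemma power_torsion_direct_sum:
  assumes "module R M" "module R N" "Y \<subseteq> carrier R"
  shows "pr a b \<in> power_torsion R Y (direct_sum M N) \<longleftrightarrow>
    a \<in> power_torsion R Y M \<and> b \<in> power_torsion R Y N"
proof
  interpret M: module R M by fact
  interpret N: module R N by fact
  show "pr a b \<in> power_torsion R Y (direct_sum M N)"
    if ab: "a \<in> power_torsion R Y M \<and> b \<in> power_torsion R Y N"
  proof -
    have c: "a \<in> carrier M" "b \<in> carrier N" using ab by (simp_all add: power_torsion_def)
    have "\<exists>n::nat. (y [^]\<^bsub>R\<^esub> n) \<odot>\<^bsub>direct_sum M N\<^esub> pr a b = \<zero>\<^bsub>direct_sum M N\<^esub>" if y: "y \<in> Y" for y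
    proof -
      have yR: "y \<in> carrier R" using y assms(3) by blast
      obtain k :: nat where k: "(y [^]\<^bsub>R\<^esub> k) \<odot>\<^bsub>M\<^esub> a = \<zero>\<^bsub>M\<^esub>"
        using ab y unfolding power_torsion_def by blast
      obtain l :: nat where l: "(y [^]\<^bsub>R\<^esub> l) \<odot>\<^bsub>N\<^esub> b = \<zero>\<^bsub>N\<^esub>"
        using ab y unfolding power_torsion_def by blast
      show ?thesis
        using M.smult_pow_zero_mono[OF yR c(1) k, of "k + l"] N.smult_pow_zero_mono[OF yR c(2) l, of "k + l"]
        by (intro exI[of _ "k + l"]) simp
    qed
    then show ?thesis using c unfolding power_torsion_def by simp
  qed
qed (auto simp: power_torsion_def)

text \<open>Together with \<open>cone_d\<close>, the mapping cone of multiplication by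
  \<open>y\<close>, with its term in degree -1 dropped. The truncation is harmless since only
  cohomology in positive degrees is used.\<close>

definition cone :: "(nat \<Rightarrow> ('a, 'c) module) \<Rightarrow> nat \<Rightarrow> ('a, 'c) module" where
  "cone C j = direct_sum (C (Suc j)) (C j)"

definition cone_d :: "'a \<Rightarrow> (nat \<Rightarrow> ('a, 'c) module) \<Rightarrow> (nat \<Rightarrow> 'c \<Rightarrow> 'c) \<Rightarrow> nat \<Rightarrow> 'c \<Rightarrow> 'c" where
  "cone_d y C \<delta> j u =
     pr (\<delta> (Suc j) (p1 u)) (y \<odot>\<^bsub>C (Suc j)\<^esub> p1 u \<ominus>\<^bsub>C (Suc j)\<^esub> \<delta> j (p2 u))"

lemma cone_d_pr [simp]:
  "cone_d y C \<delta> j (pr a b) = pr (\<delta> (Suc j) a) (y \<odot>\<^bsub>C (Suc j)\<^esub> a \<ominus>\<^bsub>C (Suc j)\<^esub> \<delta> j b)"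
  by (simp add: cone_d_def)

lemma module_complex_cone:
  assumes "module_complex R C \<delta>" and y: "y \<in> carrier R"
  shows "module_complex R (cone C) (cone_d y C \<delta>)"
proof -
  interpret module_complex R C \<delta> by fact
  have mods: "module R (cone C j)" for j
    unfolding cone_def by (intro module_direct_sum modules)
  show ?thesis
  proof (intro module_complex.intro module_complex_axioms.intro noetherian_cring_axioms mods)
    fix j
    show "cone_d y C \<delta> j \<in> mod_hom R (cone C j) (cone C (Suc j))"
      using y by (auto simp: mod_hom_def cone_def elim!: direct_sum_cases)
        (simp_all add: d_simps C.module_simps)
    fix u assume "u \<in> carrier (cone C j)"
    then obtain a b where "u = pr a b" "a \<in> carrier (C (Suc j))" "b \<in> carrier (C j)"
      unfolding cone_def by (rule direct_sum_cases)
    then show "cone_d y C \<delta> (Suc j) (cone_d y C \<delta> j u) = \<zero>\<^bsub>cone C (Suc (Suc j))\<^esub>"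
      using y by (simp add: cone_def d_simps C.diff_eq_iff C.eq_diff_iff)
  qed
qed

text \<open>The family \<open>T\<close> is described only through its pairs so that it can be either
  the whole cone or its torsion, both of which are cones of families in \<open>C\<close>.\<close>

lemma exact_at_cone:
  assumes "module_complex R C \<delta>" and y: "y \<in> carrier R"
    and S: "\<And>j. S j \<subseteq> carrier (C j)"
    and T: "\<And>j a b. pr a b \<in> T j \<longleftrightarrow> a \<in> S (Suc j) \<and> b \<in> S j"
      "\<And>j. T j \<subseteq> carrier (cone C j)"
    and ex: "\<And>a b. a \<in> cycles C \<delta> S (Suc (Suc j)) \<Longrightarrow> b \<in> S (Suc j) \<Longrightarrow>
      y \<odot>\<^bsub>C (Suc (Suc j))\<^esub> a = \<delta> (Suc j) b \<Longrightarrow>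
      \<exists>a'\<in>S (Suc j). \<exists>b'\<in>S j. a = \<delta> (Suc j) a' \<and> b = y \<odot>\<^bsub>C (Suc j)\<^esub> a' \<ominus>\<^bsub>C (Suc j)\<^esub> \<delta> j b'"
  shows "exact_at (cone C) (cone_d y C \<delta>) T j"
  unfolding exact_at_def
proof
  interpret module_complex R C \<delta> by fact
  fix u assume u: "u \<in> cycles (cone C) (cone_d y C \<delta>) T (Suc j)"
  then have "u \<in> carrier (cone C (Suc j))" using T(2) by (auto simp: cycles_def)
  then obtain a b where ab: "u = pr a b" "a \<in> carrier (C (Suc (Suc j)))" "b \<in> carrier (C (Suc j))"
    unfolding cone_def by (rule direct_sum_cases)
  have "a \<in> S (Suc (Suc j))" "b \<in> S (Suc j)" using u T(1) by (auto simp: cycles_def ab)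
  moreover have "\<delta> (Suc (Suc j)) a = \<zero>\<^bsub>C (Suc (Suc (Suc j)))\<^esub>"
    "y \<odot>\<^bsub>C (Suc (Suc j))\<^esub> a = \<delta> (Suc j) b"
    using u ab(2,3) y by (auto simp: cycles_def ab(1) cone_def C.diff_eq_iff)
  ultimately obtain a' b' where "a' \<in> S (Suc j)" "b' \<in> S j" "a = \<delta> (Suc j) a'"
    "b = y \<odot>\<^bsub>C (Suc j)\<^esub> a' \<ominus>\<^bsub>C (Suc j)\<^esub> \<delta> j b'"
    using ex[of a b] by (auto simp: cycles_def)
  then have "u = cone_d y C \<delta> j (pr a' b')" "pr a' b' \<in> T j" by (simp_all add: ab(1) T(1))
  then show "u \<in> cone_d y C \<delta> j ` T j" by (rule image_eqI)
qed

end

text \<open>\<open>y\<close> is bijective on \<open>S / tors\<close>, whereas \<open>tors\<close> is exact.\<close>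

locale torsion_exact = subcomplex R C \<delta> S
  for R (structure) and C :: "nat \<Rightarrow> ('a, 'm) module" and \<delta> S +
  fixes y :: 'a and tors :: "nat \<Rightarrow> 'm set"
  assumes y [simp]: "y \<in> carrier R"
    and tors: "tors j = {m \<in> S j. \<exists>n::nat. (y [^] n) \<odot>\<^bsub>C j\<^esub> m = \<zero>\<^bsub>C j\<^esub>}"
    and div: "z \<in> S j \<Longrightarrow> \<exists>w\<in>S j. \<exists>n::nat. (y [^] n) \<odot>\<^bsub>C j\<^esub> (z \<ominus>\<^bsub>C j\<^esub> y \<odot>\<^bsub>C j\<^esub> w) = \<zero>\<^bsub>C j\<^esub>"
    and tors_exact: "j \<noteq> 0 \<Longrightarrow> exact_at C \<delta> tors j"
begin

lemma torsI: "m \<in> S j \<Longrightarrow> (y [^] (n::nat)) \<odot>\<^bsub>C j\<^esub> m = \<zero>\<^bsub>C j\<^esub> \<Longrightarrow> m \<in> tors j"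
  using tors by blast

lemma tors_S: "m \<in> tors j \<Longrightarrow> m \<in> S j"
  using tors by blast

lemma tors_smult_iff:
  assumes "m \<in> S j"
  shows "y \<odot>\<^bsub>C j\<^esub> m \<in> tors j \<longleftrightarrow> m \<in> tors j"
proof
  assume "y \<odot>\<^bsub>C j\<^esub> m \<in> tors j"
  then obtain n :: nat where "(y [^] n) \<odot>\<^bsub>C j\<^esub> (y \<odot>\<^bsub>C j\<^esub> m) = \<zero>\<^bsub>C j\<^esub>" using tors by blast
  then have "(y [^] Suc n) \<odot>\<^bsub>C j\<^esub> m = \<zero>\<^bsub>C j\<^esub>" using assms by (simp add: C.smult_assoc1)
  then show "m \<in> tors j" using assms by (rule torsI[rotated])
next
  assume "m \<in> tors j"
  then obtain n :: nat where "(y [^] n) \<odot>\<^bsub>C j\<^esub> m = \<zero>\<^bsub>C j\<^esub>" using tors by blast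
  then have "(y [^] n) \<odot>\<^bsub>C j\<^esub> (y \<odot>\<^bsub>C j\<^esub> m) = \<zero>\<^bsub>C j\<^esub>"
    using assms C.smult_lcomm[of "y [^] n" y m] by simp
  then show "y \<odot>\<^bsub>C j\<^esub> m \<in> tors j" by (intro torsI) (simp_all add: assms sub_smult)
qed

lemma tors_d:
  assumes "m \<in> tors j"
  shows "\<delta> j m \<in> tors (Suc j)"
proof -
  have m: "m \<in> S j" using tors_S assms by blast
  obtain n :: nat where n: "(y [^] n) \<odot>\<^bsub>C j\<^esub> m = \<zero>\<^bsub>C j\<^esub>" using assms tors by blast
  have "(y [^] n) \<odot>\<^bsub>C (Suc j)\<^esub> \<delta> j m = \<delta> j ((y [^] n) \<odot>\<^bsub>C j\<^esub> m)" using m by (simp add: d_smult)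
  then have "(y [^] n) \<odot>\<^bsub>C (Suc j)\<^esub> \<delta> j m = \<zero>\<^bsub>C (Suc j)\<^esub>" using n by simp
  then show ?thesis using m by (intro torsI) (simp_all add: sub_d)
qed

lemma div_tors:
  assumes "z \<in> S j"
  obtains w where "w \<in> S j" "z \<ominus>\<^bsub>C j\<^esub> y \<odot>\<^bsub>C j\<^esub> w \<in> tors j"
  using div[OF assms] assms torsI sub_closed y by meson

text \<open>From degree 2 on, \<open>tors\<close> has no cohomology, so there \<open>S\<close> has
  the cohomology of \<open>S / tors\<close>, on which \<open>y\<close> is invertible.\<close>

lemma injective_mod_boundaries:
  assumes j: "j \<noteq> 0" and a: "a \<in> cycles C \<delta> S (Suc j)" and b: "b \<in> S j" "y \<odot>\<^bsub>C (Suc j)\<^esub> a = \<delta> j b"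
  shows "\<exists>a'\<in>S j. a = \<delta> j a'"
proof -
  have aS: "a \<in> S (Suc j)" using a by (rule cycles_sub)
  obtain w where w: "w \<in> S j" "b \<ominus>\<^bsub>C j\<^esub> y \<odot>\<^bsub>C j\<^esub> w \<in> tors j" using b(1) by (rule div_tors)
  have "y \<odot>\<^bsub>C (Suc j)\<^esub> (a \<ominus>\<^bsub>C (Suc j)\<^esub> \<delta> j w) = \<delta> j (b \<ominus>\<^bsub>C j\<^esub> y \<odot>\<^bsub>C j\<^esub> w)"
    using aS b w(1) by (simp add: d_simps C.smult_r_diff)
  moreover have "a \<ominus>\<^bsub>C (Suc j)\<^esub> \<delta> j w \<in> S (Suc j)" using aS w(1) by (simp add: sub_closed)
  ultimately have "a \<ominus>\<^bsub>C (Suc j)\<^esub> \<delta> j w \<in> tors (Suc j)"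
    using tors_d[OF w(2)] tors_smult_iff by metis
  moreover have "\<delta> (Suc j) (a \<ominus>\<^bsub>C (Suc j)\<^esub> \<delta> j w) = \<zero>\<^bsub>C (Suc (Suc j))\<^esub>"
    using aS w(1) cycles_d[OF a] by (simp add: d_simps C.diff_eq_iff)
  ultimately obtain t where t: "t \<in> tors j" "a \<ominus>\<^bsub>C (Suc j)\<^esub> \<delta> j w = \<delta> j t"
    using tors_exact[OF j] unfolding exact_at_def cycles_def by blast
  then have "a = \<delta> j (t \<oplus>\<^bsub>C j\<^esub> w)"
    using aS w(1) tors_S[OF t(1)] by (simp add: d_add C.diff_eq_iff)
  then show ?thesis using sub_add[OF tors_S[OF t(1)] w(1)] by blast
qed

text \<open>Vanishing of the cohomology of \<open>tors\<close> one degree higher lets cycles of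
  \<open>S / tors\<close> lift to \<open>S\<close>. In degree 1 \<open>tors\<close> may itself have
  cohomology, so division by \<open>y\<close> is possible only up to torsion cycles.\<close>

lemma surjective_mod_torsion:
  assumes j: "j \<noteq> 0" and z: "z \<in> cycles C \<delta> S j"
  shows "\<exists>z'\<in>cycles C \<delta> S j. z \<ominus>\<^bsub>C j\<^esub> y \<odot>\<^bsub>C j\<^esub> z' \<in> cycles C \<delta> tors j"
proof -
  have zS: "z \<in> S j" using z by (rule cycles_sub)
  obtain w where w: "w \<in> S j" "z \<ominus>\<^bsub>C j\<^esub> y \<odot>\<^bsub>C j\<^esub> w \<in> tors j" using zS by (rule div_tors)
  let ?t = "z \<ominus>\<^bsub>C j\<^esub> y \<odot>\<^bsub>C j\<^esub> w"
  have "y \<odot>\<^bsub>C (Suc j)\<^esub> \<delta> j w = \<zero>\<^bsub>C (Suc j)\<^esub> \<ominus>\<^bsub>C (Suc j)\<^esub> \<delta> j ?t"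
    using zS w(1) cycles_d[OF z] by (simp add: d_simps C.module_simps)
  moreover obtain n :: nat where "(y [^] n) \<odot>\<^bsub>C (Suc j)\<^esub> \<delta> j ?t = \<zero>\<^bsub>C (Suc j)\<^esub>"
    using tors_d[OF w(2)] tors by blast
  moreover have "\<delta> j ?t \<in> carrier (C (Suc j))" using zS w(1) by simp
  ultimately have "(y [^] n) \<odot>\<^bsub>C (Suc j)\<^esub> (y \<odot>\<^bsub>C (Suc j)\<^esub> \<delta> j w) = \<zero>\<^bsub>C (Suc j)\<^esub>"
    by (simp add: C.smult_r_diff C.diff_eq_iff)
  then have "y \<odot>\<^bsub>C (Suc j)\<^esub> \<delta> j w \<in> tors (Suc j)"
    using w(1) by (intro torsI) (simp_all add: sub_closed)
  then have "\<delta> j w \<in> tors (Suc j)" using tors_smult_iff sub_d[OF w(1)] by blast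
  then have "\<delta> j w \<in> cycles C \<delta> tors (Suc j)" using w(1) by (simp add: cycles_def dd)
  then obtain t where t: "t \<in> tors j" "\<delta> j w = \<delta> j t"
    using tors_exact[OF j] unfolding exact_at_def by blast
  have tS: "t \<in> S j" using tors_S t(1) by blast
  define z' where "z' = w \<ominus>\<^bsub>C j\<^esub> t"
  have z': "z' \<in> cycles C \<delta> S j"
    using w(1) t(2) tS by (simp add: z'_def cycles_def sub_closed d_diff C.diff_eq_iff)
  obtain n :: nat where n: "(y [^] n) \<odot>\<^bsub>C j\<^esub> ?t = \<zero>\<^bsub>C j\<^esub>" using w(2) tors by blast
  obtain l :: nat where l: "(y [^] l) \<odot>\<^bsub>C j\<^esub> t = \<zero>\<^bsub>C j\<^esub>" using t(1) tors by blast
  have yt: "(y [^] (n + l)) \<odot>\<^bsub>C j\<^esub> ?t = \<zero>\<^bsub>C j\<^esub>" "(y [^] (n + l)) \<odot>\<^bsub>C j\<^esub> t = \<zero>\<^bsub>C j\<^esub>"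
    using C.smult_pow_zero_mono[OF y _ n, of "n + l"] C.smult_pow_zero_mono[OF y _ l, of "n + l"] tS zS w(1)
    by simp_all
  have "z \<ominus>\<^bsub>C j\<^esub> y \<odot>\<^bsub>C j\<^esub> z' = ?t \<oplus>\<^bsub>C j\<^esub> y \<odot>\<^bsub>C j\<^esub> t"
    using zS w(1) tS by (simp add: z'_def C.module_simps)
  moreover have "(y [^] (n + l)) \<odot>\<^bsub>C j\<^esub> (?t \<oplus>\<^bsub>C j\<^esub> y \<odot>\<^bsub>C j\<^esub> t) = \<zero>\<^bsub>C j\<^esub>"
    using yt zS w(1) tS C.smult_lcomm[of "y [^] (n + l)" y t j] by (simp add: C.smult_r_distr)
  ultimately have "(y [^] (n + l)) \<odot>\<^bsub>C j\<^esub> (z \<ominus>\<^bsub>C j\<^esub> y \<odot>\<^bsub>C j\<^esub> z') = \<zero>\<^bsub>C j\<^esub>" by (simp only:)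
  moreover have "z \<ominus>\<^bsub>C j\<^esub> y \<odot>\<^bsub>C j\<^esub> z' \<in> S j" using zS cycles_sub[OF z'] by (simp add: sub_closed)
  ultimately have "z \<ominus>\<^bsub>C j\<^esub> y \<odot>\<^bsub>C j\<^esub> z' \<in> tors j" by (rule torsI[rotated])
  moreover have "z \<ominus>\<^bsub>C j\<^esub> y \<odot>\<^bsub>C j\<^esub> z' \<in> cycles C \<delta> S j"
    by (intro cycles_closed z z' y)
  ultimately show ?thesis using z' by (auto simp: cycles_def)
qed

text \<open>By the long exact sequence of the cone, it is enough that \<open>y\<close> is injective
  on cohomology in degree \<open>Suc (Suc j)\<close> and surjective in degree \<open>Suc j\<close>.
  The torsion cycle left over in the latter is a boundary because \<open>j\<close> is not 0.\<close>

lemma cone_exact: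
  assumes j: "j \<noteq> 0" and a: "a \<in> cycles C \<delta> S (Suc (Suc j))" and b: "b \<in> S (Suc j)"
    "y \<odot>\<^bsub>C (Suc (Suc j))\<^esub> a = \<delta> (Suc j) b"
  shows "\<exists>a'\<in>S (Suc j). \<exists>b'\<in>S j. a = \<delta> (Suc j) a' \<and> b = y \<odot>\<^bsub>C (Suc j)\<^esub> a' \<ominus>\<^bsub>C (Suc j)\<^esub> \<delta> j b'"
proof -
  obtain a' where a': "a' \<in> S (Suc j)" "a = \<delta> (Suc j) a'"
    using injective_mod_boundaries[OF _ a b] by blast
  define v where "v = y \<odot>\<^bsub>C (Suc j)\<^esub> a' \<ominus>\<^bsub>C (Suc j)\<^esub> b"
  have vc: "v \<in> cycles C \<delta> S (Suc j)"
    using a' b by (simp add: v_def cycles_def sub_closed d_simps C.diff_eq_iff)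
  obtain z' where z': "z' \<in> cycles C \<delta> S (Suc j)"
    "v \<ominus>\<^bsub>C (Suc j)\<^esub> y \<odot>\<^bsub>C (Suc j)\<^esub> z' \<in> cycles C \<delta> tors (Suc j)"
    using surjective_mod_torsion[OF _ vc] by blast
  then obtain b' where b': "b' \<in> tors j" "v \<ominus>\<^bsub>C (Suc j)\<^esub> y \<odot>\<^bsub>C (Suc j)\<^esub> z' = \<delta> j b'"
    using tors_exact[OF j] unfolding exact_at_def by blast
  have M: "z' \<in> S (Suc j)" "b' \<in> S j" using cycles_sub[OF z'(1)] tors_S[OF b'(1)] .
  have "a = \<delta> (Suc j) (a' \<ominus>\<^bsub>C (Suc j)\<^esub> z')"
    using a' M cycles_d[OF z'(1)] by (simp add: d_diff C.eq_diff_iff)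
  moreover have "b = y \<odot>\<^bsub>C (Suc j)\<^esub> (a' \<ominus>\<^bsub>C (Suc j)\<^esub> z') \<ominus>\<^bsub>C (Suc j)\<^esub> \<delta> j b'"
    using a'(1) b(1) M unfolding b'(2)[symmetric] v_def by (simp add: C.module_simps)
  moreover have "a' \<ominus>\<^bsub>C (Suc j)\<^esub> z' \<in> S (Suc j)" using a' M by (simp add: sub_closed)
  ultimately show ?thesis using M(2) by blast
qed

end

text \<open>Each element is required to be surjective, up to its own torsion, on the torsion of the
  elements after it: the hypothesis needed when an induction removes elements from the
  front.\<close>

primrec torsion_divisible :: "('a, 'c) ring_scheme \<Rightarrow> (nat \<Rightarrow> ('a, 'm) module) \<Rightarrow> 'a list \<Rightarrow> bool" where
  "torsion_divisible R C [] \<longleftrightarrow> True"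
| "torsion_divisible R C (y # ys) \<longleftrightarrow> torsion_divisible R C ys \<and> y \<in> carrier R \<and>
     (\<forall>j. \<forall>z\<in>power_torsion R (set ys) (C j). \<exists>w\<in>power_torsion R (set ys) (C j). \<exists>n::nat.
        (y [^]\<^bsub>R\<^esub> n) \<odot>\<^bsub>C j\<^esub> (z \<ominus>\<^bsub>C j\<^esub> y \<odot>\<^bsub>C j\<^esub> w) = \<zero>\<^bsub>C j\<^esub>)"

text \<open>If \<open>H\<close> is the cohomology in degree 1, these are the cycles whose class lies
  in the submodule of \<open>H\<close> generated by all multiples of classes by elements of the
  list.\<close>

primrec cycle_span :: "(nat \<Rightarrow> ('a, 'm) module) \<Rightarrow> (nat \<Rightarrow> 'm \<Rightarrow> 'm) \<Rightarrow> 'a list \<Rightarrow> 'm set" where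
  "cycle_span C \<delta> [] = \<delta> 0 ` carrier (C 0)"
| "cycle_span C \<delta> (y # ys) = {y \<odot>\<^bsub>C 1\<^esub> z \<oplus>\<^bsub>C 1\<^esub> w | z w.
     z \<in> cycles C \<delta> (\<lambda>j. carrier (C j)) 1 \<and> w \<in> cycle_span C \<delta> ys}"

lemma torsion_divisible_carrier: "torsion_divisible R C ys \<Longrightarrow> set ys \<subseteq> carrier R"
  by (induction ys) auto

context module_complex
begin

lemma cycle_span_carrier:
  assumes "set ys \<subseteq> carrier R" "w \<in> cycle_span C \<delta> ys"
  shows "w \<in> carrier (C 1)"
  using assms
proof (induction ys arbitrary: w)
  case Nil
  then show ?case using d_closed[of _ 0] by auto
next
  case (Cons y ys)
  then obtain z u where "w = y \<odot>\<^bsub>C 1\<^esub> z \<oplus>\<^bsub>C 1\<^esub> u" "z \<in> carrier (C 1)" "u \<in> cycle_span C \<delta> ys"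
    by (auto simp: cycles_def)
  then show ?case using Cons by simp
qed

lemma torsion_exact_power_torsion:
  assumes "torsion_divisible R C (y # ys)"
    and "\<And>j. j \<noteq> 0 \<Longrightarrow> exact_at C \<delta> (\<lambda>j. power_torsion R (set (y # ys)) (C j)) j"
  shows "torsion_exact R C \<delta> (\<lambda>j. power_torsion R (set ys) (C j)) y
    (\<lambda>j. power_torsion R (set (y # ys)) (C j))"
proof -
  have Y: "set ys \<subseteq> carrier R" using assms(1) torsion_divisible_carrier by fastforce
  show ?thesis
  proof (intro torsion_exact.intro torsion_exact_axioms.intro subcomplex_power_torsion Y assms(2))
    show "y \<in> carrier R" using assms(1) by simp
    show "power_torsion R (set (y # ys)) (C j) =
      {m \<in> power_torsion R (set ys) (C j). \<exists>n::nat. (y [^] n) \<odot>\<^bsub>C j\<^esub> m = \<zero>\<^bsub>C j\<^esub>}" for j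
      by (auto simp: power_torsion_def)
  qed (use assms(1) in auto)
qed

end

context pairing
begin

text \<open>Subtracting the differential of \<open>pr u' \<zero>\<close> from \<open>pr u v\<close>
  leaves second component \<open>v - y u'\<close> and first component zero. So degree 1 cohomology
  of the cone is that of \<open>C\<close> modulo \<open>y\<close>, and spans pull back with
  \<open>y\<close> added to the list.\<close>

lemma cycle_span_cone:
  assumes "module_complex R C \<delta>" and y: "y \<in> carrier R" and ys: "set ys \<subseteq> carrier R"
    and ex: "exact_at C \<delta> (\<lambda>j. carrier (C j)) 1"
    and uv: "pr u v \<in> cycle_span (cone C) (cone_d y C \<delta>) ys"
    and u': "u' \<in> carrier (C 1)" "\<delta> 1 u' = u"
  shows "v \<ominus>\<^bsub>C 1\<^esub> y \<odot>\<^bsub>C 1\<^esub> u' \<in> cycle_span C \<delta> (y # ys)"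
  using ys uv u'
proof (induction ys arbitrary: u v u')
  case Nil
  interpret module_complex R C \<delta> by fact
  interpret S: subcomplex R C \<delta> "\<lambda>j. carrier (C j)" by (rule subcomplex_carrier)
  obtain w where w: "w \<in> carrier (cone C 0)" "pr u v = cone_d y C \<delta> 0 w" using Nil by auto
  obtain p q where pq: "w = pr p q" "p \<in> carrier (C 1)" "q \<in> carrier (C 0)"
    using w(1) unfolding cone_def by (auto elim: direct_sum_cases)
  have uv: "u = \<delta> 1 p" "v = y \<odot>\<^bsub>C 1\<^esub> p \<ominus>\<^bsub>C 1\<^esub> \<delta> 0 q" using w(2) by (simp_all add: pq(1))
  have dq: "\<delta> 0 q \<in> carrier (C 1)" using d_closed[OF pq(3)] by simp
  have "p \<ominus>\<^bsub>C 1\<^esub> u' \<in> cycles C \<delta> (\<lambda>j. carrier (C j)) 1"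
    using pq Nil(3,4) uv(1) d_diff[of p 1 u'] d_closed[of u' 1] by (simp add: cycles_def C.diff_eq_iff)
  moreover have "\<delta> 0 (\<zero>\<^bsub>C 0\<^esub> \<ominus>\<^bsub>C 0\<^esub> q) \<in> cycle_span C \<delta> []" using pq(3) by simp
  moreover have "\<delta> 0 (\<zero>\<^bsub>C 0\<^esub> \<ominus>\<^bsub>C 0\<^esub> q) = \<zero>\<^bsub>C 1\<^esub> \<ominus>\<^bsub>C 1\<^esub> \<delta> 0 q"
    using pq(3) by (simp add: d_diff)
  then have "v \<ominus>\<^bsub>C 1\<^esub> y \<odot>\<^bsub>C 1\<^esub> u' =
      y \<odot>\<^bsub>C 1\<^esub> (p \<ominus>\<^bsub>C 1\<^esub> u') \<oplus>\<^bsub>C 1\<^esub> \<delta> 0 (\<zero>\<^bsub>C 0\<^esub> \<ominus>\<^bsub>C 0\<^esub> q)"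
    using pq(2) dq Nil(3) y by (simp only:) (simp add: uv(2) C.module_simps)
  ultimately show ?case unfolding cycle_span.simps(2) by blast
next
  case (Cons y2 ys)
  interpret module_complex R C \<delta> by fact
  interpret S: subcomplex R C \<delta> "\<lambda>j. carrier (C j)" by (rule subcomplex_carrier)
  interpret D: module_complex R "cone C" "cone_d y C \<delta>" by (rule module_complex_cone) fact+
  have y2: "y2 \<in> carrier R" and ys: "set ys \<subseteq> carrier R" using Cons(2) by auto
  obtain s t where s: "s \<in> cycles (cone C) (cone_d y C \<delta>) (\<lambda>j. carrier (cone C j)) 1"
    and t: "t \<in> cycle_span (cone C) (cone_d y C \<delta>) ys"
    and uv: "pr u v = y2 \<odot>\<^bsub>cone C 1\<^esub> s \<oplus>\<^bsub>cone C 1\<^esub> t" using Cons(3) by auto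
  have "s \<in> carrier (cone C 1)" using s by (simp add: cycles_def)
  then obtain a b where ab: "s = pr a b" "a \<in> carrier (C (Suc 1))" "b \<in> carrier (C 1)"
    unfolding cone_def by (rule direct_sum_cases)
  have "t \<in> carrier (cone C 1)" by (rule D.cycle_span_carrier[OF ys t])
  then obtain u2 v2 where t_eq: "t = pr u2 v2" "u2 \<in> carrier (C (Suc 1))" "v2 \<in> carrier (C 1)"
    unfolding cone_def by (rule direct_sum_cases)
  have "cone_d y C \<delta> 1 (pr a b) = \<zero>\<^bsub>cone C (Suc 1)\<^esub>"
    using s by (simp add: cycles_def ab(1))
  then have da: "\<delta> (Suc 1) a = \<zero>\<^bsub>C (Suc (Suc 1))\<^esub>" and ya: "y \<odot>\<^bsub>C (Suc 1)\<^esub> a = \<delta> 1 b"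
    using ab y d_closed[OF ab(3)] by (auto simp: cone_def C.diff_eq_iff)
  have "a \<in> cycles C \<delta> (\<lambda>j. carrier (C j)) (Suc 1)" using ab da by (simp add: cycles_def)
  \<comment> \<open>Exactness in degree 2 makes the first component of the cycle \<open>s\<close> a
    boundary, so \<open>s\<close> is homologous to a pair with first component zero. The primitive
    \<open>a'\<close> also corrects \<open>u'\<close> to the primitive \<open>u3\<close> of
    \<open>u2\<close>.\<close>
  then obtain a' where a': "a' \<in> carrier (C 1)" "a = \<delta> 1 a'"
    using S.exact_imp_boundary[OF ex] by blast
  have uv': "u = y2 \<odot>\<^bsub>C (Suc 1)\<^esub> a \<oplus>\<^bsub>C (Suc 1)\<^esub> u2" "v = y2 \<odot>\<^bsub>C 1\<^esub> b \<oplus>\<^bsub>C 1\<^esub> v2"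
    using uv by (simp_all add: ab(1) t_eq(1) cone_def)
  define u3 where "u3 = u' \<ominus>\<^bsub>C 1\<^esub> y2 \<odot>\<^bsub>C 1\<^esub> a'"
  have u3: "u3 \<in> carrier (C 1)" using Cons(4) a' y2 by (simp add: u3_def)
  have "\<delta> 1 u3 = u2"
    using Cons(4,5) a' y2 t_eq uv'(1) ab
    by (simp only: u3_def d_diff d_smult C.smult_closed) (simp add: C.diff_eq_iff C.M.a_comm)
  then have "v2 \<ominus>\<^bsub>C 1\<^esub> y \<odot>\<^bsub>C 1\<^esub> u3 \<in> cycle_span C \<delta> (y # ys)"
    using Cons.IH[OF ys _ u3] t unfolding t_eq(1) by blast
  then obtain z w where z: "z \<in> cycles C \<delta> (\<lambda>j. carrier (C j)) 1" and w: "w \<in> cycle_span C \<delta> ys"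
    and eq: "v2 \<ominus>\<^bsub>C 1\<^esub> y \<odot>\<^bsub>C 1\<^esub> u3 = y \<odot>\<^bsub>C 1\<^esub> z \<oplus>\<^bsub>C 1\<^esub> w" by auto
  have M: "z \<in> carrier (C 1)" "w \<in> carrier (C 1)"
    using z cycle_span_carrier[OF ys w] by (simp_all add: cycles_def)
  have z2: "b \<ominus>\<^bsub>C 1\<^esub> y \<odot>\<^bsub>C 1\<^esub> a' \<in> cycles C \<delta> (\<lambda>j. carrier (C j)) 1"
    using ab a' ya y d_diff[OF ab(3), of "y \<odot>\<^bsub>C 1\<^esub> a'"] d_smult[OF y a'(1)] d_closed[OF ab(3)]
    by (simp add: cycles_def C.diff_eq_iff)
  have v2: "v2 = y \<odot>\<^bsub>C 1\<^esub> z \<oplus>\<^bsub>C 1\<^esub> w \<oplus>\<^bsub>C 1\<^esub> y \<odot>\<^bsub>C 1\<^esub> u3"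
    using eq t_eq(3) u3 M y by (simp add: C.diff_eq_iff)
  have "v \<ominus>\<^bsub>C 1\<^esub> y \<odot>\<^bsub>C 1\<^esub> u' =
      y \<odot>\<^bsub>C 1\<^esub> z \<oplus>\<^bsub>C 1\<^esub> (y2 \<odot>\<^bsub>C 1\<^esub> (b \<ominus>\<^bsub>C 1\<^esub> y \<odot>\<^bsub>C 1\<^esub> a') \<oplus>\<^bsub>C 1\<^esub> w)"
    unfolding uv'(2) v2 u3_def
    using ab(3) a'(1) M y y2 Cons(4) by (simp add: C.module_simps)
  moreover have "y2 \<odot>\<^bsub>C 1\<^esub> (b \<ominus>\<^bsub>C 1\<^esub> y \<odot>\<^bsub>C 1\<^esub> a') \<oplus>\<^bsub>C 1\<^esub> w \<in> cycle_span C \<delta> (y2 # ys)"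
    using z2 w unfolding cycle_span.simps by blast
  ultimately show ?case using z unfolding cycle_span.simps(2)[of C \<delta> y "y2 # ys"] by blast
qed

lemma torsion_divisible_cone:
  assumes "module_complex R C \<delta>" "torsion_divisible R C ys"
  shows "torsion_divisible R (cone C) ys"
  using assms(2)
proof (induction ys)
  case (Cons y ys)
  interpret module_complex R C \<delta> by fact
  have ys: "set ys \<subseteq> carrier R" and y: "y \<in> carrier R"
    using Cons(2) torsion_divisible_carrier by fastforce+
  have div: "\<exists>w\<in>power_torsion R (set ys) (C j). \<exists>n::nat.
        (y [^]\<^bsub>R\<^esub> n) \<odot>\<^bsub>C j\<^esub> (z \<ominus>\<^bsub>C j\<^esub> y \<odot>\<^bsub>C j\<^esub> w) = \<zero>\<^bsub>C j\<^esub>"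
    if "z \<in> power_torsion R (set ys) (C j)" for z j
    using Cons(2) that by simp
  have "\<exists>w\<in>power_torsion R (set ys) (cone C j). \<exists>n::nat.
      (y [^]\<^bsub>R\<^esub> n) \<odot>\<^bsub>cone C j\<^esub> (u \<ominus>\<^bsub>cone C j\<^esub> y \<odot>\<^bsub>cone C j\<^esub> w) = \<zero>\<^bsub>cone C j\<^esub>"
    if u: "u \<in> power_torsion R (set ys) (cone C j)" for u j
  proof -
    have "u \<in> carrier (cone C j)" using u by (simp add: power_torsion_def)
    then obtain a b where ab: "u = pr a b" "a \<in> carrier (C (Suc j))" "b \<in> carrier (C j)"
      unfolding cone_def by (rule direct_sum_cases)
    have t: "a \<in> power_torsion R (set ys) (C (Suc j))" "b \<in> power_torsion R (set ys) (C j)"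
      using u power_torsion_direct_sum[OF modules modules ys] unfolding ab(1) cone_def by blast+
    obtain w n where w: "w \<in> power_torsion R (set ys) (C (Suc j))"
      and n: "(y [^]\<^bsub>R\<^esub> (n::nat)) \<odot>\<^bsub>C (Suc j)\<^esub> (a \<ominus>\<^bsub>C (Suc j)\<^esub> y \<odot>\<^bsub>C (Suc j)\<^esub> w) = \<zero>\<^bsub>C (Suc j)\<^esub>"
      using div[OF t(1)] by blast
    obtain w' n' where w': "w' \<in> power_torsion R (set ys) (C j)"
      and n': "(y [^]\<^bsub>R\<^esub> (n'::nat)) \<odot>\<^bsub>C j\<^esub> (b \<ominus>\<^bsub>C j\<^esub> y \<odot>\<^bsub>C j\<^esub> w') = \<zero>\<^bsub>C j\<^esub>"
      using div[OF t(2)] by blast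
    have M: "w \<in> carrier (C (Suc j))" "w' \<in> carrier (C j)" using w w' by (simp_all add: power_torsion_def)
    have eq: "u \<ominus>\<^bsub>cone C j\<^esub> y \<odot>\<^bsub>cone C j\<^esub> pr w w' =
        pr (a \<ominus>\<^bsub>C (Suc j)\<^esub> y \<odot>\<^bsub>C (Suc j)\<^esub> w) (b \<ominus>\<^bsub>C j\<^esub> y \<odot>\<^bsub>C j\<^esub> w')"
      unfolding ab(1) cone_def using ab M y by (simp add: direct_sum_diff[OF modules modules])
    have "(y [^]\<^bsub>R\<^esub> (n + n')) \<odot>\<^bsub>C (Suc j)\<^esub> (a \<ominus>\<^bsub>C (Suc j)\<^esub> y \<odot>\<^bsub>C (Suc j)\<^esub> w) = \<zero>\<^bsub>C (Suc j)\<^esub>"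
      using C.smult_pow_zero_mono[OF y _ n, of "n + n'"] ab M y by simp
    moreover have "(y [^]\<^bsub>R\<^esub> (n + n')) \<odot>\<^bsub>C j\<^esub> (b \<ominus>\<^bsub>C j\<^esub> y \<odot>\<^bsub>C j\<^esub> w') = \<zero>\<^bsub>C j\<^esub>"
      using C.smult_pow_zero_mono[OF y _ n', of "n + n'"] ab M y by simp
    ultimately have "(y [^]\<^bsub>R\<^esub> (n + n')) \<odot>\<^bsub>cone C j\<^esub> (u \<ominus>\<^bsub>cone C j\<^esub> y \<odot>\<^bsub>cone C j\<^esub> pr w w') = \<zero>\<^bsub>cone C j\<^esub>"
      unfolding eq by (simp add: cone_def)
    moreover have "pr w w' \<in> power_torsion R (set ys) (cone C j)"
      using w w' power_torsion_direct_sum[OF modules modules ys] unfolding cone_def by blast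
    ultimately show ?thesis by blast
  qed
  then show ?case using Cons y by simp
qed simp

text \<open>Replacing the complex by the cone of \<open>y\<close> reduces the number of elements by one and turns its
  cohomology \<open>H\<close> in degree \<open>1\<close> into \<open>H / y H\<close>.\<close>

lemma torsion_surjects_pairing:
  fixes C :: "nat \<Rightarrow> ('a, 'c) module"
  assumes "module_complex R C \<delta>" "torsion_divisible R C ys"
    and "\<And>j. j \<noteq> 0 \<Longrightarrow> exact_at C \<delta> (\<lambda>j. carrier (C j)) j"
    and "\<And>j. j \<noteq> 0 \<Longrightarrow> exact_at C \<delta> (\<lambda>j. power_torsion R (set ys) (C j)) j"
    and "z \<in> cycles C \<delta> (\<lambda>j. carrier (C j)) 1"
  shows "\<exists>g\<in>cycles C \<delta> (\<lambda>j. power_torsion R (set ys) (C j)) 1. z \<ominus>\<^bsub>C 1\<^esub> g \<in> cycle_span C \<delta> ys"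
  using assms
proof (induction ys arbitrary: C \<delta> z)
  case Nil
  interpret module_complex R C \<delta> by fact
  have "z \<in> carrier (C 1)" using Nil by (simp add: cycles_def)
  then have "z \<ominus>\<^bsub>C 1\<^esub> z = \<delta> 0 \<zero>\<^bsub>C 0\<^esub>" by (simp add: C.diff_eq_iff)
  moreover have "(\<lambda>j. power_torsion R (set []) (C j)) = (\<lambda>j. carrier (C j))"
    by (simp add: power_torsion_def)
  ultimately show ?case using Nil(5) by force
next
  case (Cons y ys)
  interpret module_complex R C \<delta> by fact
  interpret S: subcomplex R C \<delta> "\<lambda>j. carrier (C j)" by (rule subcomplex_carrier)
  let ?T = "\<lambda>j. power_torsion R (set ys) (C j)"
  interpret T: torsion_exact R C \<delta> ?T y "\<lambda>j. power_torsion R (set (y # ys)) (C j)"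
    by (rule torsion_exact_power_torsion) fact+
  let ?D = "cone C" and ?\<delta> = "cone_d y C \<delta>"
  have ys: "set ys \<subseteq> carrier R" and y: "y \<in> carrier R" and div: "torsion_divisible R C ys"
    using Cons(3) torsion_divisible_carrier by fastforce+
  note exC = Cons(4)
  have zM: "z \<in> carrier (C 1)" using Cons(6) by (simp add: cycles_def)
  interpret D: module_complex R ?D ?\<delta> by (rule module_complex_cone) fact+
  have "exact_at ?D ?\<delta> (\<lambda>j. carrier (?D j)) j" if j: "j \<noteq> 0" for j
  proof (rule exact_at_cone[OF Cons(2) y, where S = "\<lambda>j. carrier (C j)"])
    fix a b assume a: "a \<in> cycles C \<delta> (\<lambda>j. carrier (C j)) (Suc (Suc j))" and b: "b \<in> carrier (C (Suc j))"
      "y \<odot>\<^bsub>C (Suc (Suc j))\<^esub> a = \<delta> (Suc j) b"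
    obtain a' where a': "a' \<in> carrier (C (Suc j))" "a = \<delta> (Suc j) a'"
      using S.exact_imp_boundary[OF exC a] by auto
    have "y \<odot>\<^bsub>C (Suc j)\<^esub> a' \<ominus>\<^bsub>C (Suc j)\<^esub> b \<in> cycles C \<delta> (\<lambda>j. carrier (C j)) (Suc j)"
      using a' b y by (simp add: cycles_def d_simps C.diff_eq_iff)
    then obtain b' where b': "b' \<in> carrier (C j)" "y \<odot>\<^bsub>C (Suc j)\<^esub> a' \<ominus>\<^bsub>C (Suc j)\<^esub> b = \<delta> j b'"
      using S.exact_imp_boundary[OF exC[OF j]] by blast
    have "b = y \<odot>\<^bsub>C (Suc j)\<^esub> a' \<ominus>\<^bsub>C (Suc j)\<^esub> \<delta> j b'"
      using a'(1) b(1) y unfolding b'(2)[symmetric] by (simp add: C.module_simps)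
    then show "\<exists>a'\<in>carrier (C (Suc j)). \<exists>b'\<in>carrier (C j). a = \<delta> (Suc j) a' \<and>
        b = y \<odot>\<^bsub>C (Suc j)\<^esub> a' \<ominus>\<^bsub>C (Suc j)\<^esub> \<delta> j b'" using a' b'(1) by blast
  qed (simp_all add: cone_def)
  \<comment> \<open>Exactness is assumed only for the torsion of \<open>y # ys\<close>. The cone of
    \<open>y\<close> on the \<open>ys\<close>-torsion is nevertheless exact, as \<open>y\<close> is
    bijective on the quotient by \<open>y\<close>-torsion.\<close>
  moreover have "exact_at ?D ?\<delta> (\<lambda>j. power_torsion R (set ys) (?D j)) j" if j: "j \<noteq> 0" for j
  proof (rule exact_at_cone[OF Cons(2) y, where S = ?T])
    show "pr a b \<in> power_torsion R (set ys) (?D j) \<longleftrightarrow> a \<in> ?T (Suc j) \<and> b \<in> ?T j" for j a b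
      unfolding cone_def by (rule power_torsion_direct_sum[OF modules modules ys])
    show "?T i \<subseteq> carrier (C i)" "power_torsion R (set ys) (?D i) \<subseteq> carrier (?D i)" for i
      unfolding power_torsion_def by blast+
  qed (rule T.cone_exact[OF j])
  moreover have "pr \<zero>\<^bsub>C (Suc 1)\<^esub> z \<in> cycles ?D ?\<delta> (\<lambda>j. carrier (?D j)) 1"
    using Cons(6) y d_closed[OF zM] by (simp add: cycles_def cone_def C.diff_eq_iff)
  ultimately obtain g where g: "g \<in> cycles ?D ?\<delta> (\<lambda>j. power_torsion R (set ys) (?D j)) 1"
    and gz: "pr \<zero>\<^bsub>C (Suc 1)\<^esub> z \<ominus>\<^bsub>?D 1\<^esub> g \<in> cycle_span ?D ?\<delta> ys"
    using Cons.IH[OF D.module_complex_axioms torsion_divisible_cone[OF Cons(2) div]] by blast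
  have "g \<in> carrier (?D 1)" using g by (simp add: cycles_def power_torsion_def)
  then obtain a b where ab: "g = pr a b" "a \<in> carrier (C (Suc 1))" "b \<in> carrier (C 1)"
    unfolding cone_def by (rule direct_sum_cases)
  have t: "a \<in> ?T (Suc 1)" "b \<in> ?T 1"
    using g power_torsion_direct_sum[OF modules modules ys] unfolding ab(1) cone_def cycles_def by blast+
  have "?\<delta> 1 (pr a b) = \<zero>\<^bsub>?D (Suc 1)\<^esub>" using g by (simp add: cycles_def ab(1))
  then have da: "\<delta> (Suc 1) a = \<zero>\<^bsub>C (Suc (Suc 1))\<^esub>" and ya: "y \<odot>\<^bsub>C (Suc 1)\<^esub> a = \<delta> 1 b"
    using ab y d_closed[OF ab(3)] by (auto simp: cone_def C.diff_eq_iff)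
  have "a \<in> cycles C \<delta> ?T (Suc 1)" using t da by (simp add: cycles_def)
  \<comment> \<open>The element from the induction hypothesis is only \<open>ys\<close>-torsion.
    Making its first component zero turns \<open>b\<close> into the cycle \<open>b - y a'\<close>; a
    further multiple \<open>y z'\<close> removes what is not \<open>y\<close>-torsion. Both
    corrections vanish modulo \<open>y\<close>.\<close>
  then obtain a' where a': "a' \<in> ?T 1" "a = \<delta> 1 a'"
    using T.injective_mod_boundaries[OF _ _ t(2) ya] by auto
  have a'M: "a' \<in> carrier (C 1)" by (rule T.sub_carrier[OF a'(1)])
  have "\<delta> 1 (b \<ominus>\<^bsub>C 1\<^esub> y \<odot>\<^bsub>C 1\<^esub> a') = \<delta> 1 b \<ominus>\<^bsub>C (Suc 1)\<^esub> y \<odot>\<^bsub>C (Suc 1)\<^esub> \<delta> 1 a'"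
    using ab(3) a'M y by (simp only: d_diff d_smult C.smult_closed)
  also have "\<dots> = \<zero>\<^bsub>C (Suc 1)\<^esub>"
    using d_closed[OF ab(3)] unfolding a'(2)[symmetric] ya by (simp only: C.diff_eq_iff C.M.zero_closed C.M.l_zero)
  finally have "b \<ominus>\<^bsub>C 1\<^esub> y \<odot>\<^bsub>C 1\<^esub> a' \<in> cycles C \<delta> ?T 1"
    unfolding cycles_def using T.sub_diff[OF t(2) T.sub_smult[OF y a'(1)]] by blast
  then obtain z' where z': "z' \<in> cycles C \<delta> ?T 1"
    and h: "b \<ominus>\<^bsub>C 1\<^esub> y \<odot>\<^bsub>C 1\<^esub> a' \<ominus>\<^bsub>C 1\<^esub> y \<odot>\<^bsub>C 1\<^esub> z' \<in> cycles C \<delta> (\<lambda>j. power_torsion R (set (y # ys)) (C j)) 1"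
    using T.surjective_mod_torsion by auto
  define h where "h = b \<ominus>\<^bsub>C 1\<^esub> y \<odot>\<^bsub>C 1\<^esub> a' \<ominus>\<^bsub>C 1\<^esub> y \<odot>\<^bsub>C 1\<^esub> z'"
  have z'M: "z' \<in> carrier (C 1)" "\<delta> 1 z' = \<zero>\<^bsub>C (Suc 1)\<^esub>"
    using T.sub_carrier[OF T.cycles_sub[OF z']] T.cycles_d[OF z'] .
  have "pr \<zero>\<^bsub>C (Suc 1)\<^esub> z \<ominus>\<^bsub>?D 1\<^esub> g = pr (\<zero>\<^bsub>C (Suc 1)\<^esub> \<ominus>\<^bsub>C (Suc 1)\<^esub> a) (z \<ominus>\<^bsub>C 1\<^esub> b)"
    unfolding ab(1) cone_def using ab zM by (simp add: direct_sum_diff[OF modules modules])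
  moreover have "\<delta> 1 (\<zero>\<^bsub>C 1\<^esub> \<ominus>\<^bsub>C 1\<^esub> a') = \<zero>\<^bsub>C (Suc 1)\<^esub> \<ominus>\<^bsub>C (Suc 1)\<^esub> a"
    using a'M by (simp only: d_diff C.M.zero_closed d_zero a'(2))
  \<comment> \<open>The primitive of the first component is the negative of \<open>a'\<close>, so
    pulling the relation back adds \<open>y a'\<close> to \<open>z - b\<close>.\<close>
  ultimately have "(z \<ominus>\<^bsub>C 1\<^esub> b) \<ominus>\<^bsub>C 1\<^esub> y \<odot>\<^bsub>C 1\<^esub> (\<zero>\<^bsub>C 1\<^esub> \<ominus>\<^bsub>C 1\<^esub> a') \<in> cycle_span C \<delta> (y # ys)"
    using cycle_span_cone[OF Cons(2) y ys exC[OF one_neq_zero], of _ _ "\<zero>\<^bsub>C 1\<^esub> \<ominus>\<^bsub>C 1\<^esub> a'"] gz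
      C.M.minus_closed[OF C.M.zero_closed a'M] by metis
  then obtain p w where p: "p \<in> cycles C \<delta> (\<lambda>j. carrier (C j)) 1" and w: "w \<in> cycle_span C \<delta> ys"
    and eq: "(z \<ominus>\<^bsub>C 1\<^esub> b) \<ominus>\<^bsub>C 1\<^esub> y \<odot>\<^bsub>C 1\<^esub> (\<zero>\<^bsub>C 1\<^esub> \<ominus>\<^bsub>C 1\<^esub> a') = y \<odot>\<^bsub>C 1\<^esub> p \<oplus>\<^bsub>C 1\<^esub> w" by auto
  have M: "p \<in> carrier (C 1)" "w \<in> carrier (C 1)"
    using p cycle_span_carrier[OF ys w] by (simp_all add: cycles_def)
  have z'c: "z' \<in> cycles C \<delta> (\<lambda>j. carrier (C j)) 1"
    using z'M by (simp add: cycles_def)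
  have "p \<oplus>\<^bsub>C 1\<^esub> z' \<in> cycles C \<delta> (\<lambda>j. carrier (C j)) 1"
    by (rule S.cycles_closed(1)[OF p z'c])
  moreover have "z \<ominus>\<^bsub>C 1\<^esub> h = y \<odot>\<^bsub>C 1\<^esub> (p \<oplus>\<^bsub>C 1\<^esub> z') \<oplus>\<^bsub>C 1\<^esub> w"
  proof -
    have "z \<oplus>\<^bsub>C 1\<^esub> y \<odot>\<^bsub>C 1\<^esub> a' = y \<odot>\<^bsub>C 1\<^esub> p \<oplus>\<^bsub>C 1\<^esub> w \<oplus>\<^bsub>C 1\<^esub> b"
      using eq zM ab(3) a'M M y by (simp add: C.module_simps)
    then have "(z \<oplus>\<^bsub>C 1\<^esub> y \<odot>\<^bsub>C 1\<^esub> a') \<oplus>\<^bsub>C 1\<^esub> y \<odot>\<^bsub>C 1\<^esub> z' = (y \<odot>\<^bsub>C 1\<^esub> p \<oplus>\<^bsub>C 1\<^esub> w \<oplus>\<^bsub>C 1\<^esub> b) \<oplus>\<^bsub>C 1\<^esub> y \<odot>\<^bsub>C 1\<^esub> z'"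
      by simp
    moreover have "z \<ominus>\<^bsub>C 1\<^esub> h = y \<odot>\<^bsub>C 1\<^esub> (p \<oplus>\<^bsub>C 1\<^esub> z') \<oplus>\<^bsub>C 1\<^esub> w \<longleftrightarrow>
        (z \<oplus>\<^bsub>C 1\<^esub> y \<odot>\<^bsub>C 1\<^esub> a') \<oplus>\<^bsub>C 1\<^esub> y \<odot>\<^bsub>C 1\<^esub> z' = (y \<odot>\<^bsub>C 1\<^esub> p \<oplus>\<^bsub>C 1\<^esub> w \<oplus>\<^bsub>C 1\<^esub> b) \<oplus>\<^bsub>C 1\<^esub> y \<odot>\<^bsub>C 1\<^esub> z'"
      using zM ab(3) a'M M z'M(1) y by (simp add: h_def C.module_simps)
    ultimately show ?thesis by blast
  qed
  ultimately have "z \<ominus>\<^bsub>C 1\<^esub> h \<in> cycle_span C \<delta> (y # ys)"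
    using w unfolding cycle_span.simps(2) by blast
  then show ?case using h unfolding h_def[symmetric] by blast
qed

end

section \<open>Nilpotency from vanishing cohomology\<close>

text \<open>Copies a module along an injection \<open>\<iota>\<close> with left inverse
  \<open>\<rho>\<close>. An arbitrary type need not admit a pairing, so the complex is first moved
  to one that does.\<close>

definition transport :: "('m \<Rightarrow> 'c) \<Rightarrow> ('c \<Rightarrow> 'm) \<Rightarrow> ('a, 'm) module \<Rightarrow> ('a, 'c) module" where
  "transport \<iota> \<rho> M = \<lparr>carrier = \<iota> ` carrier M, monoid.mult = undefined, one = undefined,
     zero = \<iota> \<zero>\<^bsub>M\<^esub>, add = (\<lambda>u v. \<iota> (\<rho> u \<oplus>\<^bsub>M\<^esub> \<rho> v)), smult = (\<lambda>a u. \<iota> (a \<odot>\<^bsub>M\<^esub> \<rho> u))\<rparr>"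

locale transport_complex = module_complex R C \<delta>
  for R (structure) and C :: "nat \<Rightarrow> ('a, 'm) module" and \<delta> +
  fixes \<iota> :: "'m \<Rightarrow> 'c" and \<rho> :: "'c \<Rightarrow> 'm"
  assumes \<rho>\<iota> [simp]: "\<rho> (\<iota> m) = m"
begin

abbreviation "C' \<equiv> \<lambda>j. transport \<iota> \<rho> (C j)"
abbreviation "\<delta>' \<equiv> \<lambda>j. \<iota> \<circ> \<delta> j \<circ> \<rho>"

lemma \<iota>_eq [simp]: "\<iota> m = \<iota> m' \<longleftrightarrow> m = m'"
  using \<rho>\<iota> by metis

lemma transport_simps [simp]:
  "carrier (C' j) = \<iota> ` carrier (C j)" "\<zero>\<^bsub>C' j\<^esub> = \<iota> \<zero>\<^bsub>C j\<^esub>"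
  "\<iota> m \<oplus>\<^bsub>C' j\<^esub> \<iota> n = \<iota> (m \<oplus>\<^bsub>C j\<^esub> n)" "a \<odot>\<^bsub>C' j\<^esub> \<iota> m = \<iota> (a \<odot>\<^bsub>C j\<^esub> m)"
  by (simp_all add: transport_def)

lemma module_C': "module R (C' j)"
proof -
  have "abelian_group (C' j)"
  proof (rule abelian_groupI)
    fix u assume "u \<in> carrier (C' j)"
    then obtain m where m: "u = \<iota> m" "m \<in> carrier (C j)" by auto
    then show "\<exists>v\<in>carrier (C' j). v \<oplus>\<^bsub>C' j\<^esub> u = \<zero>\<^bsub>C' j\<^esub>"
      by (intro bexI[of _ "\<iota> (\<ominus>\<^bsub>C j\<^esub> m)"]) (simp_all add: C.M.l_neg)
  qed (auto simp: C.M.a_ac)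
  then show ?thesis
    by (intro moduleI is_cring) (auto simp: C.smult_l_distr C.smult_r_distr C.smult_assoc1)
qed

sublocale C': module_complex R C' \<delta>'
proof (intro module_complex.intro module_complex_axioms.intro noetherian_cring_axioms module_C')
  show "\<delta>' j \<in> mod_hom R (C' j) (C' (Suc j))" for j
    by (auto simp: mod_hom_def d_simps)
  show "\<delta>' (Suc j) (\<delta>' j u) = \<zero>\<^bsub>C' (Suc (Suc j))\<^esub>" if "u \<in> carrier (C' j)" for u j
    using that by (auto simp: dd)
qed

lemma transport_diff:
  assumes "m \<in> carrier (C j)" "n \<in> carrier (C j)"
  shows "\<iota> m \<ominus>\<^bsub>C' j\<^esub> \<iota> n = \<iota> (m \<ominus>\<^bsub>C j\<^esub> n)"
proof -
  have "\<iota> (m \<ominus>\<^bsub>C j\<^esub> n) \<oplus>\<^bsub>C' j\<^esub> \<iota> n = \<iota> m"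
    using assms by (simp add: C.module_simps)
  then show ?thesis using assms by (subst C'.C.diff_eq_iff) simp_all
qed

lemma power_torsion_transport: "power_torsion R Y (C' j) = \<iota> ` power_torsion R Y (C j)"
  by (auto simp: power_torsion_def)

lemma cycles_transport: "cycles C' \<delta>' (\<lambda>j. \<iota> ` S j) j = \<iota> ` cycles C \<delta> S j"
  by (auto simp: cycles_def)

lemma exact_at_transport: "exact_at C \<delta> S j \<Longrightarrow> exact_at C' \<delta>' (\<lambda>j. \<iota> ` S j) j"
  unfolding exact_at_def cycles_transport by (force simp: image_iff)

lemma torsion_divisible_transport:
  assumes "torsion_divisible R C ys"
  shows "torsion_divisible R C' ys"
  using assms
proof (induction ys)
  case (Cons y ys)
  then have y: "y \<in> carrier R" by simp
  have "\<exists>w\<in>power_torsion R (set ys) (C' j). \<exists>n::nat.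
      (y [^] n) \<odot>\<^bsub>C' j\<^esub> (u \<ominus>\<^bsub>C' j\<^esub> y \<odot>\<^bsub>C' j\<^esub> w) = \<zero>\<^bsub>C' j\<^esub>"
    if uT: "u \<in> power_torsion R (set ys) (C' j)" for u j
  proof -
    obtain m where m: "u = \<iota> m" "m \<in> power_torsion R (set ys) (C j)"
      using uT unfolding power_torsion_transport by blast
    obtain w n where w: "w \<in> power_torsion R (set ys) (C j)"
      "(y [^] (n::nat)) \<odot>\<^bsub>C j\<^esub> (m \<ominus>\<^bsub>C j\<^esub> y \<odot>\<^bsub>C j\<^esub> w) = \<zero>\<^bsub>C j\<^esub>"
      using Cons(2) m(2) unfolding torsion_divisible.simps(2) by blast
    have "m \<in> carrier (C j)" "w \<in> carrier (C j)" using m(2) w(1) unfolding power_torsion_def by blast+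
    then have "(y [^] n) \<odot>\<^bsub>C' j\<^esub> (u \<ominus>\<^bsub>C' j\<^esub> y \<odot>\<^bsub>C' j\<^esub> \<iota> w) = \<zero>\<^bsub>C' j\<^esub>"
      using y w(2) by (simp add: m(1) transport_diff)
    then show ?thesis using w(1) unfolding power_torsion_transport by blast
  qed
  then show ?case using Cons y by simp
qed simp

lemma cycle_span_transport:
  assumes "u \<in> cycle_span C' \<delta>' ys"
  shows "\<exists>w\<in>cycle_span C \<delta> ys. u = \<iota> w"
  using assms
proof (induction ys arbitrary: u)
  case (Cons y ys)
  then obtain s t where s: "s \<in> cycles C' \<delta>' (\<lambda>j. carrier (C' j)) 1" and t: "t \<in> cycle_span C' \<delta>' ys"
    and u: "u = y \<odot>\<^bsub>C' 1\<^esub> s \<oplus>\<^bsub>C' 1\<^esub> t" unfolding cycle_span.simps(2) by blast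
  obtain z where z: "z \<in> cycles C \<delta> (\<lambda>j. carrier (C j)) 1" "s = \<iota> z"
    using s cycles_transport[of "\<lambda>j. carrier (C j)" 1] by auto
  obtain w where w: "w \<in> cycle_span C \<delta> ys" "t = \<iota> w" using Cons.IH[OF t] by blast
  have "u = \<iota> (y \<odot>\<^bsub>C 1\<^esub> z \<oplus>\<^bsub>C 1\<^esub> w)" by (simp add: u z(2) w(2))
  then show ?case using z(1) w(1) unfolding cycle_span.simps(2) by blast
qed auto

end

lemma torsion_surjects:
  fixes C :: "nat \<Rightarrow> ('a, 'm) module"
  assumes "module_complex R C \<delta>" and div: "torsion_divisible R C ys"
    and ex: "\<And>j. j \<noteq> 0 \<Longrightarrow> exact_at C \<delta> (\<lambda>j. carrier (C j)) j"
    and ex_tors: "\<And>j. j \<noteq> 0 \<Longrightarrow> exact_at C \<delta> (\<lambda>j. power_torsion R (set ys) (C j)) j"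
    and z: "z \<in> cycles C \<delta> (\<lambda>j. carrier (C j)) 1"
  shows "\<exists>g\<in>cycles C \<delta> (\<lambda>j. power_torsion R (set ys) (C j)) 1. z \<ominus>\<^bsub>C 1\<^esub> g \<in> cycle_span C \<delta> ys"
proof -
  interpret module_complex R C \<delta> by fact
  \<comment> \<open>Sequences in any type can be paired by interleaving even and odd positions;
    elements embed as constant sequences.\<close>
  interpret pairing "\<lambda>(a::nat \<Rightarrow> 'm) b n. if even n then a (n div 2) else b (n div 2)"
    "\<lambda>f n. f (2 * n)" "\<lambda>f n. f (2 * n + 1)"
    by unfold_locales auto
  interpret T: transport_complex R C \<delta> "\<lambda>m (n::nat). m" "\<lambda>f. f 0"
    by unfold_locales simp
  let ?\<iota> = "\<lambda>m (n::nat). m"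
  have car: "(\<lambda>j. carrier (T.C' j)) = (\<lambda>j. ?\<iota> ` carrier (C j))" by simp
  have tors: "(\<lambda>j. power_torsion R (set ys) (T.C' j)) = (\<lambda>j. ?\<iota> ` power_torsion R (set ys) (C j))"
    by (simp add: T.power_torsion_transport)
  have "?\<iota> z \<in> cycles T.C' T.\<delta>' (\<lambda>j. carrier (T.C' j)) 1"
    unfolding car T.cycles_transport using z by blast
  then obtain g where g: "g \<in> cycles T.C' T.\<delta>' (\<lambda>j. power_torsion R (set ys) (T.C' j)) 1"
    and gz: "?\<iota> z \<ominus>\<^bsub>T.C' 1\<^esub> g \<in> cycle_span T.C' T.\<delta>' ys"
    using torsion_surjects_pairing[OF T.C'.module_complex_axioms T.torsion_divisible_transport[OF div],
        of "?\<iota> z"] T.exact_at_transport[OF ex] T.exact_at_transport[OF ex_tors]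
    unfolding car tors by blast
  obtain h where h: "h \<in> cycles C \<delta> (\<lambda>j. power_torsion R (set ys) (C j)) 1" "g = ?\<iota> h"
    using g unfolding tors T.cycles_transport by blast
  have hM: "h \<in> carrier (C 1)" "z \<in> carrier (C 1)"
    using h(1) z unfolding cycles_def power_torsion_def by blast+
  obtain w where "w \<in> cycle_span C \<delta> ys" "?\<iota> z \<ominus>\<^bsub>T.C' 1\<^esub> ?\<iota> h = ?\<iota> w"
    using T.cycle_span_transport[OF gz] h(2) by blast
  moreover have "?\<iota> z \<ominus>\<^bsub>T.C' 1\<^esub> ?\<iota> h = ?\<iota> (z \<ominus>\<^bsub>C 1\<^esub> h)"
    by (rule T.transport_diff[OF hM(2,1)])
  ultimately have "z \<ominus>\<^bsub>C 1\<^esub> h \<in> cycle_span C \<delta> ys" using T.\<iota>_eq by metis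
  then show ?thesis using h(1) by blast
qed

text \<open>Subtraction is defined through additive inverses, and these depend on the carrier of the
  record, so agreement after restriction is a fact and not a simplification.\<close>

lemma (in module) submodule_diff:
  assumes S: "submodule S R M" and xy: "x \<in> S" "y \<in> S"
  shows "x \<ominus>\<^bsub>M\<lparr>carrier := S\<rparr>\<^esub> y = x \<ominus>\<^bsub>M\<^esub> y"
proof -
  interpret S: module R "M\<lparr>carrier := S\<rparr>"
    by (rule submodule.submodule_is_module[OF S module_axioms])
  note SE = submoduleE[OF S]
  have "x \<ominus>\<^bsub>M\<^esub> y \<in> S" using xy SE(3,5) by (simp add: a_minus_def)
  moreover have "x \<in> carrier M" "y \<in> carrier M" using xy SE(1) by blast+
  ultimately show ?thesis using xy
    by (subst S.diff_eq_iff) (simp_all add: module_simps)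
qed

context torsion_resolution
begin

text \<open>The ring elements with a power killing \<open>m\<close> form the radical of the
  annihilator of \<open>m\<close>, so it suffices to test generators.\<close>

lemma torsion_generators:
  assumes "set ys \<subseteq> carrier R" "I = Idl (set ys)"
  shows "power_torsion R (set ys) (C j) = power_torsion R I (C j)"
proof
  show "power_torsion R I (C j) \<subseteq> power_torsion R (set ys) (C j)"
    using genideal_self[OF assms(1)] assms(2) unfolding power_torsion_def by blast
  show "power_torsion R (set ys) (C j) \<subseteq> power_torsion R I (C j)"
  proof
    fix m assume m: "m \<in> power_torsion R (set ys) (C j)"
    then have mM: "m \<in> carrier (C j)" by (simp add: power_torsion_def)
    have "\<exists>k::nat. y [^] k \<in> annihilator R (C j) m" if "y \<in> I" for y
    proof (rule pow_mem_if_generators_pow_mem[OF C.ideal_annihilator[OF mM] assms(1)])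
      show "y \<in> Idl (set ys)" using that assms(2) by simp
      fix x assume x: "x \<in> set ys"
      then obtain k :: nat where "(x [^] k) \<odot>\<^bsub>C j\<^esub> m = \<zero>\<^bsub>C j\<^esub>"
        using m unfolding power_torsion_def by blast
      then show "\<exists>k::nat. x [^] k \<in> annihilator R (C j) m"
        using x assms(1) unfolding annihilator_def by auto
    qed
    then show "m \<in> power_torsion R I (C j)"
      using mM unfolding power_torsion_def annihilator_def by blast
  qed
qed

text \<open>\<open>F r\<close> is shifted by \<open>r\<close> so that its cohomology
  \<open>R / c r\<close> sits in degree 1. Surjectivity of torsion then writes the generator
  \<open>e\<close> as a torsion cycle plus \<open>a \<odot> e\<close> with \<open>a\<close> in
  \<open>I\<close>, up to a boundary, and freeness of \<open>e\<close> turns this into a statement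
  about \<open>c r\<close>.\<close>

lemma coregular_imp_nilpotent:
  assumes cor: "coregular" and ex0: "\<And>j. j > r \<Longrightarrow> exact_at C \<delta> (G 0) j"
  shows "\<exists>a\<in>I. \<forall>y\<in>I. \<exists>n::nat. y [^] n \<otimes> (\<one> \<ominus> a) \<in> c r"
proof -
  define C' where "C' j = (C (r + j))\<lparr>carrier := F r (r + j)\<rparr>" for j
  define \<delta>' where "\<delta>' j = \<delta> (r + j)" for j
  have C'_simps [simp]: "carrier (C' j) = F r (r + j)" "\<zero>\<^bsub>C' j\<^esub> = \<zero>\<^bsub>C (r + j)\<^esub>"
    "x \<oplus>\<^bsub>C' j\<^esub> y = x \<oplus>\<^bsub>C (r + j)\<^esub> y" "a \<odot>\<^bsub>C' j\<^esub> x = a \<odot>\<^bsub>C (r + j)\<^esub> x" for j x y a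
    by (simp_all add: C'_def)
  have diff: "x \<ominus>\<^bsub>C' j\<^esub> y = x \<ominus>\<^bsub>C (r + j)\<^esub> y" if "x \<in> F r (r + j)" "y \<in> F r (r + j)" for x y j
    unfolding C'_def by (rule C.submodule_diff[OF F.sub that])
  have tors: "power_torsion R Y (C' j) = F r (r + j) \<inter> power_torsion R Y (C (r + j))" for Y j
    by (auto simp: power_torsion_def)
  have cyc: "cycles C' \<delta>' (\<lambda>j. S (r + j)) j = cycles C \<delta> S (r + j)" for S j
    by (simp add: cycles_def \<delta>'_def)
  have exact': "exact_at C' \<delta>' (\<lambda>j. S (r + j)) j" if "exact_at C \<delta> S (r + j)" for S j
    using that unfolding exact_at_def cyc \<delta>'_def by simp
  have mc: "module_complex R C' \<delta>'"
  proof (intro module_complex.intro module_complex_axioms.intro noetherian_cring_axioms)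
    show "module R (C' j)" for j
      unfolding C'_def by (rule submodule.submodule_is_module[OF F.sub modules])
    show "\<delta>' j \<in> mod_hom R (C' j) (C' (Suc j))" for j
      by (auto simp: mod_hom_def \<delta>'_def d_add d_smult F.sub_d)
    show "\<delta>' (Suc j) (\<delta>' j x) = \<zero>\<^bsub>C' (Suc (Suc j))\<^esub>" if "x \<in> carrier (C' j)" for x j
      using that by (simp add: \<delta>'_def dd)
  qed
  obtain A where A: "A \<subseteq> carrier R" "finite A" "I = Idl A" using finetely_gen[OF I] by auto
  then obtain ys where ys: "set ys = A" using finite_list by auto
  have ysR: "set ys \<subseteq> carrier R" and Iys: "I = Idl (set ys)" using A ys by simp_all
  have div: "torsion_divisible R C' zs" if "set zs \<subseteq> carrier R" for zs
    using that
  proof (induction zs)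
    case (Cons y zs)
    have "\<exists>w\<in>power_torsion R (set zs) (C' j). \<exists>n::nat.
        (y [^] n) \<odot>\<^bsub>C' j\<^esub> (z \<ominus>\<^bsub>C' j\<^esub> y \<odot>\<^bsub>C' j\<^esub> w) = \<zero>\<^bsub>C' j\<^esub>"
      if z: "z \<in> power_torsion R (set zs) (C' j)" for z j
    proof -
      interpret N: noetherian_module R "C (r + j)" by (rule noetherian_module_C)
      have yR: "y \<in> carrier R" and zsR: "set zs \<subseteq> carrier R" using Cons(2) by auto
      have "\<exists>w\<in>F r (r + j) \<inter> power_torsion R (set zs) (C (r + j)). \<exists>n::nat.
          (y [^] n) \<odot>\<^bsub>C (r + j)\<^esub> (z \<ominus>\<^bsub>C (r + j)\<^esub> y \<odot>\<^bsub>C (r + j)\<^esub> w) = \<zero>\<^bsub>C (r + j)\<^esub>"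
        by (rule N.power_torsion_divisible_mod[OF baer_F F.sub ideal_c _ yR zsR z[unfolded tors]])
          (rule F_kill)
      then obtain w n where w: "w \<in> F r (r + j) \<inter> power_torsion R (set zs) (C (r + j))"
        "(y [^] (n::nat)) \<odot>\<^bsub>C (r + j)\<^esub> (z \<ominus>\<^bsub>C (r + j)\<^esub> y \<odot>\<^bsub>C (r + j)\<^esub> w) = \<zero>\<^bsub>C (r + j)\<^esub>"
        by blast
      have "z \<ominus>\<^bsub>C' j\<^esub> y \<odot>\<^bsub>C' j\<^esub> w = z \<ominus>\<^bsub>C (r + j)\<^esub> y \<odot>\<^bsub>C (r + j)\<^esub> w"
        using diff[of z j "y \<odot>\<^bsub>C (r + j)\<^esub> w"] z w(1) yR unfolding tors by (simp add: F.sub_smult)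
      then show ?thesis using w unfolding tors by (intro bexI[of _ w] exI[of _ n]) simp_all
    qed
    then show ?case using Cons by simp
  qed simp
  have coh: "\<And>j. j \<noteq> r \<Longrightarrow> exact_at C \<delta> (F r) j"
    using cohomology_F[OF order_refl] by blast
  obtain e where e: "e \<in> cycles C \<delta> (F r) (Suc r)"
    and gen: "\<forall>z\<in>cycles C \<delta> (F r) (Suc r). \<exists>a\<in>carrier R.
        z \<ominus>\<^bsub>C (Suc r)\<^esub> a \<odot>\<^bsub>C (Suc r)\<^esub> e \<in> \<delta> r ` F r r"
    and free: "\<forall>a\<in>carrier R. a \<odot>\<^bsub>C (Suc r)\<^esub> e \<in> \<delta> r ` F r r \<longrightarrow> a \<in> c r"
    using cohomology_F[OF order_refl] by (elim conjE bexE)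
  have eF: "e \<in> F r (Suc r)" using e by (rule F.cycles_sub)
  have carF: "(\<lambda>j. carrier (C' j)) = (\<lambda>j. F r (r + j))" by simp
  have torsG: "(\<lambda>j. power_torsion R (set ys) (C' j)) = (\<lambda>j. G r (r + j))"
    unfolding tors G_def torsion_generators[OF ysR Iys] by simp
  have "\<exists>g\<in>cycles C' \<delta>' (\<lambda>j. power_torsion R (set ys) (C' j)) 1. e \<ominus>\<^bsub>C' 1\<^esub> g \<in> cycle_span C' \<delta>' ys"
  proof (rule torsion_surjects[OF mc div[OF ysR]])
    show "exact_at C' \<delta>' (\<lambda>j. carrier (C' j)) j" if "j \<noteq> 0" for j
      unfolding carF by (rule exact'[OF coh]) (use that in simp)
    show "exact_at C' \<delta>' (\<lambda>j. power_torsion R (set ys) (C' j)) j" if "j \<noteq> 0" for j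
      unfolding torsG by (rule exact'[OF coregular_imp_exact[OF cor ex0]]) (use that in simp_all)
    show "e \<in> cycles C' \<delta>' (\<lambda>j. carrier (C' j)) 1" unfolding carF cyc using e by simp
  qed
  then obtain g where g: "g \<in> cycles C \<delta> (G r) (Suc r)" and eg: "e \<ominus>\<^bsub>C' 1\<^esub> g \<in> cycle_span C' \<delta>' ys"
    unfolding torsG cyc by auto
  have gG: "g \<in> G r (Suc r)" using g by (rule G.cycles_sub)
  \<comment> \<open>Every cycle is a multiple of \<open>e\<close> up to boundaries, so the span by
    elements of \<open>I\<close> lies in \<open>I e\<close> plus boundaries.\<close>
  have span: "\<exists>a\<in>I. u \<ominus>\<^bsub>C (Suc r)\<^esub> a \<odot>\<^bsub>C (Suc r)\<^esub> e \<in> \<delta> r ` F r r \<and> u \<in> F r (Suc r)"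
    if "set zs \<subseteq> I" "u \<in> cycle_span C' \<delta>' zs" for zs u
    using that
  proof (induction zs arbitrary: u)
    case Nil
    then obtain b where b: "b \<in> F r r" "u = \<delta> r b" by (auto simp: \<delta>'_def)
    then have "u \<ominus>\<^bsub>C (Suc r)\<^esub> \<zero> \<odot>\<^bsub>C (Suc r)\<^esub> e = \<delta> r b" using eF by (simp add: C.diff_eq_iff)
    moreover have "u \<in> F r (Suc r)" using b by (simp add: F.sub_d)
    ultimately show ?case using b(1) ideal_closed(1)[OF I] by blast
  next
    case (Cons y zs)
    have y: "y \<in> I" "y \<in> carrier R" using Cons(2) I_carrier by auto
    obtain z w where z: "z \<in> cycles C' \<delta>' (\<lambda>j. carrier (C' j)) 1" and w: "w \<in> cycle_span C' \<delta>' zs"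
      and u: "u = y \<odot>\<^bsub>C' 1\<^esub> z \<oplus>\<^bsub>C' 1\<^esub> w" using Cons(3) unfolding cycle_span.simps(2) by blast
    have z': "z \<in> cycles C \<delta> (F r) (Suc r)" using z unfolding carF cyc by simp
    have zF: "z \<in> F r (Suc r)" using z' by (rule F.cycles_sub)
    obtain b p where b: "b \<in> carrier R" "p \<in> F r r" "z \<ominus>\<^bsub>C (Suc r)\<^esub> b \<odot>\<^bsub>C (Suc r)\<^esub> e = \<delta> r p"
      using gen z' by blast
    have "set zs \<subseteq> I" using Cons(2) by simp
    then obtain a where a: "a \<in> I" "w \<ominus>\<^bsub>C (Suc r)\<^esub> a \<odot>\<^bsub>C (Suc r)\<^esub> e \<in> \<delta> r ` F r r" "w \<in> F r (Suc r)"
      using Cons.IH[OF _ w] by blast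
    obtain q where q: "q \<in> F r r" "w \<ominus>\<^bsub>C (Suc r)\<^esub> a \<odot>\<^bsub>C (Suc r)\<^esub> e = \<delta> r q" using a(2) by (elim imageE)
    have aR: "a \<in> carrier R" using a(1) I_carrier by blast
    have z_eq: "z = \<delta> r p \<oplus>\<^bsub>C (Suc r)\<^esub> b \<odot>\<^bsub>C (Suc r)\<^esub> e"
      using b zF eF by (simp add: C.diff_eq_iff)
    have w_eq: "w = \<delta> r q \<oplus>\<^bsub>C (Suc r)\<^esub> a \<odot>\<^bsub>C (Suc r)\<^esub> e"
      using q a(3) aR eF by (simp add: C.diff_eq_iff)
    have "u = y \<odot>\<^bsub>C (Suc r)\<^esub> z \<oplus>\<^bsub>C (Suc r)\<^esub> w" using u by simp
    then have "u \<ominus>\<^bsub>C (Suc r)\<^esub> (y \<otimes> b \<oplus> a) \<odot>\<^bsub>C (Suc r)\<^esub> e = \<delta> r (y \<odot>\<^bsub>C r\<^esub> p \<oplus>\<^bsub>C r\<^esub> q)"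
      unfolding z_eq w_eq using y(2) b(1,2) q(1) aR eF by (simp add: d_simps C.module_simps)
    moreover have "y \<odot>\<^bsub>C r\<^esub> p \<oplus>\<^bsub>C r\<^esub> q \<in> F r r" using y b q by (simp add: F.sub_closed)
    moreover have "y \<otimes> b \<oplus> a \<in> I" using y b a ideal_closed(3,7)[OF I] by simp
    moreover have "u \<in> F r (Suc r)" using u y zF a(3) by (simp add: F.sub_closed)
    ultimately show ?case by blast
  qed
  have "e \<ominus>\<^bsub>C' 1\<^esub> g = e \<ominus>\<^bsub>C (Suc r)\<^esub> g" using diff[of e 1 g] eF G_F[OF gG] by simp
  moreover have "set ys \<subseteq> I" unfolding Iys by (rule genideal_self[OF ysR])
  ultimately obtain a where a: "a \<in> I"
    "e \<ominus>\<^bsub>C (Suc r)\<^esub> g \<ominus>\<^bsub>C (Suc r)\<^esub> a \<odot>\<^bsub>C (Suc r)\<^esub> e \<in> \<delta> r ` F r r"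
    using span[OF _ eg] by metis
  obtain b where b: "b \<in> F r r" "e \<ominus>\<^bsub>C (Suc r)\<^esub> g \<ominus>\<^bsub>C (Suc r)\<^esub> a \<odot>\<^bsub>C (Suc r)\<^esub> e = \<delta> r b"
    using a(2) by (elim imageE)
  have aR: "a \<in> carrier R" using a(1) I_carrier by blast
  have "\<exists>n::nat. y [^] n \<otimes> (\<one> \<ominus> a) \<in> c r" if y: "y \<in> I" for y
  proof -
    have yR: "y \<in> carrier R" using y I_carrier by blast
    obtain n :: nat where n: "(y [^] n) \<odot>\<^bsub>C (Suc r)\<^esub> g = \<zero>\<^bsub>C (Suc r)\<^esub>" using G_torsion[OF gG y] by blast
    have yn: "y [^] n \<in> carrier R" using yR by simp
    \<comment> \<open>Modulo boundaries \<open>(\<one> \<ominus> a) \<odot> e\<close> is the torsion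
      cycle \<open>g\<close>, so a power of \<open>y\<close> makes it a boundary and
      \<open>free\<close> applies.\<close>
    have "(\<one> \<ominus> a) \<odot>\<^bsub>C (Suc r)\<^esub> e = \<delta> r b \<oplus>\<^bsub>C (Suc r)\<^esub> g"
    proof -
      have "(\<one> \<ominus> a) \<odot>\<^bsub>C (Suc r)\<^esub> e = (e \<ominus>\<^bsub>C (Suc r)\<^esub> g \<ominus>\<^bsub>C (Suc r)\<^esub> a \<odot>\<^bsub>C (Suc r)\<^esub> e) \<oplus>\<^bsub>C (Suc r)\<^esub> g"
        using eF gG aR by (simp add: C.module_simps)
      then show ?thesis unfolding b(2) .
    qed
    then have "(y [^] n \<otimes> (\<one> \<ominus> a)) \<odot>\<^bsub>C (Suc r)\<^esub> e = (y [^] n) \<odot>\<^bsub>C (Suc r)\<^esub> (\<delta> r b \<oplus>\<^bsub>C (Suc r)\<^esub> g)"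
      using yn aR eF by (simp add: C.smult_assoc1)
    also have "\<dots> = \<delta> r ((y [^] n) \<odot>\<^bsub>C r\<^esub> b)"
      using yn b(1) gG n by (simp add: C.smult_r_distr d_smult)
    finally have "(y [^] n \<otimes> (\<one> \<ominus> a)) \<odot>\<^bsub>C (Suc r)\<^esub> e = \<delta> r ((y [^] n) \<odot>\<^bsub>C r\<^esub> b)" .
    moreover have "(y [^] n) \<odot>\<^bsub>C r\<^esub> b \<in> F r r" using yn b(1) by (simp add: F.sub_smult)
    ultimately have "(y [^] n \<otimes> (\<one> \<ominus> a)) \<odot>\<^bsub>C (Suc r)\<^esub> e \<in> \<delta> r ` F r r" by (rule image_eqI)
    then have "y [^] n \<otimes> (\<one> \<ominus> a) \<in> c r" using free yn aR by simp
    then show ?thesis ..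
  qed
  then show ?thesis using a(1) by blast
qed

end

section \<open>Local cohomology as a quotient module\<close>

locale quotient = module R M for R (structure) and M :: "('a, 'm) module" (structure) +
  fixes N assumes sub: "submodule N R M"
begin

abbreviation "Q \<equiv> quotient_module M N"

lemma N_closed:
  shows "x \<in> N \<Longrightarrow> x \<in> carrier M" "x \<in> N \<Longrightarrow> y \<in> N \<Longrightarrow> x \<oplus>\<^bsub>M\<^esub> y \<in> N"
    "x \<in> N \<Longrightarrow> y \<in> N \<Longrightarrow> x \<ominus>\<^bsub>M\<^esub> y \<in> N" "\<zero>\<^bsub>M\<^esub> \<in> N"
    "a \<in> carrier R \<Longrightarrow> x \<in> N \<Longrightarrow> a \<odot>\<^bsub>M\<^esub> x \<in> N"
  using submoduleE[OF sub] subgroup.one_closed[OF submodule.axioms(1)[OF sub]]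
  by (auto simp: a_minus_def)

lemma coset: "u \<in> N +>\<^bsub>M\<^esub> x \<longleftrightarrow> (\<exists>n\<in>N. u = n \<oplus>\<^bsub>M\<^esub> x)"
  by (auto simp: a_r_coset_def')

lemma coset_eq:
  assumes "x \<in> carrier M" "y \<in> carrier M"
  shows "N +>\<^bsub>M\<^esub> x = N +>\<^bsub>M\<^esub> y \<longleftrightarrow> x \<ominus>\<^bsub>M\<^esub> y \<in> N"
proof
  assume "N +>\<^bsub>M\<^esub> x = N +>\<^bsub>M\<^esub> y"
  moreover have "x \<in> N +>\<^bsub>M\<^esub> x" unfolding coset using N_closed(4) assms by force
  ultimately have "x \<in> N +>\<^bsub>M\<^esub> y" by simp
  then obtain n where "n \<in> N" "x = n \<oplus>\<^bsub>M\<^esub> y" unfolding coset by blast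
  moreover from this have "x \<ominus>\<^bsub>M\<^esub> y = n" using assms N_closed(1) by (simp add: diff_eq_iff)
  ultimately show "x \<ominus>\<^bsub>M\<^esub> y \<in> N" by simp
next
  have sub: "N +>\<^bsub>M\<^esub> x \<subseteq> N +>\<^bsub>M\<^esub> y" if "x \<ominus>\<^bsub>M\<^esub> y \<in> N" "x \<in> carrier M" "y \<in> carrier M" for x y
  proof
    fix u assume "u \<in> N +>\<^bsub>M\<^esub> x"
    then obtain n where n: "n \<in> N" "u = n \<oplus>\<^bsub>M\<^esub> x" unfolding coset by blast
    then have "u = (n \<oplus>\<^bsub>M\<^esub> (x \<ominus>\<^bsub>M\<^esub> y)) \<oplus>\<^bsub>M\<^esub> y" using that N_closed(1) by (simp add: module_simps)
    then show "u \<in> N +>\<^bsub>M\<^esub> y" unfolding coset using N_closed(2)[OF n(1) that(1)] by blast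
  qed
  assume xy: "x \<ominus>\<^bsub>M\<^esub> y \<in> N"
  have "y \<ominus>\<^bsub>M\<^esub> x = \<zero>\<^bsub>M\<^esub> \<ominus>\<^bsub>M\<^esub> (x \<ominus>\<^bsub>M\<^esub> y)" using assms by (simp add: module_simps)
  then have "y \<ominus>\<^bsub>M\<^esub> x \<in> N" using N_closed(3)[OF N_closed(4) xy] by simp
  then show "N +>\<^bsub>M\<^esub> x = N +>\<^bsub>M\<^esub> y" using sub xy assms by blast
qed

lemma coset_zero: "N +>\<^bsub>M\<^esub> \<zero>\<^bsub>M\<^esub> = N"
proof -
  have "n \<oplus>\<^bsub>M\<^esub> \<zero>\<^bsub>M\<^esub> = n" if "n \<in> N" for n using N_closed(1)[OF that] by simp
  then show ?thesis by (auto simp: coset)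
qed

lemma coset_eq_zero: "x \<in> carrier M \<Longrightarrow> N +>\<^bsub>M\<^esub> x = N \<longleftrightarrow> x \<in> N"
  using coset_eq[of x "\<zero>\<^bsub>M\<^esub>"] coset_zero diff_eq_iff[of x "\<zero>\<^bsub>M\<^esub>" x] by simp

lemma quotient_simps:
  "carrier Q = (\<lambda>x. N +>\<^bsub>M\<^esub> x) ` carrier M" "\<zero>\<^bsub>Q\<^esub> = N"
  by (auto simp: quotient_module_def A_RCOSETS_def')

lemma quotient_add:
  assumes "x \<in> carrier M" "y \<in> carrier M"
  shows "(N +>\<^bsub>M\<^esub> x) \<oplus>\<^bsub>Q\<^esub> (N +>\<^bsub>M\<^esub> y) = N +>\<^bsub>M\<^esub> (x \<oplus>\<^bsub>M\<^esub> y)"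
proof -
  have "(N +>\<^bsub>M\<^esub> x) <+>\<^bsub>M\<^esub> (N +>\<^bsub>M\<^esub> y) = N +>\<^bsub>M\<^esub> (x \<oplus>\<^bsub>M\<^esub> y)"
  proof
    show "(N +>\<^bsub>M\<^esub> x) <+>\<^bsub>M\<^esub> (N +>\<^bsub>M\<^esub> y) \<subseteq> N +>\<^bsub>M\<^esub> (x \<oplus>\<^bsub>M\<^esub> y)"
    proof
      fix u assume "u \<in> (N +>\<^bsub>M\<^esub> x) <+>\<^bsub>M\<^esub> (N +>\<^bsub>M\<^esub> y)"
      then obtain n n' where n: "n \<in> N" "n' \<in> N" "u = (n \<oplus>\<^bsub>M\<^esub> x) \<oplus>\<^bsub>M\<^esub> (n' \<oplus>\<^bsub>M\<^esub> y)"
        unfolding set_add_def' by (auto simp: coset)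
      then have "u = (n \<oplus>\<^bsub>M\<^esub> n') \<oplus>\<^bsub>M\<^esub> (x \<oplus>\<^bsub>M\<^esub> y)" using assms N_closed(1) by (simp add: M.a_ac)
      then show "u \<in> N +>\<^bsub>M\<^esub> (x \<oplus>\<^bsub>M\<^esub> y)" unfolding coset using N_closed(2) n by blast
    qed
    show "N +>\<^bsub>M\<^esub> (x \<oplus>\<^bsub>M\<^esub> y) \<subseteq> (N +>\<^bsub>M\<^esub> x) <+>\<^bsub>M\<^esub> (N +>\<^bsub>M\<^esub> y)"
    proof
      fix u assume "u \<in> N +>\<^bsub>M\<^esub> (x \<oplus>\<^bsub>M\<^esub> y)"
      then obtain n where n: "n \<in> N" "u = n \<oplus>\<^bsub>M\<^esub> (x \<oplus>\<^bsub>M\<^esub> y)" unfolding coset by blast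
      then have "u = (n \<oplus>\<^bsub>M\<^esub> x) \<oplus>\<^bsub>M\<^esub> (\<zero>\<^bsub>M\<^esub> \<oplus>\<^bsub>M\<^esub> y)" using assms N_closed(1) by (simp add: M.a_ac)
      moreover have "n \<oplus>\<^bsub>M\<^esub> x \<in> N +>\<^bsub>M\<^esub> x" "\<zero>\<^bsub>M\<^esub> \<oplus>\<^bsub>M\<^esub> y \<in> N +>\<^bsub>M\<^esub> y"
        unfolding coset using n(1) N_closed(4) by blast+
      ultimately show "u \<in> (N +>\<^bsub>M\<^esub> x) <+>\<^bsub>M\<^esub> (N +>\<^bsub>M\<^esub> y)" unfolding set_add_def' by blast
    qed
  qed
  then show ?thesis by (simp add: quotient_module_def)
qed

lemma quotient_smult:
  assumes a: "a \<in> carrier R" and x: "x \<in> carrier M"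
  shows "a \<odot>\<^bsub>Q\<^esub> (N +>\<^bsub>M\<^esub> x) = N +>\<^bsub>M\<^esub> (a \<odot>\<^bsub>M\<^esub> x)"
proof -
  \<comment> \<open>All representatives yield the same coset, so the union that defines scalar
    multiplication collapses to one coset.\<close>
  have "N +>\<^bsub>M\<^esub> (a \<odot>\<^bsub>M\<^esub> u) = N +>\<^bsub>M\<^esub> (a \<odot>\<^bsub>M\<^esub> x)" if u: "u \<in> N +>\<^bsub>M\<^esub> x" for u
  proof -
    obtain n where n: "n \<in> N" "u = n \<oplus>\<^bsub>M\<^esub> x" using u unfolding coset by blast
    then have "a \<odot>\<^bsub>M\<^esub> u \<ominus>\<^bsub>M\<^esub> a \<odot>\<^bsub>M\<^esub> x = a \<odot>\<^bsub>M\<^esub> n"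
      using a x N_closed(1) by (simp add: module_simps)
    then show ?thesis using n a x N_closed(1,5) by (subst coset_eq) simp_all
  qed
  moreover have "x \<in> N +>\<^bsub>M\<^esub> x" unfolding coset using N_closed(4) x by force
  ultimately have "(\<Union>u\<in>N +>\<^bsub>M\<^esub> x. N +>\<^bsub>M\<^esub> (a \<odot>\<^bsub>M\<^esub> u)) = N +>\<^bsub>M\<^esub> (a \<odot>\<^bsub>M\<^esub> x)" by blast
  then show ?thesis by (simp add: quotient_module_def)
qed

lemma module_quotient: "module R Q"
proof -
  have E: "\<exists>x\<in>carrier M. X = N +>\<^bsub>M\<^esub> x" if "X \<in> carrier Q" for X
    using that by (auto simp: quotient_simps)
  have I: "N +>\<^bsub>M\<^esub> x \<in> carrier Q" if "x \<in> carrier M" for x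
    using that by (auto simp: quotient_simps)
  have zero: "\<zero>\<^bsub>Q\<^esub> = N +>\<^bsub>M\<^esub> \<zero>\<^bsub>M\<^esub>" by (simp add: quotient_simps(2) coset_zero)
  have "abelian_group Q"
  proof (rule abelian_groupI)
    show "\<zero>\<^bsub>Q\<^esub> \<in> carrier Q" unfolding zero by (rule I) simp
    fix X assume X: "X \<in> carrier Q"
    obtain x where x: "x \<in> carrier M" "X = N +>\<^bsub>M\<^esub> x" using E[OF X] by blast
    show "\<zero>\<^bsub>Q\<^esub> \<oplus>\<^bsub>Q\<^esub> X = X" unfolding zero x(2) using x(1) by (simp add: quotient_add)
    show "\<exists>Y\<in>carrier Q. Y \<oplus>\<^bsub>Q\<^esub> X = \<zero>\<^bsub>Q\<^esub>"
      unfolding zero x(2)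
      by (rule bexI[OF _ I[of "\<ominus>\<^bsub>M\<^esub> x"]]) (use x(1) in \<open>simp_all add: quotient_add M.l_neg\<close>)
    fix Y assume Y: "Y \<in> carrier Q"
    obtain y where y: "y \<in> carrier M" "Y = N +>\<^bsub>M\<^esub> y" using E[OF Y] by blast
    show "X \<oplus>\<^bsub>Q\<^esub> Y \<in> carrier Q" unfolding x(2) y(2) using x(1) y(1) I by (simp add: quotient_add)
    show "X \<oplus>\<^bsub>Q\<^esub> Y = Y \<oplus>\<^bsub>Q\<^esub> X"
      unfolding x(2) y(2) using x(1) y(1) M.a_comm[of x y] by (simp add: quotient_add)
    fix Z assume Z: "Z \<in> carrier Q"
    obtain z where z: "z \<in> carrier M" "Z = N +>\<^bsub>M\<^esub> z" using E[OF Z] by blast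
    show "X \<oplus>\<^bsub>Q\<^esub> Y \<oplus>\<^bsub>Q\<^esub> Z = X \<oplus>\<^bsub>Q\<^esub> (Y \<oplus>\<^bsub>Q\<^esub> Z)"
      unfolding x(2) y(2) z(2) using x(1) y(1) z(1) by (simp add: quotient_add M.a_assoc)
  qed
  then show ?thesis
  proof (rule moduleI[OF R.is_cring])
    fix a X assume a: "a \<in> carrier R" and X: "X \<in> carrier Q"
    obtain x where x: "x \<in> carrier M" "X = N +>\<^bsub>M\<^esub> x" using E[OF X] by blast
    show "a \<odot>\<^bsub>Q\<^esub> X \<in> carrier Q" unfolding x(2) using a x(1) I by (simp add: quotient_smult)
    fix b assume b: "b \<in> carrier R"
    show "(a \<oplus> b) \<odot>\<^bsub>Q\<^esub> X = a \<odot>\<^bsub>Q\<^esub> X \<oplus>\<^bsub>Q\<^esub> b \<odot>\<^bsub>Q\<^esub> X"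
      unfolding x(2) using a b x(1) by (simp add: quotient_smult quotient_add smult_l_distr)
    show "(a \<otimes> b) \<odot>\<^bsub>Q\<^esub> X = a \<odot>\<^bsub>Q\<^esub> (b \<odot>\<^bsub>Q\<^esub> X)"
      unfolding x(2) using a b x(1) by (simp add: quotient_smult smult_assoc1)
  next
    fix a X Y assume a: "a \<in> carrier R" and XY: "X \<in> carrier Q" "Y \<in> carrier Q"
    obtain x where x: "x \<in> carrier M" "X = N +>\<^bsub>M\<^esub> x" using E[OF XY(1)] by blast
    obtain y where y: "y \<in> carrier M" "Y = N +>\<^bsub>M\<^esub> y" using E[OF XY(2)] by blast
    show "a \<odot>\<^bsub>Q\<^esub> (X \<oplus>\<^bsub>Q\<^esub> Y) = a \<odot>\<^bsub>Q\<^esub> X \<oplus>\<^bsub>Q\<^esub> a \<odot>\<^bsub>Q\<^esub> Y"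
      unfolding x(2) y(2) using a x(1) y(1) by (simp add: quotient_smult quotient_add smult_r_distr)
  next
    fix X assume X: "X \<in> carrier Q"
    obtain x where x: "x \<in> carrier M" "X = N +>\<^bsub>M\<^esub> x" using E[OF X] by blast
    show "\<one> \<odot>\<^bsub>Q\<^esub> X = X" unfolding x(2) using x(1) by (simp add: quotient_smult)
  qed
qed

lemma zero_module_quotient: "zero_module Q \<longleftrightarrow> carrier M \<subseteq> N"
proof -
  have "zero_module Q \<longleftrightarrow> (\<forall>x\<in>carrier M. N +>\<^bsub>M\<^esub> x = N)"
    unfolding zero_module_def quotient_simps using coset_zero M.zero_closed by blast
  then show ?thesis using coset_eq_zero by blast
qed

end

text \<open>One inclusion is automatic, so only surjectivity remains. With \<open>f\<close> the
  coset map and \<open>g\<close> multiplication by an entry, this brings coregularity down to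
  representatives.\<close>

lemma image_image_eq_iff:
  assumes "\<And>z. z \<in> A \<Longrightarrow> g z \<in> A"
  shows "f ` g ` A = f ` A \<longleftrightarrow> (\<forall>z\<in>A. \<exists>z'\<in>A. f z = f (g z'))"
  using assms by (fastforce simp: image_iff)

context torsion_resolution
begin

text \<open>\<open>G 0\<close> is the \<open>I\<close>-torsion of the resolution, whose term of
  index \<open>i\<close> sits in degree \<open>Suc i\<close>. For \<open>i = 0\<close> the image of
  \<open>\<delta> 0\<close> is zero, so boundaries need no case distinction.\<close>

definition "H i = quotient_module ((C (Suc i))\<lparr>carrier := cycles C \<delta> (G 0) (Suc i)\<rparr>) (\<delta> i ` G 0 i)"

abbreviation "Z i \<equiv> (C (Suc i))\<lparr>carrier := cycles C \<delta> (G 0) (Suc i)\<rparr>"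

lemma submodule_cycles: "submodule (cycles C \<delta> (G 0) j) R (C j)"
proof (rule C.submoduleI)
  show "cycles C \<delta> (G 0) j \<subseteq> carrier (C j)" using G.cycles_sub G.sub_carrier by blast
  show z: "\<zero>\<^bsub>C j\<^esub> \<in> cycles C \<delta> (G 0) j" by (simp add: cycles_def G.sub_zero)
  show "\<ominus>\<^bsub>C j\<^esub> a \<in> cycles C \<delta> (G 0) j" if "a \<in> cycles C \<delta> (G 0) j" for a
    using G.cycles_closed(2)[OF z that] G.cycles_sub[OF that] by (simp add: a_minus_def)
qed (auto intro: G.cycles_closed)

lemma module_Z: "module R (Z i)"
  by (rule submodule.submodule_is_module[OF submodule_cycles modules])

lemma quotient_H: "quotient R (Z i) (\<delta> i ` G 0 i)"
proof (intro quotient.intro quotient_axioms.intro module_Z)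
  interpret Z: module R "Z i" by (rule module_Z)
  have c: "\<delta> i ` G 0 i \<subseteq> cycles C \<delta> (G 0) (Suc i)" using G.d_cycle by blast
  show "submodule (\<delta> i ` G 0 i) R (Z i)"
  proof (rule Z.submoduleI)
    show "\<delta> i ` G 0 i \<subseteq> carrier (Z i)" using c by simp
    show "\<zero>\<^bsub>Z i\<^esub> \<in> \<delta> i ` G 0 i" 
      using image_eqI[of _ "\<delta> i" "\<zero>\<^bsub>C i\<^esub>" "G 0 i"] G.sub_zero by simp
    show s: "a \<odot>\<^bsub>Z i\<^esub> x \<in> \<delta> i ` G 0 i" if a: "a \<in> carrier R" and x: "x \<in> \<delta> i ` G 0 i" for a x
    proof -
      obtain w where w: "w \<in> G 0 i" "x = \<delta> i w" using x by blast
      then have "a \<odot>\<^bsub>Z i\<^esub> x = \<delta> i (a \<odot>\<^bsub>C i\<^esub> w)" using a by (simp add: d_smult)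
      then show ?thesis using G.sub_smult[OF a w(1)] by (rule image_eqI)
    qed
    show "\<ominus>\<^bsub>Z i\<^esub> x \<in> \<delta> i ` G 0 i" if x: "x \<in> \<delta> i ` G 0 i" for x
      using s[OF _ x, of "\<ominus> \<one>"] Z.smult_l_minus[of \<one> x] subsetD[OF c x] Z.smult_one[of x] by simp
    show "x \<oplus>\<^bsub>Z i\<^esub> y \<in> \<delta> i ` G 0 i" if xy: "x \<in> \<delta> i ` G 0 i" "y \<in> \<delta> i ` G 0 i" for x y
    proof -
      obtain u w where w: "u \<in> G 0 i" "x = \<delta> i u" "w \<in> G 0 i" "y = \<delta> i w" using xy by blast
      then have "x \<oplus>\<^bsub>Z i\<^esub> y = \<delta> i (u \<oplus>\<^bsub>C i\<^esub> w)" by (simp add: d_add)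
      then show ?thesis using G.sub_add[OF w(1,3)] by (rule image_eqI)
    qed
  qed
qed

lemma zero_module_H: "zero_module (H i) \<longleftrightarrow> exact_at C \<delta> (G 0) i"
  unfolding H_def quotient.zero_module_quotient[OF quotient_H] exact_at_def by simp

text \<open>Some power of each element of \<open>I\<close> kills a given class, and a prime omitting
  an element of \<open>I\<close> omits its powers as well.\<close>

lemma support_H: "module_support R (H i) \<subseteq> prime_locus R I"
proof
  interpret Q: quotient R "Z i" "\<delta> i ` G 0 i" by (rule quotient_H)
  fix P assume "P \<in> module_support R (H i)"
  then obtain X where P: "primeideal P R" and X: "X \<in> carrier (H i)"
    and ann: "\<And>u. u \<in> carrier R - P \<Longrightarrow> u \<odot>\<^bsub>H i\<^esub> X \<noteq> \<zero>\<^bsub>H i\<^esub>"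
    unfolding module_support_def by blast
  interpret P: primeideal P R by fact
  obtain z where z: "z \<in> cycles C \<delta> (G 0) (Suc i)" "X = \<delta> i ` G 0 i +>\<^bsub>Z i\<^esub> z"
    using X unfolding H_def Q.quotient_simps by auto
  have "a \<in> P" if a: "a \<in> I" for a
  proof (rule ccontr)
    assume aP: "a \<notin> P"
    have aR: "a \<in> carrier R" using a I_carrier by blast
    obtain n :: nat where n: "(a [^] n) \<odot>\<^bsub>C (Suc i)\<^esub> z = \<zero>\<^bsub>C (Suc i)\<^esub>"
      using G_torsion[OF G.cycles_sub[OF z(1)] a] by blast
    have "a [^] k \<notin> P" for k :: nat
    proof (induction k)
      case 0
      show ?case using P.I_notcarr P.one_imp_carrier by auto
    next
      case (Suc k)
      then show ?case using P.I_prime[of "a [^] k" a] aP aR by auto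
    qed
    then have "(a [^] n) \<odot>\<^bsub>H i\<^esub> X \<noteq> \<zero>\<^bsub>H i\<^esub>" using ann aR by simp
    moreover have "(a [^] n) \<odot>\<^bsub>H i\<^esub> X = \<zero>\<^bsub>H i\<^esub>"
      unfolding H_def z(2) using Q.quotient_smult[of "a [^] n" z] aR z(1) n Q.coset_zero
      by (simp add: Q.quotient_simps)
    ultimately show False by blast
  qed
  then show "P \<in> prime_locus R I" using P unfolding prime_locus_def by blast
qed

text \<open>Colon and image conditions on cosets become conditions on cycles modulo boundaries.
  Torsion settles the support, so non-vanishing is the one further condition on the module.\<close>

lemma coregular_sequence_H:
  "coregular_sequence R I (H r) xs \<longleftrightarrow> coregular \<and> \<not> exact_at C \<delta> (G 0) r"
proof -
  interpret Q: quotient R "Z r" "\<delta> r ` G 0 r" by (rule quotient_H)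
  interpret H: module R "H r" unfolding H_def by (rule Q.module_quotient)
  let ?B = "\<delta> r ` G 0 r"
  let ?cl = "\<lambda>z. ?B +>\<^bsub>Z r\<^esub> z"
  \<comment> \<open>The cycles representing the submodule of \<open>H r\<close> killed by the first
    \<open>k\<close> entries; it suffices to test generators of the ideal.\<close>
  define W where "W k = {z \<in> cycles C \<delta> (G 0) (Suc r). \<forall>i<k. (xs ! i) \<odot>\<^bsub>C (Suc r)\<^esub> z \<in> ?B}" for k
  have smult: "a \<odot>\<^bsub>H r\<^esub> ?cl z = ?cl (a \<odot>\<^bsub>C (Suc r)\<^esub> z)"
    if "a \<in> carrier R" "z \<in> cycles C \<delta> (G 0) (Suc r)" for a z
    using Q.quotient_smult[of a z] that unfolding H_def by simp
  have cyc: "a \<odot>\<^bsub>C (Suc r)\<^esub> z \<in> cycles C \<delta> (G 0) (Suc r)"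
    if "a \<in> carrier R" "z \<in> cycles C \<delta> (G 0) (Suc r)" for a z
    using G.cycles_closed(3)[OF that(2,1)] .
  have eq0: "?cl z = \<zero>\<^bsub>H r\<^esub> \<longleftrightarrow> z \<in> ?B" if "z \<in> cycles C \<delta> (G 0) (Suc r)" for z
    using Q.coset_eq_zero[of z] that unfolding H_def Q.quotient_simps(2) by simp
  have eq: "?cl z = ?cl z' \<longleftrightarrow> z \<ominus>\<^bsub>C (Suc r)\<^esub> z' \<in> ?B"
    if "z \<in> cycles C \<delta> (G 0) (Suc r)" "z' \<in> cycles C \<delta> (G 0) (Suc r)" for z z'
    using Q.coset_eq[of z z'] that C.submodule_diff[OF submodule_cycles that] by simp
  have carH: "carrier (H r) = ?cl ` cycles C \<delta> (G 0) (Suc r)"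
    unfolding H_def Q.quotient_simps by simp
  have colon: "colon_zero (H r) (Idl (set (take k xs))) = ?cl ` W k" if k: "k \<le> r" for k
  proof -
    have "?cl z \<in> colon_zero (H r) (Idl (set (take k xs))) \<longleftrightarrow> (\<forall>i<k. (xs ! i) \<odot>\<^bsub>C (Suc r)\<^esub> z \<in> ?B)"
      if z: "z \<in> cycles C \<delta> (G 0) (Suc r)" for z
    proof -
      have clz: "?cl z \<in> carrier (H r)" using z unfolding carH by blast
      have "?cl z \<in> colon_zero (H r) (Idl (set (take k xs))) \<longleftrightarrow>
          (\<forall>a\<in>set (take k xs). a \<odot>\<^bsub>H r\<^esub> ?cl z = \<zero>\<^bsub>H r\<^esub>)"
        unfolding colon_zero_def using H.colon_genideal[OF take_carrier clz] clz by simp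
      also have "\<dots> \<longleftrightarrow> (\<forall>i<k. (xs ! i) \<odot>\<^bsub>H r\<^esub> ?cl z = \<zero>\<^bsub>H r\<^esub>)"
        using k by (auto simp flip: nth_image)
      also have "\<dots> \<longleftrightarrow> (\<forall>i<k. (xs ! i) \<odot>\<^bsub>C (Suc r)\<^esub> z \<in> ?B)"
      proof -
        have "(xs ! i) \<odot>\<^bsub>H r\<^esub> ?cl z = \<zero>\<^bsub>H r\<^esub> \<longleftrightarrow> (xs ! i) \<odot>\<^bsub>C (Suc r)\<^esub> z \<in> ?B" if "i < k" for i
          using smult eq0 cyc z xs_carrier(2)[of i] that k by simp
        then show ?thesis by blast
      qed
      finally show ?thesis .
    qed
    moreover have "colon_zero (H r) (Idl (set (take k xs))) \<subseteq> ?cl ` cycles C \<delta> (G 0) (Suc r)"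
      unfolding colon_zero_def carH by blast
    ultimately show ?thesis unfolding W_def by blast
  qed
  have image: "(\<lambda>m. (xs ! k) \<odot>\<^bsub>H r\<^esub> m) ` (?cl ` W k) = ?cl ` W k \<longleftrightarrow>
      (\<forall>z\<in>W k. \<exists>z'\<in>W k. z \<ominus>\<^bsub>C (Suc r)\<^esub> (xs ! k) \<odot>\<^bsub>C (Suc r)\<^esub> z' \<in> ?B)" if k: "k < r" for k
  proof -
    note xk = xs_carrier(2)[OF k]
    have Wc: "z \<in> cycles C \<delta> (G 0) (Suc r)" if "z \<in> W k" for z using that by (simp add: W_def)
    have xW: "(xs ! k) \<odot>\<^bsub>C (Suc r)\<^esub> z \<in> W k" if z: "z \<in> W k" for z
    proof -
      have zM: "z \<in> carrier (C (Suc r))" using G.cycles_sub[OF Wc[OF z]] by simp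
      have "(xs ! i) \<odot>\<^bsub>C (Suc r)\<^esub> ((xs ! k) \<odot>\<^bsub>C (Suc r)\<^esub> z) \<in> ?B" if i: "i < k" for i
      proof -
        have xi: "xs ! i \<in> carrier R" using xs_carrier(2)[of i] i k by simp
        have "(xs ! i) \<odot>\<^bsub>C (Suc r)\<^esub> z \<in> ?B" using z i by (simp add: W_def)
        then have "(xs ! k) \<odot>\<^bsub>C (Suc r)\<^esub> ((xs ! i) \<odot>\<^bsub>C (Suc r)\<^esub> z) \<in> ?B"
          using Q.N_closed(5)[OF xk, of "(xs ! i) \<odot>\<^bsub>C (Suc r)\<^esub> z"] by simp
        then show ?thesis using C.smult_lcomm[OF xi xk zM] by simp
      qed
      then show ?thesis unfolding W_def using cyc[OF xk Wc[OF z]] by blast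
    qed
    have im: "(\<lambda>m. (xs ! k) \<odot>\<^bsub>H r\<^esub> m) ` (?cl ` W k) = ?cl ` (\<lambda>z. (xs ! k) \<odot>\<^bsub>C (Suc r)\<^esub> z) ` W k"
      unfolding image_image by (rule image_cong[OF refl]) (use smult xk Wc in blast)
    have "(\<lambda>m. (xs ! k) \<odot>\<^bsub>H r\<^esub> m) ` (?cl ` W k) = ?cl ` W k \<longleftrightarrow>
        (\<forall>z\<in>W k. \<exists>z'\<in>W k. ?cl z = ?cl ((xs ! k) \<odot>\<^bsub>C (Suc r)\<^esub> z'))"
      unfolding im by (rule image_image_eq_iff) (rule xW)
    also have "\<dots> \<longleftrightarrow> (\<forall>z\<in>W k. \<exists>z'\<in>W k. z \<ominus>\<^bsub>C (Suc r)\<^esub> (xs ! k) \<odot>\<^bsub>C (Suc r)\<^esub> z' \<in> ?B)"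
      using eq Wc xW by (intro ball_cong bex_cong refl) blast
    finally show ?thesis .
  qed
  have "(\<forall>k<r. (\<lambda>m. (xs ! k) \<odot>\<^bsub>H r\<^esub> m) ` colon_zero (H r) (Idl (set (take k xs))) =
      colon_zero (H r) (Idl (set (take k xs)))) \<longleftrightarrow>
    (\<forall>k<r. \<forall>z\<in>W k. \<exists>z'\<in>W k. z \<ominus>\<^bsub>C (Suc r)\<^esub> (xs ! k) \<odot>\<^bsub>C (Suc r)\<^esub> z' \<in> ?B)"
    using colon image by simp
  also have "\<dots> \<longleftrightarrow> coregular"
    unfolding coregular_def W_def by blast
  finally show ?thesis
    unfolding coregular_sequence_def
    using I H.module_axioms zero_module_H[of r] support_H[of r] xs_I by blast
qed

text \<open>The hypothesis \<open>nilpotent\<close> isolates what the local and the graded case each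
  have to supply: removing the factor \<open>\<one> \<ominus> a\<close>.\<close>

lemma coregular_sequence_iff:
  assumes nilpotent: "\<And>a. I \<noteq> carrier R \<Longrightarrow> a \<in> I \<Longrightarrow>
      \<forall>y\<in>I. \<exists>n::nat. y [^] n \<otimes> (\<one> \<ominus> a) \<in> Idl (set xs) \<Longrightarrow>
      \<forall>y\<in>I. \<exists>n::nat. y [^] n \<in> Idl (set xs)"
  shows "radical R I = radical R (Idl (set xs)) \<longleftrightarrow>
    coregular_sequence R I (H r) xs \<and> (\<forall>i>r. zero_module (H i))"
proof -
  have cr: "c r = Idl (set xs)" by (simp add: c_def)
  have "radical R I = radical R (Idl (set xs)) \<longleftrightarrow> (\<forall>y\<in>I. \<exists>n::nat. y [^] n \<in> c r)"
  proof
    assume rad: "radical R I = radical R (Idl (set xs))"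
    have "y \<in> radical R I" if "y \<in> I" for y
      using that I_carrier by (auto simp: radical_def intro!: exI[of _ "1::nat"])
    then show "\<forall>y\<in>I. \<exists>n::nat. y [^] n \<in> c r" unfolding rad cr by (auto simp: radical_def)
  next
    assume nil: "\<forall>y\<in>I. \<exists>n::nat. y [^] n \<in> c r"
    have "Idl (set xs) \<subseteq> I" by (rule genideal_minimal[OF I xs_I])
    then have "radical R (Idl (set xs)) \<subseteq> radical R I" unfolding radical_def by blast
    moreover have "radical R I \<subseteq> radical R (Idl (set xs))"
    proof
      fix a assume "a \<in> radical R I"
      then obtain n :: nat where a: "a \<in> carrier R" "a [^] n \<in> I" unfolding radical_def by blast
      then obtain m :: nat where "(a [^] n) [^] m \<in> c r" using nil by blast
      then show "a \<in> radical R (Idl (set xs))"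
        using a(1) unfolding radical_def cr by (auto simp: nat_pow_pow)
    qed
    ultimately show "radical R I = radical R (Idl (set xs))" by blast
  qed
  also have "\<dots> \<longleftrightarrow> coregular \<and> \<not> exact_at C \<delta> (G 0) r \<and> (\<forall>i>r. exact_at C \<delta> (G 0) i)"
  proof
    assume nil: "\<forall>y\<in>I. \<exists>n::nat. y [^] n \<in> c r"
    then have rad: "\<exists>n::nat. y [^] n \<in> c r" if "y \<in> I" for y using that by blast
    show "coregular \<and> \<not> exact_at C \<delta> (G 0) r \<and> (\<forall>i>r. exact_at C \<delta> (G 0) i)"
      using radical_imp_coregular[OF rad] unfolding exact_at_def by blast
  next
    assume *: "coregular \<and> \<not> exact_at C \<delta> (G 0) r \<and> (\<forall>i>r. exact_at C \<delta> (G 0) i)"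
    \<comment> \<open>If \<open>\<one>\<close> were in \<open>I\<close>, the only torsion element
      would be zero and \<open>H r\<close> would vanish, against the non-vanishing contained in
      coregularity.\<close>
    have "I \<noteq> carrier R"
    proof
      assume IR: "I = carrier R"
      have "z \<in> \<delta> r ` G 0 r" if z: "z \<in> cycles C \<delta> (G 0) (Suc r)" for z
      proof -
        have zG: "z \<in> G 0 (Suc r)" using z by (rule G.cycles_sub)
        obtain n :: nat where "(\<one> [^] n) \<odot>\<^bsub>C (Suc r)\<^esub> z = \<zero>\<^bsub>C (Suc r)\<^esub>"
          using G_torsion[OF zG, of \<one>] IR by blast
        then have "z = \<delta> r \<zero>\<^bsub>C r\<^esub>" using zG by simp
        then show ?thesis using G.sub_zero by (rule image_eqI)
      qed
      then show False using * unfolding exact_at_def by blast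
    qed
    moreover obtain a where "a \<in> I" "\<forall>y\<in>I. \<exists>n::nat. y [^] n \<otimes> (\<one> \<ominus> a) \<in> c r"
      using coregular_imp_nilpotent * by blast
    ultimately show "\<forall>y\<in>I. \<exists>n::nat. y [^] n \<in> c r" using nilpotent unfolding cr by blast
  qed
  finally show ?thesis by (simp add: coregular_sequence_H zero_module_H)
qed

end

section \<open>Local and graded rings\<close>

text \<open>A maximal ideal containing \<open>\<one> \<ominus> a\<close> would be the unique one,
  which also contains \<open>I\<close> and hence \<open>a\<close> and \<open>\<one>\<close>. So
  \<open>\<one> \<ominus> a\<close> is a unit.\<close>

lemma local_ring_mult_cancel:
  assumes R: "noetherian_local_ring R" and I: "ideal I R" "I \<noteq> carrier R" and a: "a \<in> I"
    and J: "ideal J R" and b: "b \<in> carrier R" "b \<otimes>\<^bsub>R\<^esub> (\<one>\<^bsub>R\<^esub> \<ominus>\<^bsub>R\<^esub> a) \<in> J"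
  shows "b \<in> J"
proof -
  interpret noetherian_cring R
    using R by (simp add: noetherian_local_ring_def noetherian_cring_def)
  let ?u = "\<one>\<^bsub>R\<^esub> \<ominus>\<^bsub>R\<^esub> a"
  have aR: "a \<in> carrier R" using ideal_closed(2)[OF I(1) a] .
  then have uR: "?u \<in> carrier R" by simp
  have max: "\<exists>m. maximalideal m R \<and> K \<subseteq> m" if K: "ideal K R" "K \<noteq> carrier R" for K
  proof -
    let ?F = "{Q. ideal Q R \<and> K \<subseteq> Q \<and> Q \<noteq> carrier R}"
    obtain m where m: "m \<in> ?F" and mm: "\<And>Q. Q \<in> ?F \<Longrightarrow> m \<subseteq> Q \<Longrightarrow> Q = m"
      by (rule maximal_in_ideal_family[of ?F]) (use K in auto)
    have "maximalideal m R"
    proof (rule maximalidealI)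
      show "ideal m R" "carrier R \<noteq> m" using m by auto
      fix Q assume Q: "ideal Q R" "m \<subseteq> Q" "Q \<subseteq> carrier R"
      then show "Q = m \<or> Q = carrier R" using mm[of Q] m by auto
    qed
    then show ?thesis using m by blast
  qed
  have "PIdl\<^bsub>R\<^esub> ?u = carrier R"
  proof (rule ccontr)
    assume "PIdl\<^bsub>R\<^esub> ?u \<noteq> carrier R"
    then obtain m where m: "maximalideal m R" "PIdl\<^bsub>R\<^esub> ?u \<subseteq> m"
      using max[OF cgenideal_ideal[OF uR]] by blast
    obtain m' where m': "maximalideal m' R" "I \<subseteq> m'" using max[OF I] by blast
    have mm': "m' = m" using R m(1) m'(1) unfolding noetherian_local_ring_def by blast
    have idm: "ideal m R" using m(1) by (rule maximalideal.axioms(1))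
    have "?u \<in> m" "a \<in> m" using m(2) cgenideal_self[OF uR] m'(2) mm' a by auto
    then have "?u \<oplus>\<^bsub>R\<^esub> a \<in> m" using ideal_closed(3)[OF idm] by blast
    moreover have "?u \<oplus>\<^bsub>R\<^esub> a = \<one>\<^bsub>R\<^esub>" using aR by (simp add: a_minus_def a_assoc l_neg)
    ultimately have "m = carrier R" using ideal.one_imp_carrier[OF idm] by simp
    then show False using maximalideal.I_notcarr[OF m(1)] by simp
  qed
  then obtain v where v: "v \<in> carrier R" "\<one>\<^bsub>R\<^esub> = v \<otimes>\<^bsub>R\<^esub> ?u"
    using one_closed unfolding cgenideal_def by blast
  have "b = v \<otimes>\<^bsub>R\<^esub> (b \<otimes>\<^bsub>R\<^esub> ?u)"
  proof -
    have "v \<otimes>\<^bsub>R\<^esub> (b \<otimes>\<^bsub>R\<^esub> ?u) = b \<otimes>\<^bsub>R\<^esub> (v \<otimes>\<^bsub>R\<^esub> ?u)" using v(1) b(1) uR by (simp add: m_lcomm)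
    then show ?thesis using b(1) by (simp flip: v(2))
  qed
  then show ?thesis using ideal_closed(6)[OF J v(1) b(2)] by simp
qed

section \<open>Homogeneous components in graded rings\<close>

locale graded_ring = cring R for R (structure) +
  fixes \<A> :: "nat \<Rightarrow> 'a set"
  assumes grading: "ring_grading R \<A>"
begin

lemma A_subgroup: "additive_subgroup (\<A> n) R"
  using grading by (simp add: ring_grading_def)

lemma A_carrier [simp]: "a \<in> \<A> n \<Longrightarrow> a \<in> carrier R"
  using additive_subgroup.a_Hcarr[OF A_subgroup] .

lemma A_zero [simp]: "\<zero> \<in> \<A> n"
  using additive_subgroup.zero_closed[OF A_subgroup] .

lemma A_add: "a \<in> \<A> n \<Longrightarrow> b \<in> \<A> n \<Longrightarrow> a \<oplus> b \<in> \<A> n"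
  using additive_subgroup.a_closed[OF A_subgroup] .

lemma A_mult: "a \<in> \<A> m \<Longrightarrow> b \<in> \<A> n \<Longrightarrow> a \<otimes> b \<in> \<A> (m + n)"
  using grading by (simp add: ring_grading_def)

definition "decomposes f a \<longleftrightarrow>
  (\<forall>n. f n \<in> \<A> n) \<and> finite {n. f n \<noteq> \<zero>} \<and> a = finsum R f {n. f n \<noteq> \<zero>}"

definition "component a = (THE f. decomposes f a)"

lemma decomposes_unique:
  assumes "a \<in> carrier R"
  shows "\<exists>!f. decomposes f a"
  using grading assms unfolding ring_grading_def decomposes_def by blast

lemma decomposes_component: "a \<in> carrier R \<Longrightarrow> decomposes (component a) a"
  unfolding component_def by (rule theI'[OF decomposes_unique])

lemma component_A: "a \<in> carrier R \<Longrightarrow> component a n \<in> \<A> n"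
  using decomposes_component unfolding decomposes_def by blast

lemma component_carrier: "a \<in> carrier R \<Longrightarrow> component a n \<in> carrier R"
  using component_A A_carrier by blast

text \<open>Any finite set containing the support may serve as index set, so decompositions with
  different supports can be compared over a common one.\<close>

lemma component_eqI:
  assumes f: "\<And>n. f n \<in> \<A> n" and S: "finite S" "\<And>n. n \<notin> S \<Longrightarrow> f n = \<zero>" and a: "a = finsum R f S"
  shows "component a = f"
proof -
  have fR: "f n \<in> carrier R" for n using f A_carrier by blast
  have "{n. f n \<noteq> \<zero>} \<subseteq> S" using S(2) by blast
  moreover have "finsum R f {n. f n \<noteq> \<zero>} = finsum R f S"
    by (rule add.finprod_mono_neutral_cong_left) (use S fR in auto)
  ultimately have "decomposes f a"
    unfolding decomposes_def using f a S(1) finite_subset by auto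
  moreover have "a \<in> carrier R" unfolding a using fR by (intro finsum_closed) auto
  ultimately show ?thesis using decomposes_unique decomposes_component by blast
qed

lemma component_support:
  assumes "a \<in> carrier R"
  obtains S where "finite S" "\<And>n. n \<notin> S \<Longrightarrow> component a n = \<zero>"
    "\<And>T. finite T \<Longrightarrow> S \<subseteq> T \<Longrightarrow> a = finsum R (component a) T"
proof
  let ?S = "{n. component a n \<noteq> \<zero>}"
  have dec: "finite ?S" "a = finsum R (component a) ?S"
    using decomposes_component[OF assms] unfolding decomposes_def by blast+
  show "finite ?S" by (rule dec(1))
  show "component a n = \<zero>" if "n \<notin> ?S" for n using that by simp
  show "a = finsum R (component a) T" if T: "finite T" "?S \<subseteq> T" for T
  proof -
    have "finsum R (component a) ?S = finsum R (component a) T"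
      by (rule add.finprod_mono_neutral_cong_left) (use T component_carrier[OF assms] in auto)
    then show ?thesis using dec(2) by simp
  qed
qed

lemma component_homogeneous: "a \<in> \<A> m \<Longrightarrow> component a = (\<lambda>n. if n = m then a else \<zero>)"
  by (rule component_eqI[where S = "{m}"]) auto

lemma component_zero: "component \<zero> n = \<zero>"
  using component_homogeneous[of \<zero> n] by simp

lemma component_add:
  assumes a: "a \<in> carrier R" and b: "b \<in> carrier R"
  shows "component (a \<oplus> b) = (\<lambda>n. component a n \<oplus> component b n)"
proof -
  obtain S where S: "finite S" "\<And>n. n \<notin> S \<Longrightarrow> component a n = \<zero>"
    "\<And>T. finite T \<Longrightarrow> S \<subseteq> T \<Longrightarrow> a = finsum R (component a) T"
    using component_support[OF a] by blast
  obtain T where T: "finite T" "\<And>n. n \<notin> T \<Longrightarrow> component b n = \<zero>"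
    "\<And>U. finite U \<Longrightarrow> T \<subseteq> U \<Longrightarrow> b = finsum R (component b) U"
    using component_support[OF b] by blast
  show ?thesis
  proof (rule component_eqI)
    show "component a n \<oplus> component b n \<in> \<A> n" for n
      by (intro A_add component_A a b)
    show "finite (S \<union> T)" using S(1) T(1) by simp
    show "component a n \<oplus> component b n = \<zero>" if "n \<notin> S \<union> T" for n
      using S(2) T(2) that by simp
    have "finsum R (\<lambda>n. component a n \<oplus> component b n) (S \<union> T) =
        finsum R (component a) (S \<union> T) \<oplus> finsum R (component b) (S \<union> T)"
      by (rule finsum_addf) (use component_carrier a b in auto)
    then show "a \<oplus> b = finsum R (\<lambda>n. component a n \<oplus> component b n) (S \<union> T)"
      using S(3)[of "S \<union> T"] T(3)[of "S \<union> T"] S(1) T(1) by simp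
  qed
qed

lemma component_mult:
  assumes b: "b \<in> \<A> m" and a: "a \<in> carrier R"
  shows "component (b \<otimes> a) = (\<lambda>n. if m \<le> n then b \<otimes> component a (n - m) else \<zero>)"
proof -
  obtain S where S: "finite S" "\<And>n. n \<notin> S \<Longrightarrow> component a n = \<zero>"
    "\<And>T. finite T \<Longrightarrow> S \<subseteq> T \<Longrightarrow> a = finsum R (component a) T"
    using component_support[OF a] by blast
  have bR: "b \<in> carrier R" using b by simp
  note cR = component_carrier[OF a]
  show ?thesis
  proof (rule component_eqI)
    show "(if m \<le> n then b \<otimes> component a (n - m) else \<zero>) \<in> \<A> n" for n
      using A_mult[OF b component_A[OF a, of "n - m"]] by (cases "m \<le> n") simp_all
    show "finite ((\<lambda>n. n + m) ` S)" using S(1) by simp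
    show "(if m \<le> n then b \<otimes> component a (n - m) else \<zero>) = \<zero>" if n: "n \<notin> (\<lambda>n. n + m) ` S" for n
    proof (cases "m \<le> n")
      case True
      then have "n - m \<notin> S" using n by (metis image_eqI le_add_diff_inverse2)
      then show ?thesis using S(2) bR by simp
    qed simp
    have "b \<otimes> a = b \<otimes> finsum R (component a) S" using S(3)[OF S(1) order_refl] by simp
    also have "\<dots> = finsum R (\<lambda>n. b \<otimes> component a n) S"
      by (rule finsum_rdistr) (use S(1) bR cR in auto)
    also have "\<dots> = finsum R (\<lambda>n. if m \<le> n then b \<otimes> component a (n - m) else \<zero>) ((\<lambda>n. n + m) ` S)"
      by (subst finsum_reindex) (use bR cR in \<open>auto simp: inj_on_def\<close>)
    finally show "b \<otimes> a = finsum R (\<lambda>n. if m \<le> n then b \<otimes> component a (n - m) else \<zero>) ((\<lambda>n. n + m) ` S)" .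
  qed
qed

text \<open>The elements whose components all lie in \<open>Idl Y\<close> form an ideal containing
  \<open>Y\<close>. Closure under multiplication is clear for homogeneous factors, which shift
  components, and follows for others by decomposing the factor.\<close>

lemma component_genideal:
  assumes Y: "Y \<subseteq> carrier R" "\<And>y. y \<in> Y \<Longrightarrow> homogeneous_element \<A> y" and s: "s \<in> Idl Y"
  shows "component s n \<in> Idl Y"
proof -
  let ?J = "{s \<in> carrier R. \<forall>n. component s n \<in> Idl Y}"
  have idY: "ideal (Idl Y) R" by (rule genideal_ideal[OF Y(1)])
  note Yc = ideal_closed[OF idY]
  have zero: "\<zero> \<in> ?J" using Yc(1) by (simp add: component_zero)
  have add: "a \<oplus> b \<in> ?J" if "a \<in> ?J" "b \<in> ?J" for a b
  proof -
    have ab: "a \<in> carrier R" "b \<in> carrier R" using that by simp_all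
    have "component (a \<oplus> b) n \<in> Idl Y" for n
      unfolding component_add[OF ab] by (rule Yc(3)) (use that in simp_all)
    then show ?thesis using ab by simp
  qed
  have homog: "b \<otimes> a \<in> ?J" if b: "b \<in> \<A> m" and a: "a \<in> ?J" for a b m
  proof -
    have aR: "a \<in> carrier R" using a by simp
    have "b \<otimes> component a k \<in> Idl Y" for k
      by (rule Yc(6)[OF A_carrier[OF b]]) (use a in simp)
    then have "component (b \<otimes> a) n \<in> Idl Y" for n
      unfolding component_mult[OF b aR] using Yc(1) by simp
    then show ?thesis using aR A_carrier[OF b] by simp
  qed
  have mult: "x \<otimes> a \<in> ?J" if x: "x \<in> carrier R" and a: "a \<in> ?J" for x a
  proof -
    obtain S where S: "finite S" "x = finsum R (component x) S"
      using decomposes_component[OF x] unfolding decomposes_def by blast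
    note cR = component_carrier[OF x]
    have aR: "a \<in> carrier R" using a by simp
    have sum: "finsum R (component x) T \<otimes> a \<in> ?J" if "finite T" for T
      using that
    proof induction
      case empty
      then show ?case using zero aR by simp
    next
      case (insert k T)
      have "finsum R (component x) (insert k T) \<otimes> a = component x k \<otimes> a \<oplus> finsum R (component x) T \<otimes> a"
        using insert cR aR by (simp add: l_distr finsum_closed)
      then show ?case using add[OF homog[OF component_A[OF x] a] insert.IH] by simp
    qed
    show ?thesis using sum[OF S(1)] unfolding S(2)[symmetric] .
  qed
  have "ideal ?J R"
  proof (rule idealI)
    show "ring R" by (rule ring_axioms)
    show "subgroup ?J (add_monoid R)"
    proof (rule add.subgroupI)
      show "?J \<subseteq> carrier R" "?J \<noteq> {}" using zero by auto
      show "\<ominus> a \<in> ?J" if "a \<in> ?J" for a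
        using mult[of "\<ominus> \<one>" a] that by (simp add: l_minus)
    qed (rule add)
    show "x \<otimes> a \<in> ?J" if "a \<in> ?J" "x \<in> carrier R" for a x by (rule mult[OF that(2,1)])
    then show "a \<otimes> x \<in> ?J" if "a \<in> ?J" "x \<in> carrier R" for a x
      using that m_comm[of a x] by simp
  qed
  moreover have "Y \<subseteq> ?J"
  proof
    fix y assume y: "y \<in> Y"
    then obtain m where "y \<in> \<A> m" using Y(2) by (auto simp: homogeneous_element_def)
    then show "y \<in> ?J"
      using genideal_self[OF Y(1)] y Yc(1) Y(1) by (auto simp: component_homogeneous)
  qed
  ultimately have "Idl Y \<subseteq> ?J" by (rule genideal_minimal)
  then show ?thesis using s by blast
qed

end

text \<open>Since \<open>\<A> 0\<close> is a field, \<open>a \<in> I\<close> has no component in degree \<open>0\<close>; hence \<open>y ^ n\<close> is a homogeneous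
  component of \<open>y ^ n (1 - a)\<close> whenever \<open>y\<close> is homogeneous.\<close>

lemma graded_ring_nilpotent:
  assumes R: "standard_graded_ring R \<A>" and I: "homogeneous_ideal R \<A> I" "I \<noteq> carrier R" and a: "a \<in> I"
    and X: "X \<subseteq> carrier R" "\<And>x. x \<in> X \<Longrightarrow> homogeneous_element \<A> x"
    and pow: "\<And>y. y \<in> I \<Longrightarrow> \<exists>n::nat. y [^]\<^bsub>R\<^esub> n \<otimes>\<^bsub>R\<^esub> (\<one>\<^bsub>R\<^esub> \<ominus>\<^bsub>R\<^esub> a) \<in> Idl\<^bsub>R\<^esub> X" and y: "y \<in> I"
  shows "\<exists>n::nat. y [^]\<^bsub>R\<^esub> n \<in> Idl\<^bsub>R\<^esub> X"
proof -
  interpret noetherian_cring R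
    using R by (simp add: standard_graded_ring_def noetherian_cring_def)
  interpret graded_ring R \<A>
    using R by unfold_locales (simp add: standard_graded_ring_def)
  let ?Y = "{a \<in> I. homogeneous_element \<A> a}"
  have idI: "ideal I R" and IY: "I = Idl\<^bsub>R\<^esub> ?Y" using I(1) by (auto simp: homogeneous_ideal_def)
  note Ic = ideal_closed[OF idI]
  have YR: "?Y \<subseteq> carrier R" using Ic(2) by blast
  have sf: "subfield (\<A> 0) R" using R by (simp add: standard_graded_ring_def)
  have one: "\<one>\<^bsub>R\<^esub> \<in> \<A> 0"
    by (rule subringE(3)[OF subfieldE(1)[OF sf]])
  have aR: "a \<in> carrier R" using Ic(2) a .
  have a0: "component a 0 = \<zero>\<^bsub>R\<^esub>"
  proof (rule ccontr)
    assume nz: "component a 0 \<noteq> \<zero>\<^bsub>R\<^esub>"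
    have "component a 0 \<in> \<A> 0" by (rule component_A[OF aR])
    then have "component a 0 \<in> \<A> 0 - {\<zero>\<^bsub>R\<^esub>}" using nz by blast
    note inv = subfield_m_inv(1,2)[OF sf this]
    then obtain v where v: "v \<in> \<A> 0" "component a 0 \<otimes>\<^bsub>R\<^esub> v = \<one>\<^bsub>R\<^esub>" by blast
    have "component a 0 \<in> I"
      using component_genideal[OF YR, of a 0] a IY by auto
    then have "\<one>\<^bsub>R\<^esub> \<in> I" using Ic(7)[of v "component a 0"] v by simp
    then show False using ideal.one_imp_carrier[OF idI] I(2) by blast
  qed
  show ?thesis
  \<comment> \<open>An arbitrary \<open>y\<close> is not homogeneous, so the claim is first reduced
    to the homogeneous generators of \<open>I\<close>.\<close>
  proof (rule pow_mem_if_generators_pow_mem[OF genideal_ideal[OF X(1)] YR])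
    show "y \<in> Idl\<^bsub>R\<^esub> ?Y" using y IY by simp
    fix z assume "z \<in> ?Y"
    then obtain k where z: "z \<in> I" "z \<in> \<A> k" by (auto simp: homogeneous_element_def)
    obtain n :: nat where n: "z [^]\<^bsub>R\<^esub> n \<otimes>\<^bsub>R\<^esub> (\<one>\<^bsub>R\<^esub> \<ominus>\<^bsub>R\<^esub> a) \<in> Idl\<^bsub>R\<^esub> X" using pow z(1) by blast
    have zn: "z [^]\<^bsub>R\<^esub> (n::nat) \<in> \<A> (k * n)" for n
    proof (induction n)
      case (Suc n)
      then show ?case using A_mult[OF Suc z(2)] by (simp add: add.commute)
    qed (simp add: one)
    have uR: "\<one>\<^bsub>R\<^esub> \<ominus>\<^bsub>R\<^esub> a \<in> carrier R" using aR by simp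
    have "(\<one>\<^bsub>R\<^esub> \<ominus>\<^bsub>R\<^esub> a) \<oplus>\<^bsub>R\<^esub> a = \<one>\<^bsub>R\<^esub>" using aR by (simp add: a_minus_def a_assoc l_neg)
    then have "component (\<one>\<^bsub>R\<^esub> \<ominus>\<^bsub>R\<^esub> a) 0 \<oplus>\<^bsub>R\<^esub> component a 0 = \<one>\<^bsub>R\<^esub>"
      using component_add[OF uR aR] component_homogeneous[OF one] by metis
    then have u0: "component (\<one>\<^bsub>R\<^esub> \<ominus>\<^bsub>R\<^esub> a) 0 = \<one>\<^bsub>R\<^esub>"
      using component_carrier[OF uR] by (simp add: a0)
    have "component (z [^]\<^bsub>R\<^esub> n \<otimes>\<^bsub>R\<^esub> (\<one>\<^bsub>R\<^esub> \<ominus>\<^bsub>R\<^esub> a)) (k * n) = z [^]\<^bsub>R\<^esub> n"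
      using component_mult[OF zn uR] u0 z(2) by simp
    then show "\<exists>n::nat. z [^]\<^bsub>R\<^esub> n \<in> Idl\<^bsub>R\<^esub> X" using component_genideal[OF X n] by metis
  qed
qed

section \<open>Comparison with local cohomology\<close>

text \<open>The zero module in front is realised by restricting the carrier of \<open>E 0\<close>,
  so that it has the type of the other terms.\<close>

definition augmented :: "(nat \<Rightarrow> ('a, 'm) module) \<Rightarrow> nat \<Rightarrow> ('a, 'm) module" where
  "augmented E j = (case j of 0 \<Rightarrow> (E 0)\<lparr>carrier := {\<zero>\<^bsub>E 0\<^esub>}\<rparr> | Suc i \<Rightarrow> E i)"

definition augmented_d :: "(nat \<Rightarrow> ('a, 'm) module) \<Rightarrow> (nat \<Rightarrow> 'm \<Rightarrow> 'm) \<Rightarrow> nat \<Rightarrow> 'm \<Rightarrow> 'm" where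
  "augmented_d E d j = (case j of 0 \<Rightarrow> (\<lambda>_. \<zero>\<^bsub>E 0\<^esub>) | Suc i \<Rightarrow> d i)"

lemma augmented_simps [simp]:
  "augmented E 0 = (E 0)\<lparr>carrier := {\<zero>\<^bsub>E 0\<^esub>}\<rparr>" "augmented E (Suc i) = E i"
  "augmented_d E d 0 = (\<lambda>_. \<zero>\<^bsub>E 0\<^esub>)" "augmented_d E d (Suc i) = d i"
  by (simp_all add: augmented_def augmented_d_def)

lemma a_kernel_eq: "a_kernel M N h = {x \<in> carrier M. h x = \<zero>\<^bsub>N\<^esub>}"
  by (simp add: a_kernel_def kernel_def)

lemma torsion_resolution_augmented:
  assumes R: "noetherian_cring R" and res: "injective_resolution R (regular_module R) E d \<epsilon>"
    and xs: "regular_sequence R xs" and I: "ideal I R" "set xs \<subseteq> I"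
  shows "torsion_resolution R (augmented E) (augmented_d E d) xs (\<epsilon> \<one>\<^bsub>R\<^esub>) I"
proof -
  interpret noetherian_cring R by fact
  have inj: "injective_module R (E i)" and d: "d i \<in> mod_hom R (E i) (E (Suc i))"
    and eps: "\<epsilon> \<in> mod_hom R (regular_module R) (E 0)" "inj_on \<epsilon> (carrier R)"
    and ker0: "{x \<in> carrier (E 0). d 0 x = \<zero>\<^bsub>E 1\<^esub>} = \<epsilon> ` carrier R"
    and ker: "{x \<in> carrier (E (Suc i)). d (Suc i) x = \<zero>\<^bsub>E (Suc (Suc i))\<^esub>} = d i ` carrier (E i)" for i
    using res unfolding injective_resolution_def a_kernel_eq by (auto simp: regular_module_def)
  have mE: "module R (E i)" for i using inj by (simp add: injective_module_def)
  interpret E: module R "E i" for i by (rule mE)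
  interpret A: module R "regular_module R" by (rule module_regular_module[OF is_cring])
  have sub0: "submodule {\<zero>\<^bsub>E 0\<^esub>} R (E 0)"
    by (rule E.submoduleI) (auto simp: E.M.minus_unique)
  have d0: "d i \<zero>\<^bsub>E i\<^esub> = \<zero>\<^bsub>E (Suc i)\<^esub>" for i by (rule mod_hom_zero[OF mE mE d])
  have mC: "module R (augmented E j)" for j
  proof (cases j)
    case 0
    then show ?thesis using submodule.submodule_is_module[OF sub0 mE] by simp
  qed (simp add: mE)
  have epsa: "\<epsilon> a = a \<odot>\<^bsub>E 0\<^esub> \<epsilon> \<one>\<^bsub>R\<^esub>" if "a \<in> carrier R" for a
    using mod_hom_smult[OF eps(1), of a "\<one>\<^bsub>R\<^esub>"] that by (simp add: regular_module_def)
  have eps0: "\<epsilon> \<zero>\<^bsub>R\<^esub> = \<zero>\<^bsub>E 0\<^esub>"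
    using mod_hom_zero[OF A.module_axioms mE eps(1)] by (simp add: regular_module_def)
  \<comment> \<open>Exactness at \<open>E 0\<close> makes the copy of \<open>R\<close> the cycles of
    degree 1, with the image of \<open>\<one>\<close> as generator.\<close>
  have cyc1: "cycles (augmented E) (augmented_d E d) (\<lambda>j. carrier (augmented E j)) (Suc 0) = \<epsilon> ` carrier R"
    using ker0 by (simp add: cycles_def)
  have mc: "module_complex R (augmented E) (augmented_d E d)"
  proof (intro module_complex.intro module_complex_axioms.intro R mC)
    show "augmented_d E d j \<in> mod_hom R (augmented E j) (augmented E (Suc j))" for j
    proof (cases j)
      case 0
      then show ?thesis by (auto simp: mod_hom_def)
    qed (simp add: d)
    show "augmented_d E d (Suc j) (augmented_d E d j x) = \<zero>\<^bsub>augmented E (Suc (Suc j))\<^esub>"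
      if "x \<in> carrier (augmented E j)" for x j
    proof (cases j)
      case 0
      then show ?thesis by (simp add: d0)
    next
      case (Suc i)
      then have "d i x \<in> d i ` carrier (E i)" using that by simp
      then have "d (Suc i) (d i x) = \<zero>\<^bsub>E (Suc (Suc i))\<^esub>" unfolding ker[symmetric] by blast
      then show ?thesis using Suc by simp
    qed
  qed
  show ?thesis
  proof (intro torsion_resolution.intro torsion_resolution_axioms.intro regular_resolution.intro
      regular_resolution_axioms.intro mc xs I)
    show "carrier (augmented E 0) = {\<zero>\<^bsub>augmented E 0\<^esub>}" by simp
    show "baer R {\<zero>\<^bsub>R\<^esub>} (augmented E j) (carrier (augmented E j))" for j
    proof (cases j)
      case 0
      show ?thesis
        unfolding baer_def
      proof (intro allI impI, elim conjE)
        fix T assume T: "linear_graph R (augmented E j) T"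
        have "v = a \<odot>\<^bsub>augmented E j\<^esub> \<zero>\<^bsub>E 0\<^esub>" if "(a, v) \<in> T" for a v
          using linear_graphD(1,2)[OF T that] 0 by simp
        then show "\<exists>s\<in>carrier (augmented E j). \<forall>(a, v)\<in>T. v = a \<odot>\<^bsub>augmented E j\<^esub> s"
          using 0 by auto
      qed
    next
      case (Suc i)
      then show ?thesis using baer_injective[OF inj] by simp
    qed
    show "exact_at (augmented E) (augmented_d E d) (\<lambda>j. carrier (augmented E j)) j" if "j \<noteq> 0" for j
    proof -
      obtain i where "j = Suc i" using \<open>j \<noteq> 0\<close> by (cases j) auto
      then show ?thesis using ker[of i] by (simp add: exact_at_def cycles_def)
    qed
    show "\<epsilon> \<one>\<^bsub>R\<^esub> \<in> cycles (augmented E) (augmented_d E d) (\<lambda>j. carrier (augmented E j)) (Suc 0)"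
      unfolding cyc1 by simp
    show "a = \<zero>\<^bsub>R\<^esub>" if "a \<in> carrier R" "a \<odot>\<^bsub>augmented E (Suc 0)\<^esub> \<epsilon> \<one>\<^bsub>R\<^esub> = \<zero>\<^bsub>augmented E (Suc 0)\<^esub>" for a
    proof (rule inj_onD[OF eps(2)])
      show "\<epsilon> a = \<epsilon> \<zero>\<^bsub>R\<^esub>" using that(2) epsa[OF that(1)] eps0 by simp
    qed (use that in simp_all)
    show "\<exists>a\<in>carrier R. z = a \<odot>\<^bsub>augmented E (Suc 0)\<^esub> \<epsilon> \<one>\<^bsub>R\<^esub>"
      if "z \<in> cycles (augmented E) (augmented_d E d) (\<lambda>j. carrier (augmented E j)) (Suc 0)" for z
    proof -
      obtain a where "a \<in> carrier R" "z = \<epsilon> a" using \<open>z \<in> _\<close> unfolding cyc1 by blast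
      then show ?thesis using epsa[of a] by (intro bexI[of _ a]) simp_all
    qed
  qed
qed

context torsion_resolution
begin

text \<open>The definition of torsion asks for one power of \<open>I\<close>,
  \<open>power_torsion\<close> for a power of each element. They agree because \<open>I\<close> is
  finitely generated: an ideal containing a power of each element of \<open>I\<close> contains a
  power of \<open>I\<close>.\<close>

lemma torsion_eq: "torsion R I (C j) = (C j)\<lparr>carrier := G 0 j\<rparr>"
proof -
  have "(\<exists>n::nat. \<forall>a\<in>I [^]\<^bsub>ideals_set R\<^esub> n. a \<odot>\<^bsub>C j\<^esub> m = \<zero>\<^bsub>C j\<^esub>) \<longleftrightarrow>
      (\<forall>y\<in>I. \<exists>n::nat. (y [^] n) \<odot>\<^bsub>C j\<^esub> m = \<zero>\<^bsub>C j\<^esub>)" if m: "m \<in> carrier (C j)" for m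
  proof
    assume "\<exists>n::nat. \<forall>a\<in>I [^]\<^bsub>ideals_set R\<^esub> n. a \<odot>\<^bsub>C j\<^esub> m = \<zero>\<^bsub>C j\<^esub>"
    then show "\<forall>y\<in>I. \<exists>n::nat. (y [^] n) \<odot>\<^bsub>C j\<^esub> m = \<zero>\<^bsub>C j\<^esub>"
      using pow_mem_ideals_pow[OF I] by blast
  next
    assume *: "\<forall>y\<in>I. \<exists>n::nat. (y [^] n) \<odot>\<^bsub>C j\<^esub> m = \<zero>\<^bsub>C j\<^esub>"
    have "Idl I = I" using genideal_minimal[OF I order_refl] genideal_self[OF I_carrier] by blast
    moreover have "\<exists>n::nat. (Idl I) [^]\<^bsub>ideals_set R\<^esub> n \<subseteq> annihilator R (C j) m"
    proof (rule ideals_pow_subset[OF C.ideal_annihilator[OF m] I_carrier])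
      fix y assume y: "y \<in> I"
      then obtain n :: nat where "(y [^] n) \<odot>\<^bsub>C j\<^esub> m = \<zero>\<^bsub>C j\<^esub>" using * by blast
      moreover have "y \<in> carrier R" using y I_carrier by blast
      ultimately show "\<exists>k::nat. y [^] k \<in> annihilator R (C j) m" unfolding annihilator_def by auto
    qed
    ultimately show "\<exists>n::nat. \<forall>a\<in>I [^]\<^bsub>ideals_set R\<^esub> n. a \<odot>\<^bsub>C j\<^esub> m = \<zero>\<^bsub>C j\<^esub>"
      unfolding annihilator_def by auto
  qed
  then have "{m \<in> carrier (C j). \<exists>n::nat. \<forall>a\<in>I [^]\<^bsub>ideals_set R\<^esub> n. a \<odot>\<^bsub>C j\<^esub> m = \<zero>\<^bsub>C j\<^esub>} = G 0 j"
    unfolding G_def F_0 power_torsion_def by blast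
  then show ?thesis unfolding torsion_def by simp
qed

end

lemma local_cohomology_eq:
  assumes "torsion_resolution R (augmented E) (augmented_d E d) xs e0 I"
  shows "local_cohomology R I E d i =
    torsion_resolution.H R (augmented E) (augmented_d E d) xs I i"
proof -
  interpret torsion_resolution R "augmented E" "augmented_d E d" xs e0 I by fact
  have tors: "torsion R I (E j) = (E j)\<lparr>carrier := G 0 (Suc j)\<rparr>" for j
    using torsion_eq[of "Suc j"] by simp
  have ker: "a_kernel (torsion R I (E i)) (torsion R I (E (Suc i))) (d i) =
      cycles (augmented E) (augmented_d E d) (G 0) (Suc i)"
    unfolding tors a_kernel_eq cycles_def by simp
  have im: "(case i of 0 \<Rightarrow> {\<zero>\<^bsub>torsion R I (E 0)\<^esub>} | Suc j \<Rightarrow> d j ` carrier (torsion R I (E j))) =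
      augmented_d E d i ` G 0 i"
  \<comment> \<open>For \<open>i = 0\<close> the differential out of the added zero term has image
    zero, which matches the separate clause for degree 0 in the definition of cohomology.\<close>
  proof (cases i)
    case 0
    have "G 0 0 \<noteq> {}" using G.sub_zero by blast
    then show ?thesis using 0 by (auto simp: tors)
  next
    case (Suc j)
    then show ?thesis by (simp add: tors)
  qed
  show ?thesis
    unfolding local_cohomology_def cohomology_def H_def ker im by (simp add: tors)
qed

theorem theorem3p1:
  fixes R :: "('a, 'c) ring_scheme"
    and I :: "'a set"
    and xs :: "'a list"
    and E :: "nat \<Rightarrow> ('a, 'b) module"
    and d :: "nat \<Rightarrow> 'b \<Rightarrow> 'b"
    and \<epsilon> :: "'a \<Rightarrow> 'b"
  assumes ring: "noetherian_local_ring R \<or>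
      (\<exists>\<A>. standard_graded_ring R \<A> \<and> homogeneous_ideal R \<A> I \<and>
        (\<forall>x\<in>set xs. homogeneous_element \<A> x))"
    and ideal: "ideal I R"
    and regular: "regular_sequence R xs"
    and contained: "set xs \<subseteq> I"
    and resolution: "injective_resolution R (regular_module R) E d \<epsilon>"
  shows "radical R I = radical R (Idl\<^bsub>R\<^esub> (set xs)) \<longleftrightarrow>
      coregular_sequence R I (local_cohomology R I E d (length xs)) xs \<and>
      (\<forall>i>length xs. zero_module (local_cohomology R I E d i))"
proof -
  interpret noetherian_cring R
    using ring by (auto simp: noetherian_local_ring_def standard_graded_ring_def noetherian_cring_def)
  interpret torsion_resolution R "augmented E" "augmented_d E d" xs "\<epsilon> \<one>\<^bsub>R\<^esub>" I
    by (rule torsion_resolution_augmented[OF noetherian_cring_axioms resolution regular ideal contained])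
  have J: "ideal (Idl\<^bsub>R\<^esub> (set xs)) R" by (rule genideal_ideal[OF xs_carrier(1)])
  have "\<forall>y\<in>I. \<exists>n::nat. y [^]\<^bsub>R\<^esub> n \<in> Idl\<^bsub>R\<^esub> (set xs)"
    if IR: "I \<noteq> carrier R" and a: "a \<in> I"
      and pow: "\<forall>y\<in>I. \<exists>n::nat. y [^]\<^bsub>R\<^esub> n \<otimes>\<^bsub>R\<^esub> (\<one>\<^bsub>R\<^esub> \<ominus>\<^bsub>R\<^esub> a) \<in> Idl\<^bsub>R\<^esub> (set xs)" for a
    using ring
  proof (elim disjE exE conjE)
    assume local: "noetherian_local_ring R"
    show ?thesis
    proof
      fix y assume y: "y \<in> I"
      then obtain n :: nat where n: "y [^]\<^bsub>R\<^esub> n \<otimes>\<^bsub>R\<^esub> (\<one>\<^bsub>R\<^esub> \<ominus>\<^bsub>R\<^esub> a) \<in> Idl\<^bsub>R\<^esub> (set xs)" using pow by blast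
      have "y [^]\<^bsub>R\<^esub> n \<in> carrier R" using y I_carrier by blast
      then show "\<exists>n::nat. y [^]\<^bsub>R\<^esub> n \<in> Idl\<^bsub>R\<^esub> (set xs)"
        using local_ring_mult_cancel[OF local ideal IR a J _ n] by blast
    qed
  next
    fix \<A> assume "standard_graded_ring R \<A>" "homogeneous_ideal R \<A> I"
      "\<forall>x\<in>set xs. homogeneous_element \<A> x"
    then show ?thesis
      using graded_ring_nilpotent[OF _ _ IR a xs_carrier(1)] pow by blast
  qed
  then show ?thesis
    using coregular_sequence_iff unfolding local_cohomology_eq[OF torsion_resolution_axioms] by blast
qed

end
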